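(* For every $\epsilon>0$ and $K\neq0$ there is a spiral periodic orbit $\mathbf r(t)$ of the fixed homogeneous circle problem with angular momentum $K$ and such that $\mathrm{dist}(\mathbf r(t),\mathcal C)\le\epsilon$ for all $t$. Moreover, (the trace of) its canonical projection orbit is a simple closed curve, symmetric with respect to the horizontal plane (i.e. under $(r,z)\mapsto(r,-z)$), and encloses the point $x_{\mathcal C}$ with $rz$-coordinates $(1,0)$.
   Context: $\mathcal C=\{(x,y,0)\in\mathbb R^3: x^2+y^2=1\}$ is the unit circle in the $xy$-plane centered at the origin, with constant mass density $\lambda>0$. Its potential is $V(\mathbf r)=-\int_{\mathcal C}\frac{\lambda\,du}{\|\mathbf r-u\|}$ for $\mathbf r\in\mathbb R^3\setminus\mathcal C$ ($du$ is arc length). The fixed homogeneous circle problem is the differential equation $\ddot{\mathbf r}=-\nabla V(\mathbf r)$ in $\mathbb R^3\setminus\mathcal C$; an orbit is a solution of it. Writing an orbit in cylindrical coordinates, $\mathbf r(t)=(r(t)\cos\varphi(t),r(t)\sin\varphi(t),z(t))$, its canonical projection orbit is $(r(t),z(t))$, viewed in the half plane $\{(r,z): r\ge0\}$; the circle $\mathcal C$ projects to the point $x_{\mathcal C}=(1,0)$. The angular momentum (about the $z$-axis) of an orbit is the constant $r^2\dot\varphi=x\dot y-y\dot x$. A spiral orbit is an orbit not contained in a vertical plane (a plane containing the $z$-axis) whose canonical projection orbit is periodic. A spiral periodic orbit is a spiral orbit that is itself periodic in $\mathbb R^3$. $\mathrm{dist}$ is Euclidean distance. A simple closed curve in the $rz$-plane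 encloses a point if the point lies in the bounded component of its complement. *)

theory Defs
  imports "HOL-Analysis.Analysis"
begin

definition unit_circle :: "(real^3) set" where
  "unit_circle = {p. (p$1)\<^sup>2 + (p$2)\<^sup>2 = 1 \<and> p$3 = 0}"

definition circle_param :: "real \<Rightarrow> real^3" where
  "circle_param \<theta> = vector [cos \<theta>, sin \<theta>, 0]"

lemma circle_param_image: "circle_param ` {0..<2*pi} = unit_circle"
proof
  show "circle_param ` {0..<2*pi} \<subseteq> unit_circle"
    by (auto simp: circle_param_def unit_circle_def)
  show "unit_circle \<subseteq> circle_param ` {0..<2*pi}"
  proof
    fix p assume "p \<in> unit_circle"
    then have p: "(p$1)\<^sup>2 + (p$2)\<^sup>2 = 1" "p$3 = 0"
      by (auto simp: unit_circle_def)
    from p(1) obtain t where t: "0 \<le> t" "t < 2*pi" "p$1 = cos t" "p$2 = sin t"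
      by (rule sincos_total_2pi)
    have "p = circle_param t"
      using t p(2) by (simp add: circle_param_def vec_eq_iff forall_3)
    with t show "p \<in> circle_param ` {0..<2*pi}" by auto
  qed
qed

text \<open>Since \<^term>\<open>circle_param\<close> has unit speed, the angle is arc length on the circle.
  The value on the circle itself is irrelevant, as orbits avoid it.\<close>

definition potential :: "real \<Rightarrow> real^3 \<Rightarrow> real" where
  "potential lam p = - integral {0..2*pi} (\<lambda>\<theta>. lam / norm (p - circle_param \<theta>))"

text \<open>Solutions are taken to be defined for all times, as periodicity of the (projected)
  orbit requires.\<close>

definition orbit :: "real \<Rightarrow> (real \<Rightarrow> real^3) \<Rightarrow> bool" where
  "orbit lam q \<longleftrightarrow>
     (\<exists>v a. \<forall>t. q t \<notin> unit_circle
        \<and> (q has_vector_derivative v t) (at t)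
        \<and> (v has_vector_derivative a t) (at t)
        \<and> GDERIV (potential lam) (q t) :> - a t)"

definition angular_momentum :: "(real \<Rightarrow> real^3) \<Rightarrow> real \<Rightarrow> real" where
  "angular_momentum q t =
     q t $ 1 * vector_derivative q (at t) $ 2 - q t $ 2 * vector_derivative q (at t) $ 1"

definition canonical_projection :: "(real \<Rightarrow> real^3) \<Rightarrow> real \<Rightarrow> real \<times> real" where
  "canonical_projection q t = (sqrt ((q t $ 1)\<^sup>2 + (q t $ 2)\<^sup>2), q t $ 3)"

definition periodic :: "(real \<Rightarrow> 'a) \<Rightarrow> bool" where
  "periodic f \<longleftrightarrow> (\<exists>T>0. periodic_fun_simple f T)"

definition vertical_plane :: "(real^3) set \<Rightarrow> bool" where
  "vertical_plane P \<longleftrightarrow> affine P \<and> aff_dim P = 2 \<and> {p. p$1 = 0 \<and> p$2 = 0} \<subseteq> P"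

definition spiral_orbit :: "real \<Rightarrow> (real \<Rightarrow> real^3) \<Rightarrow> bool" where
  "spiral_orbit lam q \<longleftrightarrow> orbit lam q
     \<and> \<not> (\<exists>P. vertical_plane P \<and> range q \<subseteq> P)
     \<and> periodic (canonical_projection q)"

definition spiral_periodic_orbit :: "real \<Rightarrow> (real \<Rightarrow> real^3) \<Rightarrow> bool" where
  "spiral_periodic_orbit lam q \<longleftrightarrow> spiral_orbit lam q \<and> periodic q"

definition simple_closed_curve :: "'a::topological_space set \<Rightarrow> bool" where
  "simple_closed_curve S \<longleftrightarrow>
     (\<exists>g. simple_path g \<and> pathfinish g = pathstart g \<and> path_image g = S)"

end

theory Submission
  imports Defs
begin

text \<open>Near the circle the potential behaves like \<open>2 lam\<close> times the logarithm of the distance,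
  because a short arc looks like a straight wire. In the half plane \<open>(r, z)\<close> an orbit with angular
  momentum \<open>K\<close> moves in the potential \<open>V + K\<^sup>2 / (2 r\<^sup>2)\<close>. The pull of the pole \<open>(1, 0)\<close> grows like
  the reciprocal of the distance, so on a small scale the centrifugal term, with \<open>K\<close> fixed, is
  negligible, and the motion is a small perturbation of the planar logarithmic problem. That problem
  has circular orbits, and radial oscillations around them have frequency \<open>sqrt 2\<close> per unit of
  polar angle. As \<open>sqrt 2\<close> is not an integer, there is no resonance with the angular period \<open>2 pi\<close>,
  and the circular orbits persist as closed orbits of the perturbed problem.

  Concretely, put \<open>r = 1 + exp s * cos x\<close> and \<open>z = exp s * sin x\<close>, with the polar angle \<open>x\<close> around
  the pole as independent variable; let \<open>q\<close> be the derivative of \<open>s\<close>, let \<open>L = exp (2 s) * dx/dt\<close> be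
  the momentum about the pole, and let \<open>exp b = 2 * lam * exp (2 s) / L\<^sup>2\<close>. The equations of motion become
  \<open>s' = q\<close>, \<open>q' = 1 + q\<^sup>2 - exp b * (1 + g - q * h)\<close>, \<open>b' = 2 * q + 2 * exp b * h\<close>, where the radial and
  the angular part of the force enter through the defects \<open>g (s, x)\<close> and \<open>h (s, x)\<close>. Both defects, and
  their Lipschitz constants in \<open>s\<close>, tend to \<open>0\<close> as \<open>s\<close> tends to minus infinity (\<open>defects_small\<close>).
  With \<open>Z = sqrt 2 * q + \<i> * b\<close> the linear part is \<open>Z' = \<i> * sqrt 2 * Z\<close>, whose inhomogeneous version
  has a unique \<open>2 pi\<close>-periodic solution, given by an explicit integral operator. So for every very
  negative mean value \<open>\<sigma>\<close> of \<open>s\<close> a contraction on periodic functions with the reflection symmetry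
  of the problem yields a solution that depends continuously on \<open>\<sigma>\<close> (\<open>family_solves_equations\<close>,
  \<open>family_lipschitz\<close>).

  Since \<open>s\<close> is an even \<open>2 pi\<close>-periodic function of the polar angle, the trace in the half plane is a
  polar graph around \<open>(1, 0)\<close>: a symmetric simple closed curve around the pole. Over one turn the
  meridian plane rotates by \<open>K\<close> times the integral of \<open>dt / r\<^sup>2\<close>. This angle is nonzero, is continuous
  in \<open>\<sigma>\<close>, and tends to \<open>0\<close> with the size of the orbit; so it equals \<open>2 pi / n\<close> up to sign for a suitable
  \<open>n\<close> and \<open>\<sigma>\<close>, and then the orbit closes up in space after \<open>n\<close> turns
  (\<open>spiral_periodic_orbit_exists\<close>).\<close>

section \<open>Integrals of periodic functions\<close>

lemma antiderivative_on_line: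
  fixes f :: "real \<Rightarrow> 'a::euclidean_space"
  assumes "continuous_on UNIV f"
  obtains F where "\<And>x. (F has_vector_derivative f x) (at x)"
proof -
  have "\<And>x. isCont f x"
    using assms by (simp add: continuous_on_eq_continuous_at)
  then have "\<exists>F. \<forall>x::real. -\<infinity> < ereal x \<longrightarrow> ereal x < \<infinity> \<longrightarrow> (F has_vector_derivative f x) (at x)"
    by (intro einterval_antiderivative) auto
  then show ?thesis using that by auto
qed

lemma integral_eq_increment:
  fixes F :: "real \<Rightarrow> 'a::euclidean_space"
  assumes "\<And>x. (F has_vector_derivative f x) (at x)" "a \<le> b"
  shows "integral {a..b} f = F b - F a"
  by (intro integral_unique fundamental_theorem_of_calculus assms(2)
      has_vector_derivative_at_within[OF assms(1)])

lemma has_vector_derivative_shift: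
  assumes "\<And>x. (F has_vector_derivative f x) (at x)"
  shows "((\<lambda>x. F (x + c)) has_vector_derivative f (x + c)) (at x)"
  by (rule has_vector_derivative_eq_rhs, rule vector_diff_chain_at[unfolded o_def, of "\<lambda>x. x + c" 1 x F "f (x + c)"])
    (auto intro!: derivative_eq_intros assms)

text \<open>The difference has derivative zero by periodicity. Integrals over a period, the time for one
  turn and the rotation per turn are all increments of this kind.\<close>

lemma increment_over_period_constant:
  fixes F :: "real \<Rightarrow> 'a::euclidean_space"
  assumes F: "\<And>x. (F has_vector_derivative f x) (at x)"
    and per: "\<And>x. f (x + T) = f x"
  shows "F (x + T) - F x = F T - F 0"
proof -
  have "((\<lambda>x. F (x + T) - F x) has_vector_derivative 0) (at x)" for x
    using has_vector_derivative_diff[OF has_vector_derivative_shift[of F f T x, OF F] F[of x]]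
    by (simp add: per)
  then have "((\<lambda>x. F (x + T) - F x) has_derivative (\<lambda>h. 0)) (at x within UNIV)" for x
    by (simp add: has_vector_derivative_def)
  then obtain c where "\<And>x. F (x + T) - F x = c"
    using has_derivative_zero_constant[of UNIV "\<lambda>x. F (x + T) - F x"] by auto
  from this[of x] this[of 0] show ?thesis by simp
qed

lemma integral_shift:
  fixes f :: "real \<Rightarrow> 'a::euclidean_space"
  assumes "continuous_on UNIV f" "a \<le> b"
  shows "integral {a..b} (\<lambda>x. f (x + c)) = integral {a + c..b + c} f"
proof -
  obtain F where F: "\<And>x. (F has_vector_derivative f x) (at x)"
    using antiderivative_on_line[OF assms(1)] by blast
  show ?thesis
    using integral_eq_increment[OF has_vector_derivative_shift[of F f c, OF F] assms(2)]
      integral_eq_increment[OF F, of "a + c" "b + c"] assms(2) by simp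
qed

lemma integral_period_shift:
  fixes f :: "real \<Rightarrow> 'a::euclidean_space"
  assumes cont: "continuous_on UNIV f" and per: "\<And>x. f (x + T) = f x" and "T \<ge> 0"
  shows "integral {a..a + T} f = integral {0..T} f"
proof -
  obtain F where F: "\<And>x. (F has_vector_derivative f x) (at x)"
    using antiderivative_on_line[OF cont] by blast
  show ?thesis
    using increment_over_period_constant[of F f T a, OF F per]
      integral_eq_increment[OF F, of a "a + T"] integral_eq_increment[OF F, of 0 T] \<open>T \<ge> 0\<close>
    by simp
qed

lemma integral_reverse:
  fixes f :: "real \<Rightarrow> 'a::euclidean_space"
  assumes cont: "continuous_on UNIV f" and "T \<ge> 0"
  shows "integral {0..T} (\<lambda>v. f (T - v)) = integral {0..T} f"
proof -
  obtain F where F: "\<And>x. (F has_vector_derivative f x) (at x)"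
    using antiderivative_on_line[OF cont] by blast
  have "((\<lambda>v. - F (T - v)) has_vector_derivative f (T - v)) (at v)" for v
    by (rule has_vector_derivative_eq_rhs, rule has_vector_derivative_minus,
        rule vector_diff_chain_at[unfolded o_def, of "\<lambda>v. T - v" "-1" v F "f (T - v)"])
      (auto intro!: derivative_eq_intros F)
  from integral_eq_increment[OF this \<open>T \<ge> 0\<close>] integral_eq_increment[OF F \<open>T \<ge> 0\<close>]
  show ?thesis by simp
qed

text \<open>Reflecting a period about its midpoint changes the sign of the integrand.\<close>

lemma integral_odd_period:
  fixes f :: "real \<Rightarrow> real"
  assumes cont: "continuous_on UNIV f" and per: "\<And>x. f (x + 2 * pi) = f x"
    and odd: "\<And>x. f (- x) = - f x"
  shows "integral {a..a + 2 * pi} f = 0"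
proof -
  have "f (2 * pi - v) = - f v" for v
    using per[of "- v"] odd[of v] by (simp add: algebra_simps)
  then have "integral {0..2 * pi} f = - integral {0..2 * pi} f"
    using integral_reverse[OF cont, of "2 * pi"] by simp
  then show ?thesis
    using integral_period_shift[OF cont per, of a] by simp
qed

section \<open>Periodic solutions of the linearised equations\<close>

text \<open>Integration by parts shows that this is a primitive of a periodic function with mean zero; it is
  the one with mean zero. Unlike an integral from a base point it is visibly periodic and needs no
  case distinction on the sign of \<open>x\<close>.\<close>

definition periodic_primitive :: "(real \<Rightarrow> real) \<Rightarrow> real \<Rightarrow> real" where
  "periodic_primitive q x = integral {0..2 * pi} (\<lambda>v. v * q (x + v)) / (2 * pi)"

text \<open>Substituting \<open>u = x + v\<close> turns the weight into \<open>u - x\<close>; the part with weight \<open>x\<close> is an integral of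
  \<open>q\<close> over a full period, which vanishes because \<open>q\<close> is odd.\<close>

lemma periodic_primitive_has_derivative:
  assumes cont: "continuous_on UNIV q" and per: "\<And>x. q (x + 2 * pi) = q x"
    and odd: "\<And>x. q (- x) = - q x"
  shows "(periodic_primitive q has_real_derivative q x) (at x)"
proof -
  obtain H where H: "\<And>x. (H has_vector_derivative x * q x) (at x)"
    using antiderivative_on_line[OF continuous_on_mult[OF continuous_on_id cont]] by auto
  have "periodic_primitive q y = (H (y + 2 * pi) - H y) / (2 * pi)" for y
  proof -
    have "integral {0..2 * pi} (\<lambda>v. v * q (y + v))
        = integral {0..2 * pi} (\<lambda>v. (v + y) * q (v + y) - y * q (v + y))"
      by (simp add: algebra_simps)
    also have "\<dots> = integral {0..2 * pi} (\<lambda>v. (v + y) * q (v + y))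
        - integral {0..2 * pi} (\<lambda>v. y * q (v + y))"
      by (intro integral_diff integrable_continuous_interval)
        (auto intro!: continuous_intros continuous_on_compose2[OF cont])
    also have "integral {0..2 * pi} (\<lambda>v. (v + y) * q (v + y)) = H (y + 2 * pi) - H y"
      using integral_shift[of "\<lambda>x. x * q x" 0 "2 * pi" y] cont integral_eq_increment[OF H, of y "y + 2 * pi"]
      by (simp add: add.commute continuous_intros)
    also have "integral {0..2 * pi} (\<lambda>v. y * q (v + y)) = 0"
      using integral_shift[OF cont, of 0 "2 * pi" y] integral_odd_period[OF cont per odd, of y]
      by (simp add: add.commute)
    finally show ?thesis by (simp add: periodic_primitive_def)
  qed
  then have *: "periodic_primitive q = (\<lambda>y. (H (y + 2 * pi) - H y) / (2 * pi))" by blast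
  have "((\<lambda>y. H (y + 2 * pi)) has_real_derivative (x + 2 * pi) * q (x + 2 * pi)) (at x)"
    using has_vector_derivative_shift[of H "\<lambda>x. x * q x" "2 * pi" x, OF H]
    by (simp add: has_real_derivative_iff_has_vector_derivative)
  moreover have "(H has_real_derivative x * q x) (at x)"
    using H by (simp add: has_real_derivative_iff_has_vector_derivative)
  ultimately show ?thesis
    unfolding * by (auto intro!: derivative_eq_intros simp: per[of x] divide_simps)
      (simp add: algebra_simps per[of x])?
qed

lemma periodic_primitive_periodic:
  assumes "\<And>x. q (x + 2 * pi) = q x"
  shows "periodic_primitive q (x + 2 * pi) = periodic_primitive q x"
  using assms[of "x + v" for v] by (simp add: periodic_primitive_def algebra_simps)

lemma periodic_primitive_even:
  assumes cont: "continuous_on UNIV q" and per: "\<And>x. q (x + 2 * pi) = q x"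
    and odd: "\<And>x. q (- x) = - q x"
  shows "periodic_primitive q (- x) = periodic_primitive q x"
proof -
  have refl: "q (- x + (2 * pi - v)) = - q (x + v)" for v
  proof -
    have "- x + (2 * pi - v) = - (x + v) + 2 * pi" by simp
    then show ?thesis by (simp only: per odd)
  qed
  have "integral {0..2 * pi} (\<lambda>v. v * q (- x + v))
      = integral {0..2 * pi} (\<lambda>v. (2 * pi - v) * q (- x + (2 * pi - v)))"
    by (rule integral_reverse[symmetric, of "\<lambda>v. v * q (- x + v)"])
      (auto intro!: continuous_intros continuous_on_compose2[OF cont])
  also have "\<dots> = integral {0..2 * pi} (\<lambda>v. v * q (x + v) - 2 * pi * q (v + x))"
    by (simp only: refl) (simp add: algebra_simps)
  also have "\<dots> = integral {0..2 * pi} (\<lambda>v. v * q (x + v)) - integral {0..2 * pi} (\<lambda>v. 2 * pi * q (v + x))"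
    by (intro integral_diff integrable_continuous_interval)
      (auto intro!: continuous_intros continuous_on_compose2[OF cont])
  also have "integral {0..2 * pi} (\<lambda>v. 2 * pi * q (v + x)) = 0"
    using integral_shift[OF cont, of 0 "2 * pi" x] integral_odd_period[OF cont per odd, of x]
    by (simp add: add.commute)
  finally show ?thesis by (simp add: periodic_primitive_def)
qed

lemma periodic_primitive_diff_le:
  assumes "continuous_on UNIV q" "continuous_on UNIV p" and C: "\<And>x. \<bar>q x - p x\<bar> \<le> C"
  shows "\<bar>periodic_primitive q x - periodic_primitive p x\<bar> \<le> 2 * pi * C"
proof -
  have "\<bar>integral {0..2 * pi} (\<lambda>v. v * q (x + v)) - integral {0..2 * pi} (\<lambda>v. v * p (x + v))\<bar>
     = norm (integral {0..2 * pi} (\<lambda>v. v * q (x + v) - v * p (x + v)))"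
    by (subst integral_diff)
      (auto intro!: integrable_continuous_interval continuous_intros continuous_on_compose2[OF assms(1)]
        continuous_on_compose2[OF assms(2)])
  also have "\<dots> \<le> (2 * pi * C) * (2 * pi - 0)"
  proof (rule integral_bound)
    show "norm (v * q (x + v) - v * p (x + v)) \<le> 2 * pi * C" if "v \<in> {0..2 * pi}" for v
    proof -
      have "\<bar>v * (q (x + v) - p (x + v))\<bar> \<le> 2 * pi * C"
        unfolding abs_mult using that C[of "x + v"] by (intro mult_mono) auto
      then show ?thesis by (simp add: algebra_simps)
    qed
  qed (auto intro!: continuous_intros continuous_on_compose2[OF assms(1)] continuous_on_compose2[OF assms(2)])
  finally show ?thesis
    by (simp add: periodic_primitive_def diff_divide_distrib[symmetric] abs_div field_simps)
qed

lemma periodic_primitive_0 [simp]: "periodic_primitive (\<lambda>_. 0) x = 0"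
  by (simp add: periodic_primitive_def)

text \<open>The variation-of-constants formula for \<open>Z' = \<i> * sqrt 2 * Z + M\<close> determines \<open>Z (x + 2 pi)\<close> from
  \<open>Z x\<close>. Requiring both to agree and solving for \<open>Z x\<close> gives \<open>periodic_oscillation\<close>; the division is
  possible because the free oscillation does not return to its initial phase after a turn.\<close>

definition oscillator_denom :: complex where
  "oscillator_denom = cis (- sqrt 2 * (2 * pi)) - 1"

definition periodic_oscillation :: "(real \<Rightarrow> complex) \<Rightarrow> real \<Rightarrow> complex" where
  "periodic_oscillation M x =
     integral {0..2 * pi} (\<lambda>v. cis (- sqrt 2 * v) * M (x + v)) / oscillator_denom"

text \<open>This is the absence of resonance: it holds because \<open>sqrt 2\<close> lies strictly between two
  consecutive integers.\<close>

lemma oscillator_denom_nonzero: "oscillator_denom \<noteq> 0"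
proof
  assume "oscillator_denom = 0"
  then have "cis (sqrt 2 * (2 * pi)) = 1"
    by (simp add: oscillator_denom_def flip: cis_inverse)
  then have "cos (sqrt 2 * (2 * pi)) = 1"
    by (metis cis.sel(1) one_complex.sel(1))
  then obtain n :: int where "sqrt 2 * (2 * pi) = of_int n * (2 * pi)"
    by (auto simp: cos_one_2pi_int)
  then have n: "sqrt 2 = of_int n" by simp
  have "1 < sqrt 2" by simp
  moreover have "sqrt 2 < 2" by (rule real_less_lsqrt) auto
  ultimately have "1 < n" "n < 2" unfolding n by linarith+
  then show False by simp
qed

lemma cis_has_vector_derivative:
  "((\<lambda>x. cis (c * x)) has_vector_derivative (\<i> * of_real c * cis (c * x))) (at x)"
proof -
  have "((\<lambda>x. \<i> * of_real (c * x)) has_vector_derivative \<i> * of_real c) (at x)"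
    by (auto intro!: derivative_eq_intros has_vector_derivative_of_real)
  from field_vector_diff_chain_at[OF this DERIV_exp] show ?thesis
    by (simp add: o_def cis_conv_exp)
qed

text \<open>After the substitution \<open>u = x + v\<close> the parameter occurs only in the factor \<open>cis (sqrt 2 * x)\<close> and
  in the limits of integration. The limits contribute \<open>M x\<close> times \<open>oscillator_denom\<close>, which the
  normalisation cancels.\<close>

lemma periodic_oscillation_has_derivative:
  assumes cont: "continuous_on UNIV M" and per: "\<And>x. M (x + 2 * pi) = M x"
  shows "(periodic_oscillation M has_vector_derivative
      (\<i> * sqrt 2 * periodic_oscillation M x + M x)) (at x)"
proof -
  define m where "m x = cis (- sqrt 2 * x) * M x" for x
  have cm: "continuous_on UNIV m"
    unfolding m_def using cont by (auto intro!: continuous_intros)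
  obtain G where G: "\<And>x. (G has_vector_derivative m x) (at x)"
    using antiderivative_on_line[OF cm] by blast
  have form: "periodic_oscillation M y = cis (sqrt 2 * y) * (G (y + 2 * pi) - G y) / oscillator_denom" for y
  proof -
    have "integral {0..2 * pi} (\<lambda>v. cis (- sqrt 2 * v) * M (y + v))
        = integral {0..2 * pi} (\<lambda>v. cis (sqrt 2 * y) * m (v + y))"
      unfolding m_def mult.assoc[symmetric] cis_mult by (simp add: algebra_simps)
    also have "\<dots> = cis (sqrt 2 * y) * integral {0..2 * pi} (\<lambda>v. m (v + y))"
      by simp
    also have "integral {0..2 * pi} (\<lambda>v. m (v + y)) = G (y + 2 * pi) - G y"
      using integral_shift[OF cm, of 0 "2 * pi" y] integral_eq_increment[OF G, of y "y + 2 * pi"]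
      by (simp add: add.commute)
    finally show ?thesis by (simp add: periodic_oscillation_def)
  qed
  have G2: "((\<lambda>y. G (y + 2 * pi)) has_vector_derivative m (x + 2 * pi)) (at x)"
    by (rule has_vector_derivative_shift[OF G])
  have jump: "cis (sqrt 2 * x) * (m (x + 2 * pi) - m x) = oscillator_denom * M x"
    unfolding m_def oscillator_denom_def per right_diff_distrib mult.assoc[symmetric] cis_mult
    by (simp add: algebra_simps)
  have "((\<lambda>y. cis (sqrt 2 * y) * (G (y + 2 * pi) - G y) / oscillator_denom) has_vector_derivative
     (cis (sqrt 2 * x) * (m (x + 2 * pi) - m x)
       + (\<i> * of_real (sqrt 2) * cis (sqrt 2 * x)) * (G (x + 2 * pi) - G x)) / oscillator_denom) (at x)"
    by (intro has_vector_derivative_divide has_vector_derivative_mult cis_has_vector_derivative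
        has_vector_derivative_diff G G2)
  moreover have "(oscillator_denom * M x
       + (\<i> * of_real (sqrt 2) * cis (sqrt 2 * x)) * (G (x + 2 * pi) - G x)) / oscillator_denom
     = \<i> * sqrt 2 * periodic_oscillation M x + M x"
    using oscillator_denom_nonzero by (simp add: form add_divide_distrib)
  ultimately show ?thesis
    unfolding form[abs_def] jump by simp
qed

lemma periodic_oscillation_periodic:
  assumes "\<And>x. M (x + 2 * pi) = M x"
  shows "periodic_oscillation M (x + 2 * pi) = periodic_oscillation M x"
  using assms[of "x + v" for v] by (simp add: periodic_oscillation_def algebra_simps)

text \<open>The symmetry of the forcing under reflection in the plane of the circle. It makes the real
  part of the response odd and the imaginary part even, as the slope and the momentum of a
  symmetric orbit must be.\<close>

lemma periodic_oscillation_reflect: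
  assumes cont: "continuous_on UNIV M" and per: "\<And>x. M (x + 2 * pi) = M x"
    and sym: "\<And>x. M (- x) = cnj (M x)"
  shows "periodic_oscillation M (- x) = - cnj (periodic_oscillation M x)"
proof -
  define \<omega> where "\<omega> = cis (- sqrt 2 * (2 * pi))"
  have \<omega>: "\<omega> * cnj \<omega> = 1" by (simp add: \<omega>_def cis_cnj cis_mult)
  have refl: "M (- x + (2 * pi - v)) = cnj (M (x + v))" for v
  proof -
    have "- x + (2 * pi - v) = - (x + v) + 2 * pi" by simp
    then show ?thesis by (simp only: per sym)
  qed
  have k: "cis (- sqrt 2 * (2 * pi - v)) = \<omega> * cnj (cis (- sqrt 2 * v))" for v
    by (simp add: \<omega>_def cis_cnj cis_mult algebra_simps)
  have "integral {0..2 * pi} (\<lambda>v. cis (- sqrt 2 * v) * M (- x + v))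
      = integral {0..2 * pi} (\<lambda>v. cis (- sqrt 2 * (2 * pi - v)) * M (- x + (2 * pi - v)))"
    by (rule integral_reverse[symmetric, of "\<lambda>v. cis (- sqrt 2 * v) * M (- x + v)"])
      (auto intro!: continuous_intros continuous_on_compose2[OF cont])
  also have "\<dots> = integral {0..2 * pi} (\<lambda>v. \<omega> * cnj (cis (- sqrt 2 * v) * M (x + v)))"
    by (simp only: refl k) (simp add: mult.assoc)
  also have "\<dots> = \<omega> * cnj (integral {0..2 * pi} (\<lambda>v. cis (- sqrt 2 * v) * M (x + v)))"
    by (simp add: integral_cnj del: complex_cnj_mult)
  finally have *: "integral {0..2 * pi} (\<lambda>v. cis (- sqrt 2 * v) * M (- x + v)) = \<dots>" .
  have "\<omega> / oscillator_denom = - 1 / cnj oscillator_denom"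
    using oscillator_denom_nonzero complex_cnj_zero_iff[of oscillator_denom] \<omega>
    unfolding oscillator_denom_def \<omega>_def[symmetric]
    by (simp add: field_simps del: complex_cnj_zero_iff)
  then show ?thesis
    unfolding periodic_oscillation_def *
    by (metis (no_types, lifting) complex_cnj_divide minus_divide_left mult_minus1
        times_divide_eq_left)
qed

lemma periodic_oscillation_diff_le:
  assumes "continuous_on UNIV M" "continuous_on UNIV N" and C: "\<And>x. norm (M x - N x) \<le> C"
  shows "norm (periodic_oscillation M x - periodic_oscillation N x)
    \<le> 2 * pi / norm oscillator_denom * C"
proof -
  have "norm (integral {0..2 * pi} (\<lambda>v. cis (- sqrt 2 * v) * M (x + v))
        - integral {0..2 * pi} (\<lambda>v. cis (- sqrt 2 * v) * N (x + v)))
     = norm (integral {0..2 * pi} (\<lambda>v. cis (- sqrt 2 * v) * M (x + v) - cis (- sqrt 2 * v) * N (x + v)))"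
    by (subst integral_diff)
      (auto intro!: integrable_continuous_interval continuous_intros continuous_on_compose2[OF assms(1)]
        continuous_on_compose2[OF assms(2)])
  also have "\<dots> \<le> C * (2 * pi - 0)"
  proof (rule integral_bound)
    show "norm (cis (- sqrt 2 * v) * M (x + v) - cis (- sqrt 2 * v) * N (x + v)) \<le> C" for v
      using C[of "x + v"] by (simp add: right_diff_distrib[symmetric] norm_mult)
  qed (auto intro!: continuous_intros continuous_on_compose2[OF assms(1)] continuous_on_compose2[OF assms(2)])
  finally show ?thesis
    using oscillator_denom_nonzero
    by (simp add: periodic_oscillation_def diff_divide_distrib[symmetric] norm_divide field_simps)
qed

lemma periodic_oscillation_0 [simp]: "periodic_oscillation (\<lambda>_. 0) x = 0"
  by (simp add: periodic_oscillation_def)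

section \<open>The force of the circle in cylindrical coordinates\<close>

lemma continuous_on_circle_param: "continuous_on S circle_param"
proof -
  have *: "circle_param = (\<lambda>t. \<chi> i. if i = 1 then cos t else if i = 2 then sin t else 0)"
    by (auto simp: circle_param_def fun_eq_iff vec_eq_iff forall_3)
  have "continuous_on S (\<lambda>t. if i = (1::3) then cos t else if i = 2 then sin t else (0::real))" for i
    by (cases "i = 1"; cases "i = 2") (auto intro!: continuous_intros)
  then show ?thesis
    unfolding * by (rule continuous_on_vec_lambda)
qed

lemma circle_param_nth:
  "circle_param t $ 1 = cos t" "circle_param t $ 2 = sin t" "circle_param t $ 3 = 0"
  by (simp_all add: circle_param_def)

lemma circle_param_in_unit_circle: "circle_param t \<in> unit_circle"
  by (simp add: circle_param_def unit_circle_def)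

lemma closed_unit_circle: "closed unit_circle"
proof -
  have "unit_circle = circle_param ` {0..2 * pi}"
    using circle_param_image circle_param_in_unit_circle by fastforce
  then show ?thesis
    using compact_continuous_image[OF continuous_on_circle_param compact_Icc] compact_imp_closed by metis
qed

text \<open>Differentiation under the integral sign, in a ball around the point that avoids the circle.\<close>

lemma potential_gradient_integral:
  assumes p: "p \<notin> unit_circle"
  shows "GDERIV (potential lam) p :>
    integral {0..2 * pi} (\<lambda>t. (lam / norm (p - circle_param t) ^ 3) *\<^sub>R (p - circle_param t))"
proof -
  obtain e where e: "e > 0" "ball p e \<inter> unit_circle = {}"
    using p closed_unit_circle by (metis Int_commute closed_def disjoint_eq_subset_Compl
        openE ComplI)
  have nz: "x - circle_param t \<noteq> 0" if "x \<in> ball p e" for x t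
    using that e circle_param_in_unit_circle[of t] by auto
  have np: "p \<in> ball p e" using e by simp
  define fx where "fx x t = blinfun_inner_right
    ((- lam / norm (x - circle_param t) ^ 3) *\<^sub>R (x - circle_param t))" for x t
  define G where "G = integral {0..2 * pi}
    (\<lambda>t. (- lam / norm (p - circle_param t) ^ 3) *\<^sub>R (p - circle_param t))"
  have contp: "continuous_on S (\<lambda>x. circle_param (g x))" if "continuous_on S g" for S and g :: "_ \<Rightarrow> real"
    by (rule continuous_on_compose2[OF continuous_on_circle_param that subset_UNIV])
  have "((\<lambda>x. integral (cbox 0 (2 * pi)) (\<lambda>t. lam / norm (x - circle_param t)))
      has_derivative integral (cbox 0 (2 * pi)) (fx p)) (at p within ball p e)"
  proof (rule leibniz_rule)
    fix x t assume x: "x \<in> ball p e"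
    show "((\<lambda>x. lam / norm (x - circle_param t)) has_derivative fx x t) (at x within ball p e)"
    proof -
      have "((\<lambda>x. norm (x - circle_param t)) has_derivative (\<lambda>h. inner h (sgn (x - circle_param t)))) (at x within ball p e)"
        using nz[OF x, of t] by (intro GDERIV_norm[unfolded gderiv_def, THEN has_derivative_compose[rotated]]
            derivative_eq_intros) auto
      then show ?thesis
        unfolding fx_def blinfun_inner_right.rep_eq using nz[OF x, of t]
        by (auto intro!: derivative_eq_intros simp: fun_eq_iff sgn_div_norm inner_commute
            power3_eq_cube power2_eq_square divide_simps)
    qed
  next
    fix x assume x: "x \<in> ball p e"
    show "(\<lambda>t. lam / norm (x - circle_param t)) integrable_on cbox 0 (2 * pi)"
      using nz[OF x] by (intro integrable_continuous continuous_intros contp) auto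
  next
    show "continuous_on (ball p e \<times> cbox 0 (2 * pi)) (\<lambda>(x, t). fx x t)"
      unfolding fx_def split_beta
      using nz by (intro bounded_linear.continuous_on[OF bounded_linear_blinfun_inner_right]
          continuous_intros contp) auto
  qed (use e in auto)
  moreover have "integral (cbox 0 (2 * pi)) (fx p) = blinfun_inner_right G"
    unfolding fx_def G_def box_real
    by (subst integral_linear[OF _ bounded_linear_blinfun_inner_right, unfolded o_def])
      (use nz[OF np] in \<open>auto intro!: integrable_continuous_interval continuous_intros contp\<close>)
  ultimately have "((\<lambda>x. integral {0..2 * pi} (\<lambda>t. lam / norm (x - circle_param t)))
      has_derivative (\<lambda>h. inner G h)) (at p)"
    using at_within_open[OF np open_ball] by (simp add: box_real[symmetric] del: box_real)
  then have "(potential lam has_derivative (\<lambda>h. inner h (- G))) (at p)"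
    unfolding potential_def
    by (auto dest!: has_derivative_minus simp: inner_commute)
  moreover have "- G = integral {0..2 * pi} (\<lambda>t. (lam / norm (p - circle_param t) ^ 3) *\<^sub>R (p - circle_param t))"
    unfolding G_def by (subst integral_neg[symmetric]) simp
  ultimately show ?thesis
    by (simp add: gderiv_def)
qed

text \<open>Distance, and force components for density one, for a point in the meridian half plane, the
  angle on the circle being measured from that half plane. They are integrated over \<open>{-pi..pi}\<close>,
  where \<open>cos (w / 2)\<close> is nonnegative.\<close>

definition ring_dist :: "real \<Rightarrow> real \<Rightarrow> real \<Rightarrow> real" where
  "ring_dist r z w = sqrt (r\<^sup>2 + 1 - 2 * r * cos w + z\<^sup>2)"

definition ring_force_r :: "real \<Rightarrow> real \<Rightarrow> real" where
  "ring_force_r r z = integral {-pi..pi} (\<lambda>w. (r - cos w) / ring_dist r z w ^ 3)"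

definition ring_force_z :: "real \<Rightarrow> real \<Rightarrow> real" where
  "ring_force_z r z = integral {-pi..pi} (\<lambda>w. z / ring_dist r z w ^ 3)"

lemma ring_radicand: "(r::real)\<^sup>2 + 1 - 2 * r * cos w + z\<^sup>2 = (r - cos w)\<^sup>2 + (sin w)\<^sup>2 + z\<^sup>2"
  using sin_cos_squared_add[of w] by (simp add: power2_diff) 

lemma ring_dist_pos:
  assumes "(r, z) \<noteq> (1, 0)" "r \<ge> 0"
  shows "ring_dist r z w > 0"
proof -
  have "\<not> ((r - cos w)\<^sup>2 + (sin w)\<^sup>2 + z\<^sup>2 \<le> 0)"
  proof
    assume "(r - cos w)\<^sup>2 + (sin w)\<^sup>2 + z\<^sup>2 \<le> 0"
    then have "r = cos w" "sin w = 0" "z = 0"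
      by (smt (verit) zero_le_power2 zero_less_power2)+
    moreover from this have "(cos w)\<^sup>2 = 1" by (simp add: cos_squared_eq)
    ultimately show False using assms by (auto simp: power2_eq_1_iff)
  qed
  then show ?thesis by (simp add: ring_dist_def ring_radicand)
qed

lemma continuous_on_ring_dist [continuous_intros]:
  fixes f g h :: "'a::t2_space \<Rightarrow> real"
  shows
  "continuous_on S f \<Longrightarrow> continuous_on S g \<Longrightarrow> continuous_on S h
    \<Longrightarrow> continuous_on S (\<lambda>x. ring_dist (f x) (g x) (h x))"
  unfolding ring_dist_def by (intro continuous_intros)

lemma sum_squares_polar: "(r * cos f)\<^sup>2 + (r * sin f)\<^sup>2 = (r::real)\<^sup>2"
proof -
  have "(r * cos f)\<^sup>2 + (r * sin f)\<^sup>2 = r\<^sup>2 * ((cos f)\<^sup>2 + (sin f)\<^sup>2)" by algebra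
  then show ?thesis by simp
qed

lemma norm_cylindrical_diff_circle:
  "norm (vector [r * cos f, r * sin f, z] - circle_param t) = ring_dist r z (t - f)"
proof -
  have "(r * cos f - cos t)\<^sup>2 + (r * sin f - sin t)\<^sup>2 + z\<^sup>2
      = r\<^sup>2 * ((cos f)\<^sup>2 + (sin f)\<^sup>2) + ((cos t)\<^sup>2 + (sin t)\<^sup>2)
        - 2 * r * (cos t * cos f + sin t * sin f) + z\<^sup>2"
    by algebra
  also have "\<dots> = r\<^sup>2 + 1 - 2 * r * cos (t - f) + z\<^sup>2"
    by (simp add: cos_diff)
  finally have "(r * cos f - cos t)\<^sup>2 + (r * sin f - sin t)\<^sup>2 + z\<^sup>2 = r\<^sup>2 + 1 - 2 * r * cos (t - f) + z\<^sup>2" .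
  then show ?thesis
    by (simp add: ring_dist_def norm_eq_sqrt_inner inner_vec_def sum_3 circle_param_def
        flip: power2_eq_square)
qed

text \<open>Rotational symmetry reduces the gradient to two integrals: the force component perpendicular to
  the meridian plane has an odd integrand.\<close>

lemma potential_gradient_cylindrical:
  assumes r: "r \<ge> 0" "(r, z) \<noteq> (1, 0)"
  shows "GDERIV (potential lam) (vector [r * cos f, r * sin f, z]) :>
    vector [lam * ring_force_r r z * cos f, lam * ring_force_r r z * sin f, lam * ring_force_z r z]"
proof -
  let ?p = "vector [r * cos f, r * sin f, z] :: real^3"
  have d: "ring_dist r z w > 0" for w using ring_dist_pos[OF r(2,1)] .
  have np: "?p \<notin> unit_circle"
  proof
    assume "?p \<in> unit_circle"
    then have "(r * cos f)\<^sup>2 + (r * sin f)\<^sup>2 = 1" "z = 0" by (auto simp: unit_circle_def)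
    then show False using r sum_squares_polar[of r f] by (auto simp: power2_eq_1_iff)
  qed
  let ?I = "\<lambda>t. (lam / norm (?p - circle_param t) ^ 3) *\<^sub>R (?p - circle_param t)"
  have nz: "?p - circle_param t \<noteq> 0" for t
    using np circle_param_in_unit_circle[of t] by auto
  have int: "?I integrable_on {0..2 * pi}"
    using nz by (auto intro!: integrable_continuous_interval continuous_intros continuous_on_circle_param)
  \<comment> \<open>By periodicity the angle on the circle may be measured from the meridian of the point.\<close>
  have turn: "integral {0..2 * pi} (\<lambda>t. h (t - f)) = integral {-pi..pi} h"
    if c: "continuous_on UNIV h" and per: "\<And>x. h (x + 2 * pi) = h x" for h :: "real \<Rightarrow> real"
    using integral_shift[OF c, of 0 "2 * pi" "- f"] integral_period_shift[OF c per, of "- f"]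
      integral_period_shift[OF c per, of "- pi"] by simp
  have per: "ring_dist r z (x + 2 * pi) = ring_dist r z x" for x
    by (simp add: ring_dist_def)
  define A where "A w = (r - cos w) / ring_dist r z w ^ 3" for w
  define B where "B w = sin w / ring_dist r z w ^ 3" for w
  have nd: "ring_dist r z w \<noteq> 0" for w using d[of w] by simp
  have cA: "continuous_on S A" and cB: "continuous_on S B" for S
    unfolding A_def B_def using nd by (auto intro!: continuous_intros)
  have "integral {-pi..pi} B = 0"
  proof -
    have "integral {-pi..-pi + 2 * pi} B = 0"
      by (rule integral_odd_period[OF cB]) (auto simp: B_def ring_dist_def)
    then show ?thesis by simp
  qed
  have comp: "integral {-pi..pi} (\<lambda>w. lam * (a * A w + b * B w)) = lam * ring_force_r r z * a" for a b
  proof -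
    have "integral {-pi..pi} (\<lambda>w. a * A w + b * B w) = a * integral {-pi..pi} A + b * integral {-pi..pi} B"
      by (subst integral_add) (auto intro!: integrable_continuous_interval continuous_intros cA cB)
    then show ?thesis using \<open>integral {-pi..pi} B = 0\<close> by (simp add: ring_force_r_def A_def[abs_def])
  qed
  have perAB: "A (x + 2 * pi) = A x" "B (x + 2 * pi) = B x" for x
    by (simp_all add: A_def B_def per)
  have tc: "integral {0..2 * pi} (\<lambda>t. lam * (a * A (t - f) + b * B (t - f))) = lam * ring_force_r r z * a" for a b
    unfolding comp[of a b, symmetric]
    by (rule turn) (auto intro!: continuous_intros cA cB simp: perAB)
  have ct: "cos t = cos f * cos (t - f) - sin f * sin (t - f)" for t
    using cos_add[of f "t - f"] by simp
  have c1: "r * cos f - cos t = cos f * (r - cos (t - f)) + sin f * sin (t - f)" for t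
    unfolding ct[of t] by (simp add: algebra_simps)
  have st: "sin t = sin f * cos (t - f) + cos f * sin (t - f)" for t
    using sin_add[of f "t - f"] by simp
  have s1: "r * sin f - sin t = sin f * (r - cos (t - f)) - cos f * sin (t - f)" for t
    unfolding st[of t] by (simp add: algebra_simps)
  have "integral {0..2 * pi} ?I $ 1 = integral {0..2 * pi} (\<lambda>t. ?I t $ 1)"
    by (rule integral_component_eq_cart[OF int, symmetric])
  also have "\<dots> = integral {0..2 * pi} (\<lambda>t. lam * (cos f * A (t - f) + sin f * B (t - f)))"
    unfolding norm_cylindrical_diff_circle A_def B_def
    by (intro integral_cong) (simp add: circle_param_nth c1 flip: add_divide_distrib)
  also have "\<dots> = lam * ring_force_r r z * cos f"
    by (rule tc)
  finally have 1: "integral {0..2 * pi} ?I $ 1 = lam * ring_force_r r z * cos f" .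
  have "integral {0..2 * pi} ?I $ 2 = integral {0..2 * pi} (\<lambda>t. ?I t $ 2)"
    by (rule integral_component_eq_cart[OF int, symmetric])
  also have "\<dots> = integral {0..2 * pi} (\<lambda>t. lam * (sin f * A (t - f) + (- cos f) * B (t - f)))"
    unfolding norm_cylindrical_diff_circle A_def B_def
    by (intro integral_cong) (simp add: circle_param_nth s1 flip: diff_divide_distrib)
  also have "\<dots> = lam * ring_force_r r z * sin f"
    by (rule tc)
  finally have 2: "integral {0..2 * pi} ?I $ 2 = lam * ring_force_r r z * sin f" .
  have "integral {0..2 * pi} ?I $ 3 = integral {0..2 * pi} (\<lambda>t. ?I t $ 3)"
    by (rule integral_component_eq_cart[OF int, symmetric])
  also have "\<dots> = integral {0..2 * pi} (\<lambda>t. lam * (z / ring_dist r z (t - f) ^ 3))"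
    unfolding norm_cylindrical_diff_circle by (simp add: circle_param_nth)
  also have "\<dots> = integral {-pi..pi} (\<lambda>w. lam * (z / ring_dist r z w ^ 3))"
    by (rule turn) (use nd in \<open>auto intro!: continuous_intros simp: per\<close>)
  also have "\<dots> = lam * ring_force_z r z"
    unfolding ring_force_z_def by (rule integral_mult_right)
  finally have 3: "integral {0..2 * pi} ?I $ 3 = lam * ring_force_z r z" .
  show ?thesis
    using potential_gradient_integral[OF np, of lam]
    by (rule GDERIV_subst) (simp add: vec_eq_iff forall_3 1 2 3)
qed

section \<open>Size and Lipschitz constant near minus infinity\<close>

text \<open>One constant controls both the size and the Lipschitz constant on a half line. The predicate is
  stable under sums, products and integration, so it can be verified for the defects piece by piece
  without differentiating the elliptic integrals that they contain.\<close>

definition small_lip :: "real \<Rightarrow> real \<Rightarrow> (real \<Rightarrow> real) \<Rightarrow> bool" where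
  "small_lip c s0 f \<longleftrightarrow> (\<forall>s\<le>s0. \<bar>f s\<bar> \<le> c) \<and> (\<forall>s\<le>s0. \<forall>t\<le>s0. \<bar>f s - f t\<bar> \<le> c * \<bar>s - t\<bar>)"

lemma small_lip_bound: "small_lip c s0 f \<Longrightarrow> s \<le> s0 \<Longrightarrow> \<bar>f s\<bar> \<le> c"
  and small_lip_lipschitz: "small_lip c s0 f \<Longrightarrow> s \<le> s0 \<Longrightarrow> t \<le> s0 \<Longrightarrow> \<bar>f s - f t\<bar> \<le> c * \<bar>s - t\<bar>"
  by (auto simp: small_lip_def)

lemma small_lip_nonneg: "small_lip c s0 f \<Longrightarrow> 0 \<le> c"
  using small_lip_bound[of c s0 f s0] by linarith

lemma small_lip_mono: "small_lip c s0 f \<Longrightarrow> c \<le> d \<Longrightarrow> s1 \<le> s0 \<Longrightarrow> small_lip d s1 f"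
  unfolding small_lip_def
  by (smt (verit, best) mult_right_mono abs_ge_zero)

lemma small_lip_cong: "small_lip c s0 f \<Longrightarrow> (\<And>s. s \<le> s0 \<Longrightarrow> f s = g s) \<Longrightarrow> small_lip c s0 g"
  by (simp add: small_lip_def)

lemma small_lip_add:
  assumes "small_lip a s0 f" "small_lip b s0 g"
  shows "small_lip (a + b) s0 (\<lambda>s. f s + g s)"
  unfolding small_lip_def
proof (intro conjI allI impI)
  fix s t assume st: "s \<le> s0" "t \<le> s0"
  have "\<bar>f s - f t\<bar> \<le> a * \<bar>s - t\<bar>" "\<bar>g s - g t\<bar> \<le> b * \<bar>s - t\<bar>"
    using assms st by (auto intro: small_lip_lipschitz)
  then show "\<bar>f s + g s - (f t + g t)\<bar> \<le> (a + b) * \<bar>s - t\<bar>"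
    unfolding distrib_right by linarith
next
  fix s assume "s \<le> s0"
  then show "\<bar>f s + g s\<bar> \<le> a + b"
    using small_lip_bound[OF assms(1)] small_lip_bound[OF assms(2)] by (smt (verit))
qed

lemma small_lip_cmult:
  assumes "small_lip a s0 f"
  shows "small_lip (\<bar>c\<bar> * a) s0 (\<lambda>s. c * f s)"
  unfolding small_lip_def
proof (intro conjI allI impI)
  fix s t assume st: "s \<le> s0" "t \<le> s0"
  have "\<bar>c * f s - c * f t\<bar> = \<bar>c\<bar> * \<bar>f s - f t\<bar>"
    by (simp add: abs_mult[symmetric] right_diff_distrib)
  also have "\<dots> \<le> \<bar>c\<bar> * (a * \<bar>s - t\<bar>)"
    using assms st by (intro mult_left_mono small_lip_lipschitz) auto
  finally show "\<bar>c * f s - c * f t\<bar> \<le> \<bar>c\<bar> * a * \<bar>s - t\<bar>" by simp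
next
  fix s assume "s \<le> s0"
  then show "\<bar>c * f s\<bar> \<le> \<bar>c\<bar> * a"
    using small_lip_bound[OF assms] by (simp add: abs_mult mult_left_mono)
qed

lemma small_lip_mult:
  assumes f: "small_lip a s0 f" and g: "small_lip b s0 g"
  shows "small_lip (2 * a * b) s0 (\<lambda>s. f s * g s)"
  unfolding small_lip_def
proof (intro conjI allI impI)
  note ab = small_lip_nonneg[OF f] small_lip_nonneg[OF g]
  fix s t assume st: "s \<le> s0" "t \<le> s0"
  have "\<bar>f s * g s - f t * g t\<bar> = \<bar>(f s - f t) * g s + f t * (g s - g t)\<bar>"
    by (simp add: algebra_simps)
  also have "\<dots> \<le> \<bar>f s - f t\<bar> * \<bar>g s\<bar> + \<bar>f t\<bar> * \<bar>g s - g t\<bar>"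
    by (metis abs_mult abs_triangle_ineq)
  also have "\<dots> \<le> (a * \<bar>s - t\<bar>) * b + a * (b * \<bar>s - t\<bar>)"
    using ab by (intro add_mono mult_mono small_lip_lipschitz[OF f] small_lip_lipschitz[OF g]
        small_lip_bound[OF f] small_lip_bound[OF g] st) auto
  finally show "\<bar>f s * g s - f t * g t\<bar> \<le> 2 * a * b * \<bar>s - t\<bar>" by (simp add: mult_ac)
next
  note ab = small_lip_nonneg[OF f] small_lip_nonneg[OF g]
  fix s assume "s \<le> s0"
  then have "\<bar>f s\<bar> * \<bar>g s\<bar> \<le> a * b"
    using ab by (intro mult_mono small_lip_bound[OF f] small_lip_bound[OF g]) auto
  also have "\<dots> \<le> 2 * a * b" using ab by simp
  finally show "\<bar>f s * g s\<bar> \<le> 2 * a * b" by (simp add: abs_mult)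
qed

lemma small_lip_deriv:
  assumes "\<And>s. s \<le> s0 \<Longrightarrow> \<bar>f s\<bar> \<le> c"
    and "\<And>s. s \<le> s0 \<Longrightarrow> (f has_real_derivative f' s) (at s)"
    and "\<And>s. s \<le> s0 \<Longrightarrow> \<bar>f' s\<bar> \<le> c"
  shows "small_lip c s0 f"
  unfolding small_lip_def
proof (intro conjI allI impI)
  fix s t assume "s \<le> s0" "t \<le> s0"
  then have "norm (f s - f t) \<le> c * norm (s - t)"
    using assms by (intro field_differentiable_bound[where S = "{..s0}" and f' = f'])
      (auto intro: has_field_derivative_at_within)
  then show "\<bar>f s - f t\<bar> \<le> c * \<bar>s - t\<bar>" by simp
qed (rule assms(1))

lemma small_lip_integral:
  fixes F :: "real \<Rightarrow> real \<Rightarrow> real"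
  assumes F: "\<And>w. w \<in> {a..b} \<Longrightarrow> small_lip (c w) s0 (\<lambda>s. F s w)"
    and cont: "\<And>s. s \<le> s0 \<Longrightarrow> continuous_on {a..b} (F s)" and c: "continuous_on {a..b} c"
  shows "small_lip (integral {a..b} c) s0 (\<lambda>s. integral {a..b} (F s))"
  unfolding small_lip_def
proof (intro conjI allI impI)
  fix s t assume st: "s \<le> s0" "t \<le> s0"
  have "\<bar>integral {a..b} (F s) - integral {a..b} (F t)\<bar> = norm (integral {a..b} (\<lambda>w. F s w - F t w))"
    by (subst integral_diff) (use st in \<open>auto intro!: integrable_continuous_interval cont\<close>)
  also have "\<dots> \<le> integral {a..b} (\<lambda>w. c w * \<bar>s - t\<bar>)"
    by (rule integral_norm_bound_integral)
      (auto intro!: integrable_continuous_interval continuous_intros cont st c small_lip_lipschitz[OF F])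
  finally show "\<bar>integral {a..b} (F s) - integral {a..b} (F t)\<bar> \<le> integral {a..b} c * \<bar>s - t\<bar>"
    by simp
next
  fix s assume s: "s \<le> s0"
  have "norm (integral {a..b} (F s)) \<le> integral {a..b} c"
    by (rule integral_norm_bound_integral)
      (auto intro!: integrable_continuous_interval cont c small_lip_bound[OF F] s)
  then show "\<bar>integral {a..b} (F s)\<bar> \<le> integral {a..b} c" by simp
qed

section \<open>Concentration of the kernel\<close>

text \<open>A bound, for points at distance at most \<open>p\<close> from the circle, for the ratio of that distance to the
  distance from the point of the circle at angle \<open>w\<close>. It is close to \<open>1\<close> only for \<open>w\<close> of order \<open>p\<close>, and this concentration is what
  makes the integral of the ratio small.\<close>

definition peak :: "real \<Rightarrow> real \<Rightarrow> real" where
  "peak p w = p / sqrt (p\<^sup>2 + 2 * (sin (w / 2))\<^sup>2)"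

lemma peak_bounds: "p > 0 \<Longrightarrow> 0 \<le> peak p w" "p > 0 \<Longrightarrow> peak p w \<le> 1"
proof -
  show "p > 0 \<Longrightarrow> 0 \<le> peak p w" by (simp add: peak_def)
  assume p: "p > 0"
  then have "p \<le> sqrt (p\<^sup>2 + 2 * (sin (w / 2))\<^sup>2)"
    by (intro real_le_rsqrt) simp
  then show "peak p w \<le> 1" using p unfolding peak_def by (intro divide_le_eq_1[THEN iffD2] disjI1 conjI) linarith+
qed

lemma continuous_on_peak: "p > 0 \<Longrightarrow> continuous_on S (peak p)"
  unfolding peak_def
  by (intro continuous_intros) (auto simp: add_nonneg_eq_0_iff)

lemma peak_mono:
  assumes "0 < p" "p \<le> q"
  shows "peak p w \<le> peak q w"
proof -
  let ?S = "2 * (sin (w / 2))\<^sup>2"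
  have quotient_le: "a * d \<le> c * b \<Longrightarrow> 0 < b \<Longrightarrow> 0 < d \<Longrightarrow> a / b \<le> c / d" for a b c d :: real
    by (simp add: field_simps)
  have "p\<^sup>2 \<le> q\<^sup>2" using assms by (intro power_mono) auto
  then have "p\<^sup>2 * (q\<^sup>2 + ?S) \<le> q\<^sup>2 * (p\<^sup>2 + ?S)"
    using mult_right_mono[of "p\<^sup>2" "q\<^sup>2" ?S] by (simp add: algebra_simps)
  then have "sqrt (p\<^sup>2 * (q\<^sup>2 + ?S)) \<le> sqrt (q\<^sup>2 * (p\<^sup>2 + ?S))"
    by (rule real_sqrt_le_mono)
  then have "p * sqrt (q\<^sup>2 + ?S) \<le> q * sqrt (p\<^sup>2 + ?S)"
    using assms by (simp add: real_sqrt_mult)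
  moreover have "sqrt (p\<^sup>2 + ?S) > 0" "sqrt (q\<^sup>2 + ?S) > 0"
    using assms by (auto intro!: add_pos_nonneg)
  ultimately show ?thesis
    unfolding peak_def by (rule quotient_le)
qed

lemma integral_peak_small:
  assumes "e > 0"
  shows "\<exists>\<delta>>0. \<forall>p. 0 < p \<longrightarrow> p \<le> \<delta> \<longrightarrow> integral {-pi..pi} (peak p) \<le> e"
proof -
  \<comment> \<open>On an interval of length \<open>2 m\<close> around \<open>0\<close> the integrand is at most \<open>1\<close>; elsewhere \<open>sin (w / 2)\<close> is
    bounded away from \<open>0\<close> by \<open>\<sigma>\<close>.\<close>
  define m where "m = min 1 (e / 4)"
  have m: "0 < m" "m \<le> 1" "m \<le> e / 4" using assms by (auto simp: m_def)
  have mpi: "m < pi" using m pi_gt3 by linarith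
  define \<sigma> where "\<sigma> = sin (m / 2)"
  have \<sigma>: "\<sigma> > 0" unfolding \<sigma>_def using m mpi by (intro sin_gt_zero) auto
  define \<delta> where "\<delta> = e * \<sigma> / (4 * pi)"
  have "integral {-pi..pi} (peak p) \<le> e" if p: "0 < p" "p \<le> \<delta>" for p
  proof -
    have far: "peak p w \<le> p / \<sigma>" if w: "m \<le> \<bar>w\<bar>" "\<bar>w\<bar> \<le> pi" for w
    proof -
      have "\<sigma> \<le> sin (\<bar>w\<bar> / 2)"
        unfolding \<sigma>_def using w m by (intro sin_monotone_2pi_le) auto
      also have "sin (\<bar>w\<bar> / 2) \<le> \<bar>sin (w / 2)\<bar>"
        by (cases "w \<ge> 0") auto
      finally have "\<sigma>\<^sup>2 \<le> (sin (w / 2))\<^sup>2"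
        using \<sigma> by (simp add: abs_le_square_iff[symmetric])
      then have "\<sigma>\<^sup>2 \<le> p\<^sup>2 + 2 * (sin (w / 2))\<^sup>2"
        using zero_le_power2[of p] zero_le_power2[of "sin (w / 2)"] by linarith
      then have "\<sigma> \<le> sqrt (p\<^sup>2 + 2 * (sin (w / 2))\<^sup>2)" by (rule real_le_rsqrt)
      then show ?thesis unfolding peak_def using \<sigma> p
        by (intro divide_left_mono mult_pos_pos) linarith+
    qed
    have int: "peak p integrable_on {a..b}" for a b
      using p by (intro integrable_continuous_interval continuous_on_peak)
    have side: "p / \<sigma> * (pi - m) \<le> e / 4"
    proof -
      have "p / \<sigma> \<le> e / (4 * pi)" using p \<sigma> by (simp add: \<delta>_def field_simps)
      then have "p / \<sigma> * (pi - m) \<le> e / (4 * pi) * pi"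
        using m mpi assms by (intro mult_mono) auto
      then show ?thesis by simp
    qed
    have "integral {-pi..pi} (peak p) = integral {-pi..-m} (peak p) + integral {-m..m} (peak p) + integral {m..pi} (peak p)"
      using m mpi Henstock_Kurzweil_Integration.integral_combine[of "-pi" "-m" m "peak p"]
        Henstock_Kurzweil_Integration.integral_combine[of "-pi" m pi "peak p"] int by simp
    moreover have "\<bar>integral {-pi..-m} (peak p)\<bar> \<le> e / 4"
    proof -
      have "norm (integral {-pi..-m} (peak p)) \<le> p / \<sigma> * (-m - -pi)"
        using m mpi p by (intro integral_bound continuous_on_peak) (auto simp: peak_bounds intro!: far)
      also have "p / \<sigma> * (-m - -pi) = p / \<sigma> * (pi - m)" by simp
      finally show ?thesis using side unfolding real_norm_def by (rule order_trans)
    qed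
    moreover have "\<bar>integral {m..pi} (peak p)\<bar> \<le> e / 4"
    proof -
      have "norm (integral {m..pi} (peak p)) \<le> p / \<sigma> * (pi - m)"
        using m mpi p by (intro integral_bound continuous_on_peak) (auto simp: peak_bounds intro!: far)
      then show ?thesis using side unfolding real_norm_def by (rule order_trans)
    qed
    moreover have "\<bar>integral {-m..m} (peak p)\<bar> \<le> e / 2"
      using integral_bound[of "-m" m "peak p" 1] m mpi p
      by (auto simp: peak_bounds continuous_on_peak)
    ultimately show ?thesis by linarith
  qed
  moreover have "\<delta> > 0" using assms \<sigma> by (simp add: \<delta>_def)
  ultimately show ?thesis by blast
qed

section \<open>The defects from the logarithmic problem\<close>

text \<open>The gradient of the logarithmic potential \<open>2 * log \<rho>\<close>, multiplied by \<open>\<rho>\<close>, has radial part \<open>2\<close> and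
  angular part \<open>0\<close>. The defects are half the deviations of the true gradient (circle of density
  one, centrifugal term \<open>k / r\<^sup>3\<close> with \<open>k = K\<^sup>2 / lam\<close>) from these values, at polar angle \<open>x\<close> and
  distance \<open>\<rho> = exp s\<close> from the pole.\<close>

definition radial_defect :: "real \<Rightarrow> real \<Rightarrow> real \<Rightarrow> real" where
  "radial_defect k s x = (let r = 1 + exp s * cos x; z = exp s * sin x in
     exp s / 2 * (cos x * (ring_force_r r z - k / r ^ 3) + sin x * ring_force_z r z) - 1)"

definition torque_defect :: "real \<Rightarrow> real \<Rightarrow> real \<Rightarrow> real" where
  "torque_defect k s x = (let r = 1 + exp s * cos x; z = exp s * sin x in
     exp s / 2 * (cos x * ring_force_z r z - sin x * (ring_force_r r z - k / r ^ 3)))"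

lemma ring_force_reflect:
  "ring_force_r r (- z) = ring_force_r r z" "ring_force_z r (- z) = - ring_force_z r z"
  by (simp_all add: ring_force_r_def ring_force_z_def ring_dist_def flip: integral_neg)

lemma radial_defect_even: "radial_defect k s (- x) = radial_defect k s x"
  and torque_defect_odd: "torque_defect k s (- x) = - torque_defect k s x"
  by (simp_all add: radial_defect_def torque_defect_def Let_def ring_force_reflect algebra_simps)

lemma radial_defect_periodic: "radial_defect k s (x + 2 * pi) = radial_defect k s x"
  and torque_defect_periodic: "torque_defect k s (x + 2 * pi) = torque_defect k s x"
  by (simp_all add: radial_defect_def torque_defect_def)

text \<open>The integrands are jointly continuous in the parameters and the angle off the pole.\<close>

lemma continuous_on_ring_force:
  "continuous_on {(r, z). r \<ge> 0 \<and> (r, z) \<noteq> (1, 0)} (\<lambda>(r, z). ring_force_r r z)" (is "continuous_on ?U _")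
  "continuous_on {(r, z). r \<ge> 0 \<and> (r, z) \<noteq> (1, 0)} (\<lambda>(r, z). ring_force_z r z)"
proof -
  have nz: "ring_dist r z w \<noteq> 0" if "(r, z) \<in> ?U" for r z w
    using ring_dist_pos[of r z w] that by auto
  have "continuous_on (?U \<times> cbox (- pi) pi)
      (\<lambda>(y, w). (fst y - cos w) / ring_dist (fst y) (snd y) w ^ 3)"
    unfolding split_beta by (intro continuous_intros) (use nz in auto)
  from integral_continuous_on_param[OF this]
  show "continuous_on ?U (\<lambda>(r, z). ring_force_r r z)"
    by (simp add: ring_force_r_def split_beta)
  have "continuous_on (?U \<times> cbox (- pi) pi) (\<lambda>(y, w). snd y / ring_dist (fst y) (snd y) w ^ 3)"
    unfolding split_beta by (intro continuous_intros) (use nz in auto)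
  from integral_continuous_on_param[OF this]
  show "continuous_on ?U (\<lambda>(r, z). ring_force_z r z)"
    by (simp add: ring_force_z_def split_beta)
qed

lemma continuous_on_defects:
  fixes f g :: "'a::t2_space \<Rightarrow> real"
  assumes f: "continuous_on S f" "\<And>y. y \<in> S \<Longrightarrow> exp (f y) < 1" and g: "continuous_on S g"
  shows "continuous_on S (\<lambda>y. radial_defect k (f y) (g y))"
    "continuous_on S (\<lambda>y. torque_defect k (f y) (g y))"
proof -
  let ?p = "\<lambda>y. (1 + exp (f y) * cos (g y), exp (f y) * sin (g y))"
  have pos: "0 < 1 + exp (f y) * cos (g y)" if "y \<in> S" for y
  proof -
    have "\<bar>exp (f y) * cos (g y)\<bar> \<le> exp (f y) * 1"
      unfolding abs_mult by (intro mult_mono) auto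
    then show ?thesis using f(2)[OF that] by linarith
  qed
  have im: "?p ` S \<subseteq> {(r, z). r \<ge> 0 \<and> (r, z) \<noteq> (1, 0)}"
    using pos by (auto intro: less_imp_le) (metis cos_zero sin_cos_squared_add3 mult_zero_left add_0 zero_neq_one)
  have p: "continuous_on S ?p" using f g by (intro continuous_intros)
  have "continuous_on S (\<lambda>y. ring_force_r (1 + exp (f y) * cos (g y)) (exp (f y) * sin (g y)))"
    "continuous_on S (\<lambda>y. ring_force_z (1 + exp (f y) * cos (g y)) (exp (f y) * sin (g y)))"
    using continuous_on_compose2[OF continuous_on_ring_force(1) p im]
      continuous_on_compose2[OF continuous_on_ring_force(2) p im] by simp_all
  then show "continuous_on S (\<lambda>y. radial_defect k (f y) (g y))"
    "continuous_on S (\<lambda>y. torque_defect k (f y) (g y))"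
    unfolding radial_defect_def torque_defect_def Let_def
    using f g pos by (force intro!: continuous_intros)+
qed

text \<open>The rest of the estimate takes place on the ray of polar angle \<open>x\<close> from the pole. There
  \<open>loc_dist2 s w\<close> is the squared distance to the point of the circle at angle \<open>w\<close>, \<open>dist_ratio\<close> is the
  ratio bounded by \<open>peak\<close>, and \<open>chord_ratio\<close> compares the chord along the circle with that distance and
  stays bounded. Every part of the defects except the leading one carries a factor \<open>dist_ratio\<close> or
  \<open>exp s\<close>.\<close>

context
  fixes s0 x :: real
  assumes s0: "exp s0 \<le> 1 / 2"
begin

definition loc_r :: "real \<Rightarrow> real" where "loc_r s = 1 + exp s * cos x"
definition loc_dist2 :: "real \<Rightarrow> real \<Rightarrow> real" where
  "loc_dist2 s w = (exp s)\<^sup>2 + 4 * loc_r s * (sin (w / 2))\<^sup>2"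
definition dist_ratio :: "real \<Rightarrow> real \<Rightarrow> real" where "dist_ratio s w = exp s / sqrt (loc_dist2 s w)"
definition chord_ratio :: "real \<Rightarrow> real \<Rightarrow> real" where "chord_ratio s w = (sin (w / 2))\<^sup>2 / loc_dist2 s w"

lemma exp_le_half: "s \<le> s0 \<Longrightarrow> exp s \<le> 1 / 2"
  using s0 by (meson exp_le_cancel_iff order_trans)

lemma exp_cos_le: "\<bar>exp s * cos x\<bar> \<le> exp s"
  using mult_left_mono[of "\<bar>cos x\<bar>" 1 "exp s"] by (simp add: abs_mult)

lemma loc_r_bounds: "s \<le> s0 \<Longrightarrow> 1 / 2 \<le> loc_r s" "s \<le> s0 \<Longrightarrow> loc_r s \<le> 3 / 2"
  using exp_le_half[of s] exp_cos_le[of s] unfolding loc_r_def by linarith+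

lemma loc_r_deriv: "(loc_r has_real_derivative exp s * cos x) (at s)"
  unfolding loc_r_def[abs_def] by (auto intro!: derivative_eq_intros)

lemma loc_dist2_ge: "s \<le> s0 \<Longrightarrow> (exp s)\<^sup>2 + 2 * (sin (w / 2))\<^sup>2 \<le> loc_dist2 s w"
  using mult_right_mono[of 2 "4 * loc_r s" "(sin (w / 2))\<^sup>2"] loc_r_bounds(1)[of s]
  unfolding loc_dist2_def by simp

lemma loc_dist2_pos: "s \<le> s0 \<Longrightarrow> loc_dist2 s w > 0"
proof -
  assume "s \<le> s0"
  moreover have "(exp s)\<^sup>2 > 0" "(sin (w / 2))\<^sup>2 \<ge> 0" by auto
  ultimately show ?thesis using loc_dist2_ge[of s w] by linarith
qed

definition loc_dist2' :: "real \<Rightarrow> real \<Rightarrow> real" where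
  "loc_dist2' s w = 2 * (exp s)\<^sup>2 + 4 * (exp s * cos x) * (sin (w / 2))\<^sup>2"

lemma loc_dist2_deriv: "((\<lambda>s. loc_dist2 s w) has_real_derivative loc_dist2' s w) (at s)"
  unfolding loc_dist2_def[abs_def] loc_dist2'_def
  by (auto intro!: derivative_eq_intros loc_r_deriv simp: power2_eq_square)

lemma loc_dist2'_bound: assumes "s \<le> s0" shows "\<bar>loc_dist2' s w\<bar> \<le> 2 * loc_dist2 s w"
proof -
  have "\<bar>exp s * cos x\<bar> * (sin (w / 2))\<^sup>2 \<le> 1 / 2 * (sin (w / 2))\<^sup>2"
    using exp_cos_le[of s] exp_le_half[OF assms] by (intro mult_right_mono) auto
  moreover have "\<bar>(exp s * cos x) * (sin (w / 2))\<^sup>2\<bar> = \<bar>exp s * cos x\<bar> * (sin (w / 2))\<^sup>2"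
    by (simp add: abs_mult)
  moreover have "(exp s)\<^sup>2 > 0" "(sin (w / 2))\<^sup>2 \<ge> 0" by auto
  ultimately show ?thesis
    using loc_dist2_ge[OF assms, of w] unfolding loc_dist2'_def by linarith
qed

lemma dist_ratio_le_peak: assumes "s \<le> s0" shows "dist_ratio s w \<le> peak (exp s0) w"
proof -
  have S: "(sin (w / 2))\<^sup>2 \<ge> 0" by simp
  have e: "exp s > 0" "exp s \<le> exp s0" using assms by auto
  have "dist_ratio s w \<le> peak (exp s) w"
    unfolding dist_ratio_def peak_def
    using loc_dist2_ge[OF assms, of w] loc_dist2_pos[OF assms, of w] e(1)
    by (intro divide_left_mono real_sqrt_le_mono mult_pos_pos) (auto intro: add_pos_nonneg)
  also have "\<dots> \<le> peak (exp s0) w"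
    using e by (intro peak_mono)
  finally show ?thesis .
qed

lemma small_lip_dist_ratio: "small_lip (2 * peak (exp s0) w) s0 (\<lambda>s. dist_ratio s w)"
proof (rule small_lip_deriv)
  fix s assume s: "s \<le> s0"
  have D: "loc_dist2 s w > 0" using loc_dist2_pos[OF s] .
  have p: "0 \<le> peak (exp s0) w" by (rule peak_bounds) simp
  have a0: "0 \<le> dist_ratio s w" using D by (simp add: dist_ratio_def)
  show "\<bar>dist_ratio s w\<bar> \<le> 2 * peak (exp s0) w"
    using dist_ratio_le_peak[OF s, of w] p a0 by simp
  show "((\<lambda>s. dist_ratio s w) has_real_derivative
      dist_ratio s w * (1 - loc_dist2' s w / (2 * loc_dist2 s w))) (at s)"
    unfolding dist_ratio_def[abs_def] using D
    by (auto intro!: derivative_eq_intros loc_dist2_deriv simp: field_simps)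
  have "\<bar>loc_dist2' s w / (2 * loc_dist2 s w)\<bar> \<le> 1"
    using loc_dist2'_bound[OF s, of w] D by (simp add: abs_divide)
  then have "\<bar>1 - loc_dist2' s w / (2 * loc_dist2 s w)\<bar> \<le> 2" by linarith
  then have "\<bar>dist_ratio s w * (1 - loc_dist2' s w / (2 * loc_dist2 s w))\<bar> \<le> peak (exp s0) w * 2"
    unfolding abs_mult using dist_ratio_le_peak[OF s, of w] p a0 by (intro mult_mono) auto
  then show "\<bar>dist_ratio s w * (1 - loc_dist2' s w / (2 * loc_dist2 s w))\<bar> \<le> 2 * peak (exp s0) w"
    by simp
qed

lemma small_lip_chord_ratio: "small_lip 1 s0 (\<lambda>s. chord_ratio s w)"
proof (rule small_lip_deriv)
  fix s assume s: "s \<le> s0"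
  have D: "loc_dist2 s w > 0" using loc_dist2_pos[OF s] .
  have "2 * (sin (w / 2))\<^sup>2 \<le> loc_dist2 s w"
    using loc_dist2_ge[OF s, of w] zero_le_power2[of "exp s"] by linarith
  then have b: "0 \<le> chord_ratio s w" "chord_ratio s w \<le> 1 / 2"
    using D by (auto simp: chord_ratio_def field_simps)
  then show "\<bar>chord_ratio s w\<bar> \<le> 1" by simp
  show "((\<lambda>s. chord_ratio s w) has_real_derivative
      - chord_ratio s w * (loc_dist2' s w / loc_dist2 s w)) (at s)"
    unfolding chord_ratio_def[abs_def] using D
    by (auto intro!: derivative_eq_intros loc_dist2_deriv simp: field_simps)
  have "\<bar>loc_dist2' s w / loc_dist2 s w\<bar> \<le> 2"
    using loc_dist2'_bound[OF s, of w] D by (simp add: abs_divide field_simps)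
  then have "\<bar>- chord_ratio s w * (loc_dist2' s w / loc_dist2 s w)\<bar> \<le> (1 / 2) * 2"
    unfolding abs_mult using b by (intro mult_mono) auto
  then show "\<bar>- chord_ratio s w * (loc_dist2' s w / loc_dist2 s w)\<bar> \<le> 1" by simp
qed

lemma small_lip_exp: "small_lip (exp s0) s0 exp"
  by (rule small_lip_deriv) (auto intro!: derivative_eq_intros)

lemma small_lip_inverse_r: "small_lip 2 s0 (\<lambda>s. 1 / loc_r s)"
proof (rule small_lip_deriv)
  fix s assume s: "s \<le> s0"
  have r: "1 / 2 \<le> loc_r s" using loc_r_bounds[OF s] by simp
  then have i: "0 \<le> 1 / loc_r s" "1 / loc_r s \<le> 2" by (auto simp: field_simps)
  then show "\<bar>1 / loc_r s\<bar> \<le> 2" by simp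
  define y where "y = exp s * cos x"
  show "((\<lambda>s. 1 / loc_r s) has_real_derivative - y * (1 / loc_r s) * (1 / loc_r s)) (at s)"
    using r unfolding y_def by (auto intro!: derivative_eq_intros loc_r_deriv simp: field_simps)
  have "\<bar>y\<bar> \<le> 1 / 2" using exp_cos_le[of s] exp_le_half[OF s] unfolding y_def by linarith
  then have "\<bar>- y * (1 / loc_r s) * (1 / loc_r s)\<bar> \<le> 1 / 2 * 2 * 2"
    unfolding abs_mult using i by (intro mult_mono) auto
  then show "\<bar>- y * (1 / loc_r s) * (1 / loc_r s)\<bar> \<le> 2" by simp
qed

lemma small_lip_centrifugal: "small_lip (64 * exp s0) s0 (\<lambda>s. exp s / loc_r s ^ 3)"
proof -
  have "small_lip (2 * (2 * (2 * exp s0 * 2) * 2) * 2) s0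
      (\<lambda>s. exp s * (1 / loc_r s) * (1 / loc_r s) * (1 / loc_r s))"
    by (intro small_lip_mult small_lip_exp small_lip_inverse_r)
  then show ?thesis by (simp add: power3_eq_cube)
qed

text \<open>The square root is the distance to the opposite point of the circle in the meridian plane,
  which tends to \<open>2\<close> at the pole.\<close>

lemma small_lip_leading: "small_lip (5 * exp s0) s0 (\<lambda>s. 2 / sqrt ((exp s)\<^sup>2 + 4 * loc_r s) - 1)"
proof (rule small_lip_deriv)
  fix s assume s: "s \<le> s0"
  define d where "d = sqrt ((exp s)\<^sup>2 + 4 * loc_r s)"
  have "2 \<le> 4 * loc_r s" using loc_r_bounds(1)[OF s] by simp
  then have d2: "(exp s)\<^sup>2 + 4 * loc_r s \<ge> 2" by (smt (verit) zero_le_power2)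
  then have d1: "d \<ge> 1" unfolding d_def by (intro real_le_rsqrt) simp
  have dd: "d\<^sup>2 = (exp s)\<^sup>2 + 4 * loc_r s" unfolding d_def using d2 by simp
  have es: "(exp s)\<^sup>2 \<le> 1 / 2 * exp s"
    unfolding power2_eq_square using exp_le_half[OF s] by (intro mult_right_mono) auto
  have e0: "exp s \<le> exp s0" using s by simp
  have "4 - d\<^sup>2 = (2 - d) * (2 + d)" by (simp add: power2_eq_square algebra_simps)
  then have "2 / d - 1 = (4 - d\<^sup>2) / (d * (2 + d))"
    using d1 by (simp add: diff_divide_distrib)
  also have "\<bar>\<dots>\<bar> \<le> \<bar>4 - d\<^sup>2\<bar> / 1"
    unfolding abs_divide using d1 mult_mono[of 1 d 1 "2 + d"] by (intro divide_left_mono) auto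
  also have "4 - d\<^sup>2 = - ((exp s)\<^sup>2 + 4 * (exp s * cos x))"
    unfolding dd loc_r_def by simp
  also have "\<bar>\<dots>\<bar> / 1 \<le> 5 * exp s0"
    using exp_cos_le[of s] es e0 exp_gt_zero[of s] zero_le_power2[of "exp s"]
    unfolding div_by_1 by linarith
  finally show "\<bar>2 / sqrt ((exp s)\<^sup>2 + 4 * loc_r s) - 1\<bar> \<le> 5 * exp s0" unfolding d_def .
  show "((\<lambda>s. 2 / sqrt ((exp s)\<^sup>2 + 4 * loc_r s) - 1) has_real_derivative
      - (2 * (exp s)\<^sup>2 + 4 * (exp s * cos x)) / d ^ 3) (at s)"
  proof -
    let ?N = "2 * (exp s)\<^sup>2 + 4 * (exp s * cos x)"
    have gen: "((\<lambda>s. 2 / F s - 1) has_real_derivative - N / F s ^ 3) (at s)"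
      if "(F has_real_derivative inverse (F s) / 2 * N) (at s)" "F s \<ge> 1" for F N
      using that by (auto intro!: derivative_eq_intros simp: field_simps power3_eq_cube)
    have "((\<lambda>s. (exp s)\<^sup>2 + 4 * loc_r s) has_real_derivative ?N) (at s)"
      by (auto intro!: derivative_eq_intros loc_r_deriv simp: power2_eq_square)
    then have "((\<lambda>s. sqrt ((exp s)\<^sup>2 + 4 * loc_r s)) has_real_derivative inverse d / 2 * ?N) (at s)"
      unfolding d_def using d2 by (intro DERIV_chain2[where f = sqrt] DERIV_real_sqrt) auto
    from gen[OF this[unfolded d_def]] d1 show ?thesis unfolding d_def by simp
  qed
  have shrink: "\<bar>- a / e\<bar> \<le> \<bar>a\<bar>" if "1 \<le> e" for a e :: real
    using that mult_left_mono[of 1 e "\<bar>a\<bar>"] by (simp add: abs_divide divide_le_eq)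
  have "\<bar>- (2 * (exp s)\<^sup>2 + 4 * (exp s * cos x)) / d ^ 3\<bar> \<le> \<bar>2 * (exp s)\<^sup>2 + 4 * (exp s * cos x)\<bar>"
    by (intro shrink one_le_power d1)
  also have "\<dots> \<le> 5 * exp s0"
    using exp_cos_le[of s] es e0 zero_le_power2[of "exp s"] by linarith
  finally show "\<bar>- (2 * (exp s)\<^sup>2 + 4 * (exp s * cos x)) / d ^ 3\<bar> \<le> 5 * exp s0" .
qed

lemma ring_dist_loc: "ring_dist (loc_r s) (exp s * sin x) w = sqrt (loc_dist2 s w)"
proof -
  have c: "cos w = 1 - 2 * (sin (w / 2))\<^sup>2"
    using cos_double_sin[of "w / 2"] by simp
  have "(exp s * cos x)\<^sup>2 + (exp s * sin x)\<^sup>2 = (exp s)\<^sup>2"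
    by (rule sum_squares_polar)
  then show ?thesis
    unfolding ring_dist_def loc_dist2_def c loc_r_def
    by (intro arg_cong[of _ _ sqrt]) (simp add: power2_eq_square algebra_simps)
qed

lemma continuous_on_loc_dist2 [continuous_intros]: "continuous_on S (loc_dist2 s)"
  unfolding loc_dist2_def[abs_def] by (intro continuous_intros) auto

lemma continuous_on_ratios: "s \<le> s0 \<Longrightarrow> continuous_on S (dist_ratio s)" "s \<le> s0 \<Longrightarrow> continuous_on S (chord_ratio s)"
  unfolding dist_ratio_def[abs_def] chord_ratio_def[abs_def]
  using loc_dist2_pos[of s] by (auto intro!: continuous_intros simp: less_imp_neq[THEN not_sym])

text \<open>With the weight \<open>cos (w / 2)\<close> the integral over the angle is elementary, since
  \<open>2 * sin (w / 2) / D\<close>, for the distance \<open>D\<close>, is a primitive. The weight is \<open>1\<close> at the nearest point of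
  the circle, where the mass of the integral sits. So this captures the singular part of the
  force exactly, and only a small remainder has to be estimated.\<close>

lemma leading_integral:
  assumes s: "s \<le> s0"
  shows "((\<lambda>w. (exp s)\<^sup>2 * cos (w / 2) / sqrt (loc_dist2 s w) ^ 3) has_integral
     4 / sqrt ((exp s)\<^sup>2 + 4 * loc_r s)) {-pi..pi}"
proof -
  have "((\<lambda>w. 2 * sin (w / 2) / sqrt (loc_dist2 s w)) has_real_derivative
      (exp s)\<^sup>2 * cos (w / 2) / sqrt (loc_dist2 s w) ^ 3) (at w)" for w
  proof -
    have D: "loc_dist2 s w > 0" by (rule loc_dist2_pos[OF s])
    define d where "d = sqrt (loc_dist2 s w)"
    have d: "d > 0" "d\<^sup>2 = loc_dist2 s w" using D by (auto simp: d_def)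
    have "(loc_dist2 s has_real_derivative 4 * loc_r s * (sin (w / 2) * cos (w / 2))) (at w)"
      unfolding loc_dist2_def[abs_def] by (auto intro!: derivative_eq_intros)
    then have "((\<lambda>w. 2 * sin (w / 2) / sqrt (loc_dist2 s w)) has_real_derivative
       (cos (w / 2) * d - 2 * sin (w / 2) * (4 * loc_r s * (sin (w / 2) * cos (w / 2)) * (inverse d / 2))) / (d * d)) (at w)"
      unfolding d_def using D by (auto intro!: derivative_eq_intros)
    also have "(cos (w / 2) * d - 2 * sin (w / 2) * (4 * loc_r s * (sin (w / 2) * cos (w / 2)) * (inverse d / 2))) / (d * d)
        = (cos (w / 2) * d\<^sup>2 - cos (w / 2) * (4 * loc_r s * (sin (w / 2))\<^sup>2)) / d ^ 3"
      using d(1) by (simp add: field_simps power2_eq_square power3_eq_cube)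
    also have "\<dots> = (exp s)\<^sup>2 * cos (w / 2) / d ^ 3"
      unfolding d(2) loc_dist2_def by (simp add: algebra_simps)
    finally show ?thesis unfolding d_def .
  qed
  then have "((\<lambda>w. (exp s)\<^sup>2 * cos (w / 2) / sqrt (loc_dist2 s w) ^ 3) has_integral
     2 * sin (pi / 2) / sqrt (loc_dist2 s pi) - 2 * sin (- pi / 2) / sqrt (loc_dist2 s (- pi))) {-pi..pi}"
    by (intro fundamental_theorem_of_calculus)
      (auto simp: has_real_derivative_iff_has_vector_derivative[symmetric]
        intro: has_field_derivative_at_within)
  then show ?thesis by (simp add: loc_dist2_def)
qed

text \<open>The first summand comes from replacing the weight \<open>1\<close> by \<open>cos (w / 2)\<close>, using that
  \<open>1 - cos (w / 2)\<close> is \<open>(sin (w / 2))\<^sup>2 / (1 + cos (w / 2))\<close>; the second one is the curvature of the circle.\<close>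

definition rest_kernel :: "real \<Rightarrow> real \<Rightarrow> real" where
  "rest_kernel s w = 1 / (2 * (1 + cos (w / 2))) * (exp s * (dist_ratio s w * chord_ratio s w))
     + cos x * (dist_ratio s w * chord_ratio s w)"

lemma small_lip_rest: assumes w: "w \<in> {-pi..pi}"
  shows "small_lip (6 * peak (exp s0) w) s0 (\<lambda>s. rest_kernel s w)"
proof -
  have ab: "small_lip (2 * (2 * peak (exp s0) w) * 1) s0 (\<lambda>s. dist_ratio s w * chord_ratio s w)"
    by (intro small_lip_mult small_lip_dist_ratio small_lip_chord_ratio)
  have p: "0 \<le> peak (exp s0) w" by (rule peak_bounds) simp
  have C: "cos (w / 2) \<ge> 0" using w by (intro cos_ge_zero) auto
  have "small_lip (\<bar>1 / (2 * (1 + cos (w / 2)))\<bar> * (2 * exp s0 * (2 * (2 * peak (exp s0) w) * 1))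
      + \<bar>cos x\<bar> * (2 * (2 * peak (exp s0) w) * 1)) s0 (\<lambda>s. rest_kernel s w)"
    unfolding rest_kernel_def
    by (intro small_lip_add small_lip_cmult small_lip_mult[OF small_lip_exp] ab)
  moreover have "\<bar>1 / (2 * (1 + cos (w / 2)))\<bar> * (2 * exp s0 * (2 * (2 * peak (exp s0) w) * 1))
      \<le> (1 / 2) * (1 * (2 * (2 * peak (exp s0) w) * 1))"
    using C p s0 by (intro mult_mono) (auto simp: field_simps)
  moreover have "\<bar>cos x\<bar> * (2 * (2 * peak (exp s0) w) * 1) \<le> 1 * (2 * (2 * peak (exp s0) w) * 1)"
    using p by (intro mult_right_mono) auto
  ultimately show ?thesis
    by (elim small_lip_mono) auto
qed

lemma continuous_on_rest: "s \<le> s0 \<Longrightarrow> continuous_on {-pi..pi} (rest_kernel s)"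
proof -
  assume s: "s \<le> s0"
  have nz: "2 + 2 * cos (w / 2) \<noteq> 0" if "- pi \<le> w" "w \<le> pi" for w
    using that cos_ge_zero[of "w / 2"] by auto
  then show ?thesis
    unfolding rest_kernel_def[abs_def]
    by (intro continuous_intros continuous_on_ratios s) (auto dest: nz)
qed

lemma dist_chord_ratio: assumes s: "s \<le> s0"
  shows "dist_ratio s w * chord_ratio s w = exp s * (sin (w / 2))\<^sup>2 / sqrt (loc_dist2 s w) ^ 3"
  using loc_dist2_pos[OF s, of w]
  by (simp add: dist_ratio_def chord_ratio_def power3_eq_cube)

lemma radial_defect_formula:
  assumes s: "s \<le> s0"
  shows "radial_defect k s x = (2 / sqrt ((exp s)\<^sup>2 + 4 * loc_r s) - 1)
     + integral {-pi..pi} (rest_kernel s) + (- k / 2 * cos x) * (exp s / loc_r s ^ 3)"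
proof -
  let ?D = "\<lambda>w. sqrt (loc_dist2 s w) ^ 3"
  have nD: "sqrt (loc_dist2 s w) \<noteq> 0" for w using loc_dist2_pos[OF s, of w] by simp
  let ?f = "\<lambda>w. (loc_r s - cos w) / ?D w" and ?h = "\<lambda>w. exp s * sin x / ?D w"
  have int: "?f integrable_on {-pi..pi}" "?h integrable_on {-pi..pi}"
    using nD by (auto intro!: integrable_continuous_interval continuous_intros)
  have "exp s / 2 * (cos x * integral {-pi..pi} ?f + sin x * integral {-pi..pi} ?h)
      = integral {-pi..pi} (\<lambda>w. exp s / 2 * (cos x * ?f w + sin x * ?h w))"
    by (rule integral_unique[symmetric]) (intro has_integral_mult_right has_integral_add integrable_integral int)
  also have "\<dots> = integral {-pi..pi} (\<lambda>w. 1 / 2 * ((exp s)\<^sup>2 * cos (w / 2) / ?D w) + rest_kernel s w)"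
  proof (rule integral_cong)
    fix w assume w: "w \<in> {-pi..pi}"
    have C: "1 + cos (w / 2) > 0" using w cos_ge_zero[of "w / 2"] by auto
    have S: "1 / (2 * (1 + cos (w / 2))) * (sin (w / 2))\<^sup>2 = (1 - cos (w / 2)) / 2"
    proof -
      have sq: "(sin (w / 2))\<^sup>2 = (1 - cos (w / 2)) * (1 + cos (w / 2))"
        by (simp add: sin_squared_eq power2_eq_square algebra_simps)
      have "1 / (2 * X) * (Y * X) = Y / 2" if "X > 0" for X Y :: real
        using that by simp
      from this[OF C] show ?thesis unfolding sq .
    qed
    have c: "cos w = 1 - 2 * (sin (w / 2))\<^sup>2"
      using cos_double_sin[of "w / 2"] by simp
    have rk: "rest_kernel s w = ((exp s)\<^sup>2 * ((1 - cos (w / 2)) / 2) + cos x * exp s * (sin (w / 2))\<^sup>2) / ?D w"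
      unfolding rest_kernel_def dist_chord_ratio[OF s] S[symmetric]
      by (simp add: power2_eq_square add_divide_distrib)
    have "exp s / 2 * (cos x * ?f w + sin x * ?h w)
        = exp s / 2 * (cos x * (loc_r s - cos w) + sin x * (exp s * sin x)) / ?D w"
    proof -
      have "a / 2 * (b * (y / d) + c * (z / d)) = a / 2 * (b * y + c * z) / d" for a b c d y z :: real
        by (simp add: add_divide_distrib distrib_left)
      then show ?thesis .
    qed
    also have "exp s / 2 * (cos x * (loc_r s - cos w) + sin x * (exp s * sin x))
        = (exp s)\<^sup>2 / 2 * ((cos x)\<^sup>2 + (sin x)\<^sup>2) + cos x * exp s * (sin (w / 2))\<^sup>2"
      unfolding c loc_r_def by algebra
    also have "\<dots> = 1 / 2 * ((exp s)\<^sup>2 * cos (w / 2)) + ((exp s)\<^sup>2 * ((1 - cos (w / 2)) / 2) + cos x * exp s * (sin (w / 2))\<^sup>2)"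
      by (simp add: field_simps)
    finally show "exp s / 2 * (cos x * ?f w + sin x * ?h w) = 1 / 2 * ((exp s)\<^sup>2 * cos (w / 2) / ?D w) + rest_kernel s w"
      unfolding rk by (simp add: add_divide_distrib)
  qed
  also have "\<dots> = 1 / 2 * (4 / sqrt ((exp s)\<^sup>2 + 4 * loc_r s)) + integral {-pi..pi} (rest_kernel s)"
    by (intro integral_unique has_integral_add has_integral_mult_right leading_integral[OF s]
        integrable_integral integrable_continuous_interval continuous_on_rest[OF s])
  finally show ?thesis
    unfolding radial_defect_def Let_def ring_force_r_def ring_force_z_def
      loc_r_def[symmetric] ring_dist_loc
    by (simp add: algebra_simps)
qed

lemma torque_defect_formula:
  assumes s: "s \<le> s0"
  shows "torque_defect k s x = (- sin x) * integral {-pi..pi} (\<lambda>w. dist_ratio s w * chord_ratio s w)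
     + (k / 2 * sin x) * (exp s / loc_r s ^ 3)"
proof -
  let ?D = "\<lambda>w. sqrt (loc_dist2 s w) ^ 3"
  have nD: "sqrt (loc_dist2 s w) \<noteq> 0" for w using loc_dist2_pos[OF s, of w] by simp
  let ?f = "\<lambda>w. (loc_r s - cos w) / ?D w" and ?h = "\<lambda>w. exp s * sin x / ?D w"
  have int: "?f integrable_on {-pi..pi}" "?h integrable_on {-pi..pi}"
    using nD by (auto intro!: integrable_continuous_interval continuous_intros)
  have "exp s / 2 * (cos x * integral {-pi..pi} ?h - sin x * integral {-pi..pi} ?f)
      = integral {-pi..pi} (\<lambda>w. exp s / 2 * (cos x * ?h w - sin x * ?f w))"
    by (rule integral_unique[symmetric]) (intro has_integral_mult_right has_integral_diff integrable_integral int)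
  also have "\<dots> = integral {-pi..pi} (\<lambda>w. (- sin x) * (dist_ratio s w * chord_ratio s w))"
  proof (rule integral_cong)
    fix w :: real
    have c: "cos w = 1 - 2 * (sin (w / 2))\<^sup>2"
      using cos_double_sin[of "w / 2"] by simp
    have "exp s / 2 * (cos x * ?h w - sin x * ?f w)
        = exp s / 2 * (cos x * (exp s * sin x) - sin x * (loc_r s - cos w)) / ?D w"
    proof -
      have "a / 2 * (b * (y / d) - c * (z / d)) = a / 2 * (b * y - c * z) / d" for a b c d y z :: real
        by (simp add: diff_divide_distrib right_diff_distrib)
      then show ?thesis .
    qed
    also have "exp s / 2 * (cos x * (exp s * sin x) - sin x * (loc_r s - cos w))
        = (- sin x) * (exp s * (sin (w / 2))\<^sup>2)"
      unfolding c loc_r_def by (simp add: algebra_simps)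
    finally show "exp s / 2 * (cos x * ?h w - sin x * ?f w) = (- sin x) * (dist_ratio s w * chord_ratio s w)"
      by (simp add: dist_chord_ratio[OF s])
  qed
  also have "\<dots> = (- sin x) * integral {-pi..pi} (\<lambda>w. dist_ratio s w * chord_ratio s w)"
    by (rule integral_mult_right)
  finally show ?thesis
    unfolding torque_defect_def Let_def ring_force_r_def ring_force_z_def
      loc_r_def[symmetric] ring_dist_loc
    by (simp add: algebra_simps)
qed

lemma small_lip_defects:
  assumes k: "k \<ge> 0" and I: "integral {-pi..pi} (peak (exp s0)) \<le> e"
  shows "small_lip (5 * exp s0 + 6 * e + 32 * k * exp s0) s0 (\<lambda>s. radial_defect k s x)"
    "small_lip (5 * exp s0 + 6 * e + 32 * k * exp s0) s0 (\<lambda>s. torque_defect k s x)"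
proof -
  let ?I = "integral {-pi..pi} (peak (exp s0))"
  have cp: "continuous_on {-pi..pi} (\<lambda>w. c * peak (exp s0) w)" for c
    by (intro continuous_intros continuous_on_peak) auto
  have I0: "0 \<le> ?I"
    by (intro integral_nonneg integrable_continuous_interval continuous_on_peak peak_bounds) auto
  have rest: "small_lip (6 * ?I) s0 (\<lambda>s. integral {-pi..pi} (rest_kernel s))"
    using small_lip_integral[OF small_lip_rest continuous_on_rest cp] by simp
  have ab: "small_lip (4 * peak (exp s0) w) s0 (\<lambda>s. dist_ratio s w * chord_ratio s w)" for w
    using small_lip_mult[OF small_lip_dist_ratio[of w] small_lip_chord_ratio[of w]] by simp
  have abI: "small_lip (4 * ?I) s0 (\<lambda>s. integral {-pi..pi} (\<lambda>w. dist_ratio s w * chord_ratio s w))"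
  proof -
    have "small_lip (integral {-pi..pi} (\<lambda>w. 4 * peak (exp s0) w)) s0
        (\<lambda>s. integral {-pi..pi} (\<lambda>w. dist_ratio s w * chord_ratio s w))"
      by (rule small_lip_integral[where F = "\<lambda>s w. dist_ratio s w * chord_ratio s w"])
        (auto intro!: ab cp continuous_on_mult continuous_on_ratios)
    then show ?thesis by simp
  qed
  have c: "\<bar>a * t\<bar> \<le> \<bar>a\<bar>" if "\<bar>t\<bar> \<le> 1" for a t :: real
    using that by (simp add: abs_mult mult_left_le)
  have cent: "small_lip (32 * k * exp s0) s0 (\<lambda>s. (a * t) * (exp s / loc_r s ^ 3))"
    if "\<bar>t\<bar> \<le> 1" "\<bar>a\<bar> = k / 2" for a t
  proof (rule small_lip_mono[OF small_lip_cmult[OF small_lip_centrifugal]])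
    have "\<bar>a * t\<bar> * (64 * exp s0) \<le> k / 2 * (64 * exp s0)"
      using c[OF that(1), of a] that(2) by (intro mult_right_mono) auto
    then show "\<bar>a * t\<bar> * (64 * exp s0) \<le> 32 * k * exp s0" by simp
  qed simp
  show "small_lip (5 * exp s0 + 6 * e + 32 * k * exp s0) s0 (\<lambda>s. radial_defect k s x)"
  proof (rule small_lip_cong)
    show "small_lip (5 * exp s0 + 6 * e + 32 * k * exp s0) s0
      (\<lambda>s. (2 / sqrt ((exp s)\<^sup>2 + 4 * loc_r s) - 1)
     + integral {-pi..pi} (rest_kernel s) + (- k / 2 * cos x) * (exp s / loc_r s ^ 3))"
      by (rule small_lip_mono[OF small_lip_add[OF small_lip_add[OF small_lip_leading rest] cent]])
        (use I k in auto)
  qed (simp add: radial_defect_formula)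
  have s1: "small_lip (4 * ?I) s0 (\<lambda>s. (- sin x) * integral {-pi..pi} (\<lambda>w. dist_ratio s w * chord_ratio s w))"
  proof (rule small_lip_mono[OF small_lip_cmult[OF abI]])
    show "\<bar>- sin x\<bar> * (4 * ?I) \<le> 4 * ?I"
      using I0 by (simp add: mult_right_le_one_le mult_left_le_one_le)
  qed simp
  show "small_lip (5 * exp s0 + 6 * e + 32 * k * exp s0) s0 (\<lambda>s. torque_defect k s x)"
  proof (rule small_lip_cong)
    show "small_lip (5 * exp s0 + 6 * e + 32 * k * exp s0) s0
      (\<lambda>s. (- sin x) * integral {-pi..pi} (\<lambda>w. dist_ratio s w * chord_ratio s w)
     + (k / 2 * sin x) * (exp s / loc_r s ^ 3))"
    proof (rule small_lip_mono[OF small_lip_add[OF s1 cent]])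
      show "4 * ?I + 32 * k * exp s0 \<le> 5 * exp s0 + 6 * e + 32 * k * exp s0"
        using I I0 exp_gt_zero[of s0] by linarith
    qed (use k in auto)
  qed (simp add: torque_defect_formula)
qed

end

text \<open>All contributions to the constants are multiples of \<open>exp s0\<close> or of the integral of \<open>peak\<close>, so they
  can be made small by going down with \<open>s0\<close>.\<close>

lemma defects_small:
  assumes k: "k \<ge> 0" and "\<kappa> > 0" "\<epsilon> > 0"
  obtains s0 where "exp s0 \<le> 1 / 2" "exp s0 \<le> \<epsilon>"
    "\<And>x. small_lip \<kappa> s0 (\<lambda>s. radial_defect k s x)" "\<And>x. small_lip \<kappa> s0 (\<lambda>s. torque_defect k s x)"
proof -
  obtain \<delta> where \<delta>: "\<delta> > 0" "\<And>p. 0 < p \<Longrightarrow> p \<le> \<delta> \<Longrightarrow> integral {-pi..pi} (peak p) \<le> \<kappa> / 12"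
    using integral_peak_small[of "\<kappa> / 12"] \<open>\<kappa> > 0\<close> by auto
  define d where "d = \<kappa> / (2 * (5 + 32 * k))"
  have d: "d > 0" using assms by (simp add: d_def add_pos_nonneg)
  define p where "p = min (min (1 / 2) \<epsilon>) (min \<delta> d)"
  have p: "p > 0" "p \<le> 1 / 2" "p \<le> \<epsilon>" "p \<le> \<delta>" "p \<le> d"
    unfolding p_def using assms \<delta> d by auto
  define s0 where "s0 = ln p"
  have e: "exp s0 = p" using p by (simp add: s0_def)
  have "p * (5 + 32 * k) \<le> \<kappa> / 2" using p(5) k unfolding d_def by (simp add: field_simps)
  then have K: "5 * exp s0 + 6 * (\<kappa> / 12) + 32 * k * exp s0 \<le> \<kappa>" unfolding e by (simp add: algebra_simps)
  show ?thesis
  proof (rule that[of s0])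
    show "small_lip \<kappa> s0 (\<lambda>s. radial_defect k s x)" "small_lip \<kappa> s0 (\<lambda>s. torque_defect k s x)" for x
      using small_lip_defects[of s0 k "\<kappa> / 12" x] \<delta>(2)[of p] p k K by (auto simp: e elim!: small_lip_mono)
  qed (use p e in auto)
qed

section \<open>Periodic solutions of perturbations of the logarithmic problem\<close>

text \<open>The unknown is \<open>Z = sqrt 2 * q + \<i> * b\<close>. The reflection condition says that \<open>q\<close> is odd and \<open>b\<close> is
  even, that is, the orbit is symmetric under \<open>z \<mapsto> - z\<close>; oddness of \<open>q\<close> also guarantees that it has a
  periodic primitive.\<close>

definition admissible :: "real \<Rightarrow> (real \<Rightarrow> complex) \<Rightarrow> bool" where
  "admissible \<eta> Z \<longleftrightarrow> continuous_on UNIV Z \<and> (\<forall>x. Z (x + 2 * pi) = Z x)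
     \<and> (\<forall>x. Z (- x) = - cnj (Z x)) \<and> (\<forall>x. norm (Z x) \<le> \<eta>)"

definition slope :: "(real \<Rightarrow> complex) \<Rightarrow> real \<Rightarrow> real" where
  "slope Z x = Re (Z x) / sqrt 2"

definition log_radius :: "real \<Rightarrow> (real \<Rightarrow> complex) \<Rightarrow> real \<Rightarrow> real" where
  "log_radius \<sigma> Z x = \<sigma> + periodic_primitive (slope Z) x"

text \<open>What remains of \<open>q'\<close> and \<open>b'\<close> after removing the linear parts \<open>- b\<close> and \<open>2 * q\<close>. Every term is either
  of second order in \<open>(q, b)\<close> or contains a defect, hence has a small Lipschitz constant on a small ball.\<close>

definition forcing_q :: "real \<Rightarrow> real \<Rightarrow> real \<Rightarrow> real \<Rightarrow> real" where
  "forcing_q q b g h = q\<^sup>2 - (exp b - 1 - b) - exp b * (g - q * h)"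

definition forcing_b :: "real \<Rightarrow> real \<Rightarrow> real" where
  "forcing_b b h = 2 * exp b * h"

lemma exp_le_3: "b \<le> 1 \<Longrightarrow> exp b \<le> (3::real)"
  using exp_le order_trans[of "exp b" "exp 1" 3] by simp

lemma exp_lipschitz:
  fixes b b' :: real
  assumes "\<bar>b\<bar> \<le> 1" "\<bar>b'\<bar> \<le> 1"
  shows "\<bar>exp b - exp b'\<bar> \<le> 3 * \<bar>b - b'\<bar>"
proof -
  have "norm (exp b - exp b') \<le> 3 * norm (b - b')"
    using assms by (intro field_differentiable_bound[where S = "{-1..1}" and f' = exp])
      (auto intro!: derivative_eq_intros exp_le_3)
  then show ?thesis by simp
qed

lemma exp_remainder_lipschitz:
  fixes b b' :: real
  assumes "\<eta> \<le> 1" "\<bar>b\<bar> \<le> \<eta>" "\<bar>b'\<bar> \<le> \<eta>"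
  shows "\<bar>(exp b - 1 - b) - (exp b' - 1 - b')\<bar> \<le> 3 * \<eta> * \<bar>b - b'\<bar>"
proof -
  have "norm ((exp b - 1 - b) - (exp b' - 1 - b')) \<le> 3 * \<eta> * norm (b - b')"
  proof (rule field_differentiable_bound[where S = "{-\<eta>..\<eta>}" and f' = "\<lambda>b. exp b - 1"])
    fix t assume t: "t \<in> {-\<eta>..\<eta>}"
    have "\<bar>exp t - exp 0\<bar> \<le> 3 * \<bar>t - 0\<bar>" using t assms by (intro exp_lipschitz) auto
    also have "\<dots> \<le> 3 * \<eta>" using t by auto
    finally show "norm (exp t - 1) \<le> 3 * \<eta>" by simp
  qed (use assms in \<open>auto intro!: derivative_eq_intros\<close>)
  then show ?thesis by simp
qed

lemma abs_mult_le: "\<bar>a\<bar> \<le> A \<Longrightarrow> \<bar>b\<bar> \<le> B \<Longrightarrow> \<bar>a * b\<bar> \<le> A * (B::real)"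
  unfolding abs_mult by (intro mult_mono) auto

lemma forcing_q_lipschitz:
  assumes \<eta>: "\<eta> \<le> 1" and q: "\<bar>q\<bar> \<le> \<eta>" "\<bar>q'\<bar> \<le> \<eta>" and b: "\<bar>b\<bar> \<le> \<eta>" "\<bar>b'\<bar> \<le> \<eta>"
    and gh: "\<bar>g\<bar> \<le> \<kappa>" "\<bar>h\<bar> \<le> \<kappa>"
    and d: "\<bar>q - q'\<bar> \<le> \<delta>" "\<bar>b - b'\<bar> \<le> \<delta>"
    and e: "\<bar>g - g'\<bar> \<le> \<kappa> * e" "\<bar>h - h'\<bar> \<le> \<kappa> * e"
  shows "\<bar>forcing_q q b g h - forcing_q q' b' g' h'\<bar> \<le> 5 * \<eta> * \<delta> + 9 * \<kappa> * \<delta> + 6 * \<kappa> * e"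
proof -
  have \<eta>0: "0 \<le> \<eta>" using q(1) by linarith
  have 1: "\<bar>q\<^sup>2 - q'\<^sup>2\<bar> \<le> (2 * \<eta>) * \<delta>"
    unfolding square_diff_square_factored power2_eq_square using q d by (intro abs_mult_le) auto
  have "\<bar>(exp b - 1 - b) - (exp b' - 1 - b')\<bar> \<le> 3 * \<eta> * \<bar>b - b'\<bar>"
    by (rule exp_remainder_lipschitz[OF \<eta> b])
  also have "\<dots> \<le> 3 * \<eta> * \<delta>" using d \<eta>0 by (intro mult_left_mono) auto
  finally have 2: "\<bar>(exp b - 1 - b) - (exp b' - 1 - b')\<bar> \<le> 3 * \<eta> * \<delta>" .
  have "\<bar>q * h\<bar> \<le> 1 * \<kappa>" using q \<eta> gh by (intro abs_mult_le) auto
  then have gqh: "\<bar>g - q * h\<bar> \<le> 2 * \<kappa>" using gh by linarith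
  have "\<bar>exp b - exp b'\<bar> \<le> 3 * \<bar>b - b'\<bar>" using b \<eta> by (intro exp_lipschitz) auto
  also have "\<dots> \<le> 3 * \<delta>" using d by simp
  finally have "\<bar>exp b - exp b'\<bar> \<le> 3 * \<delta>" .
  then have 3: "\<bar>(exp b - exp b') * (g - q * h)\<bar> \<le> (3 * \<delta>) * (2 * \<kappa>)"
    using gqh by (intro abs_mult_le)
  have "\<bar>(q - q') * h\<bar> \<le> \<delta> * \<kappa>" using d gh by (intro abs_mult_le)
  moreover have "\<bar>q' * (h - h')\<bar> \<le> 1 * (\<kappa> * e)" using q \<eta> e by (intro abs_mult_le) auto
  ultimately have "\<bar>(g - g') - (q - q') * h - q' * (h - h')\<bar> \<le> \<delta> * \<kappa> + 2 * (\<kappa> * e)"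
    using e by linarith
  moreover have "\<bar>exp b'\<bar> \<le> 3" using b \<eta> by (auto intro!: exp_le_3)
  ultimately have 4: "\<bar>exp b' * ((g - g') - (q - q') * h - q' * (h - h'))\<bar> \<le> 3 * (\<delta> * \<kappa> + 2 * (\<kappa> * e))"
    by (intro abs_mult_le)
  have "forcing_q q b g h - forcing_q q' b' g' h' = (q\<^sup>2 - q'\<^sup>2)
     - ((exp b - 1 - b) - (exp b' - 1 - b')) - (exp b - exp b') * (g - q * h)
     - exp b' * ((g - g') - (q - q') * h - q' * (h - h'))"
    unfolding forcing_q_def by (simp add: algebra_simps)
  also have "\<bar>\<dots>\<bar> \<le> (2 * \<eta>) * \<delta> + 3 * \<eta> * \<delta> + (3 * \<delta>) * (2 * \<kappa>) + 3 * (\<delta> * \<kappa> + 2 * (\<kappa> * e))"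
    using 1 2 3 4 by linarith
  also have "\<dots> = 5 * \<eta> * \<delta> + 9 * \<kappa> * \<delta> + 6 * \<kappa> * e" by (simp add: algebra_simps)
  finally show ?thesis .
qed

lemma forcing_b_lipschitz:
  assumes b: "\<bar>b\<bar> \<le> 1" "\<bar>b'\<bar> \<le> 1" and h: "\<bar>h\<bar> \<le> \<kappa>"
    and d: "\<bar>b - b'\<bar> \<le> \<delta>" and e: "\<bar>h - h'\<bar> \<le> \<kappa> * e"
  shows "\<bar>forcing_b b h - forcing_b b' h'\<bar> \<le> 6 * \<kappa> * \<delta> + 6 * \<kappa> * e"
proof -
  have "\<bar>exp b - exp b'\<bar> \<le> 3 * \<bar>b - b'\<bar>" using b by (rule exp_lipschitz)
  also have "\<dots> \<le> 3 * \<delta>" using d by simp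
  finally have "\<bar>exp b - exp b'\<bar> \<le> 3 * \<delta>" .
  then have 1: "\<bar>(exp b - exp b') * h\<bar> \<le> (3 * \<delta>) * \<kappa>" using h by (intro abs_mult_le)
  have "\<bar>exp b'\<bar> \<le> 3" using b by (auto intro!: exp_le_3)
  then have 2: "\<bar>exp b' * (h - h')\<bar> \<le> 3 * (\<kappa> * e)" using e by (intro abs_mult_le)
  have "forcing_b b h - forcing_b b' h' = 2 * ((exp b - exp b') * h) + 2 * (exp b' * (h - h'))"
    unfolding forcing_b_def by (simp add: algebra_simps)
  also have "\<bar>\<dots>\<bar> \<le> 2 * ((3 * \<delta>) * \<kappa>) + 2 * (3 * (\<kappa> * e))" using 1 2 by linarith
  also have "\<dots> = 6 * \<kappa> * \<delta> + 6 * \<kappa> * e" by (simp add: algebra_simps)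
  finally show ?thesis .
qed

definition oscillation_norm :: real where
  "oscillation_norm = 2 * pi / norm oscillator_denom"

lemma oscillation_norm_pos: "oscillation_norm > 0"
  using oscillator_denom_nonzero by (simp add: oscillation_norm_def)

text \<open>The bounds \<open>1 / 4\<close> for \<open>\<eta>\<close> and for \<open>\<kappa>\<close> add up to the contraction factor \<open>1 / 2\<close>; the last bound
  keeps the image of \<open>0\<close> within \<open>\<eta> / 2\<close>, so that the ball of radius \<open>\<eta>\<close> is mapped into itself.\<close>

locale near_logarithmic =
  fixes g h :: "real \<Rightarrow> real \<Rightarrow> real" and s0 \<kappa> \<eta> :: real
  assumes g_even: "g s (- x) = g s x" and h_odd: "h s (- x) = - h s x"
    and g_periodic: "g s (x + 2 * pi) = g s x" and h_periodic: "h s (x + 2 * pi) = h s x"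
    and g_continuous: "continuous_on UNIV f \<Longrightarrow> (\<And>x. f x \<le> s0) \<Longrightarrow> continuous_on UNIV (\<lambda>x. g (f x) x)"
    and h_continuous: "continuous_on UNIV f \<Longrightarrow> (\<And>x. f x \<le> s0) \<Longrightarrow> continuous_on UNIV (\<lambda>x. h (f x) x)"
    and g_small: "small_lip \<kappa> s0 (\<lambda>s. g s x)" and h_small: "small_lip \<kappa> s0 (\<lambda>s. h s x)"
    and \<eta>: "0 < \<eta>" "\<eta> \<le> 1" "oscillation_norm * (10 * \<eta>) \<le> 1 / 4"
    and \<kappa>: "oscillation_norm * (150 * \<kappa>) \<le> 1 / 4" "oscillation_norm * (4 * \<kappa>) \<le> \<eta> / 2"
begin

definition forcing :: "real \<Rightarrow> (real \<Rightarrow> complex) \<Rightarrow> real \<Rightarrow> complex" where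
  "forcing \<sigma> Z x = Complex
     (sqrt 2 * forcing_q (slope Z x) (Im (Z x)) (g (log_radius \<sigma> Z x) x) (h (log_radius \<sigma> Z x) x))
     (forcing_b (Im (Z x)) (h (log_radius \<sigma> Z x) x))"

lemma \<kappa>_nonneg: "0 \<le> \<kappa>"
  by (rule small_lip_nonneg[OF g_small[of 0]])

lemma slope_le: "\<bar>slope Z x\<bar> \<le> norm (Z x)"
proof -
  have "\<bar>slope Z x\<bar> \<le> \<bar>Re (Z x)\<bar>"
    using mult_left_mono[of 1 "sqrt 2" "\<bar>Re (Z x)\<bar>"] by (simp add: slope_def abs_divide divide_le_eq)
  then show ?thesis using abs_Re_le_cmod[of "Z x"] by linarith
qed

lemma slope_diff: "slope Z x - slope W x = slope (\<lambda>x. Z x - W x) x"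
  by (simp add: slope_def diff_divide_distrib)

context
  fixes Z
  assumes Z: "admissible \<eta> Z"
begin

lemma admissibleD:
  "continuous_on UNIV Z" "Z (x + 2 * pi) = Z x" "Z (- x) = - cnj (Z x)" "norm (Z x) \<le> \<eta>"
  using Z by (auto simp: admissible_def)

lemma slope_continuous: "continuous_on UNIV (slope Z)"
  unfolding slope_def[abs_def] by (intro continuous_intros admissibleD) auto

lemma slope_periodic: "slope Z (x + 2 * pi) = slope Z x"
  by (simp add: slope_def admissibleD)

lemma slope_odd: "slope Z (- x) = - slope Z x"
  by (simp add: slope_def admissibleD)

lemma slope_small: "\<bar>slope Z x\<bar> \<le> \<eta>"
  using slope_le[of Z x] admissibleD(4)[of x] by linarith

lemma Im_small: "\<bar>Im (Z x)\<bar> \<le> \<eta>"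
  using abs_Im_le_cmod[of "Z x"] admissibleD(4)[of x] by linarith

lemma log_radius_has_derivative: "(log_radius \<sigma> Z has_real_derivative slope Z x) (at x)"
  unfolding log_radius_def[abs_def]
  using periodic_primitive_has_derivative[OF slope_continuous slope_periodic slope_odd]
  by (auto intro!: derivative_eq_intros)

lemma log_radius_continuous: "continuous_on UNIV (log_radius \<sigma> Z)"
  using DERIV_isCont[OF log_radius_has_derivative] by (simp add: continuous_at_imp_continuous_on)

lemma log_radius_periodic: "log_radius \<sigma> Z (x + 2 * pi) = log_radius \<sigma> Z x"
  by (simp add: log_radius_def periodic_primitive_periodic slope_periodic)

lemma log_radius_even: "log_radius \<sigma> Z (- x) = log_radius \<sigma> Z x"
  by (simp add: log_radius_def periodic_primitive_even[OF slope_continuous slope_periodic slope_odd])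

lemma log_radius_near: "\<bar>log_radius \<sigma> Z x - \<sigma>\<bar> \<le> 2 * pi * \<eta>"
  using periodic_primitive_diff_le[OF slope_continuous continuous_on_const[of _ 0], of \<eta> x] slope_small
  by (simp add: log_radius_def)

lemma log_radius_le: "\<sigma> \<le> s0 - 2 * pi * \<eta> \<Longrightarrow> log_radius \<sigma> Z x \<le> s0"
  using log_radius_near[of \<sigma> x] by linarith

lemma forcing_continuous:
  assumes \<sigma>: "\<sigma> \<le> s0 - 2 * pi * \<eta>"
  shows "continuous_on UNIV (forcing \<sigma> Z)"
proof -
  have "continuous_on UNIV (\<lambda>x. g (log_radius \<sigma> Z x) x)" "continuous_on UNIV (\<lambda>x. h (log_radius \<sigma> Z x) x)"
    by (intro g_continuous h_continuous log_radius_continuous log_radius_le \<sigma>)+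
  then show ?thesis
    unfolding forcing_def[abs_def] forcing_q_def forcing_b_def
    by (intro continuous_intros slope_continuous admissibleD)
qed

lemma forcing_periodic: "forcing \<sigma> Z (x + 2 * pi) = forcing \<sigma> Z x"
  by (simp add: forcing_def log_radius_periodic slope_periodic g_periodic h_periodic admissibleD)

lemma forcing_reflect: "forcing \<sigma> Z (- x) = cnj (forcing \<sigma> Z x)"
  by (simp add: forcing_def log_radius_even slope_odd g_even h_odd admissibleD complex_eq_iff
      forcing_q_def forcing_b_def)

end

lemma log_radius_diff:
  assumes Z: "admissible \<eta> Z" and W: "admissible \<eta> W"
    and \<delta>: "\<And>x. norm (Z x - W x) \<le> \<delta>"
  shows "\<bar>log_radius \<sigma> Z x - log_radius \<tau> W x\<bar> \<le> \<bar>\<sigma> - \<tau>\<bar> + 2 * pi * \<delta>"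
proof -
  have "\<bar>periodic_primitive (slope Z) x - periodic_primitive (slope W) x\<bar> \<le> 2 * pi * \<delta>"
    using slope_le[of "\<lambda>x. Z x - W x"] \<delta>
    by (intro periodic_primitive_diff_le slope_continuous Z W) (metis order_trans slope_diff)
  then show ?thesis unfolding log_radius_def by linarith
qed

text \<open>The dependence on \<open>\<sigma>\<close> is kept in the estimate: the same inequality gives the contraction, for
  equal parameters, and the Lipschitz dependence of the solution on the parameter.\<close>

lemma forcing_lipschitz:
  assumes Z: "admissible \<eta> Z" and W: "admissible \<eta> W"
    and \<delta>: "\<And>x. norm (Z x - W x) \<le> \<delta>"
    and \<sigma>: "\<sigma> \<le> s0 - 2 * pi * \<eta>" and \<tau>: "\<tau> \<le> s0 - 2 * pi * \<eta>"
  shows "norm (forcing \<sigma> Z x - forcing \<tau> W x) \<le> (10 * \<eta> + 150 * \<kappa>) * \<delta> + 18 * \<kappa> * \<bar>\<sigma> - \<tau>\<bar>"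
proof -
  let ?s = "log_radius \<sigma> Z x" and ?t = "log_radius \<tau> W x"
  define e where "e = \<bar>\<sigma> - \<tau>\<bar> + 2 * pi * \<delta>"
  have st: "\<bar>?s - ?t\<bar> \<le> e" unfolding e_def by (rule log_radius_diff[OF Z W \<delta>])
  have s: "?s \<le> s0" "?t \<le> s0" using log_radius_le[OF Z \<sigma>] log_radius_le[OF W \<tau>] by auto
  have dq: "\<bar>slope Z x - slope W x\<bar> \<le> \<delta>"
    using slope_le[of "\<lambda>x. Z x - W x" x] \<delta>[of x] by (simp add: slope_diff)
  have db: "\<bar>Im (Z x) - Im (W x)\<bar> \<le> \<delta>"
    using abs_Im_le_cmod[of "Z x - W x"] \<delta>[of x] by simp
  have lip: "\<bar>f ?s - f ?t\<bar> \<le> \<kappa> * e" if "small_lip \<kappa> s0 f" for f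
    using small_lip_lipschitz[OF that s] mult_left_mono[OF st \<kappa>_nonneg] by linarith
  have \<delta>0: "0 \<le> \<delta>" using \<delta>[of x] norm_ge_zero order_trans by blast
  have N1: "\<bar>forcing_q (slope Z x) (Im (Z x)) (g ?s x) (h ?s x)
      - forcing_q (slope W x) (Im (W x)) (g ?t x) (h ?t x)\<bar> \<le> 5 * \<eta> * \<delta> + 9 * \<kappa> * \<delta> + 6 * \<kappa> * e"
    by (intro forcing_q_lipschitz \<eta> slope_small[OF Z] slope_small[OF W] Im_small[OF Z] Im_small[OF W]
        dq db lip[OF g_small] lip[OF h_small] small_lip_bound[OF g_small] small_lip_bound[OF h_small] s)
  have N2: "\<bar>forcing_b (Im (Z x)) (h ?s x) - forcing_b (Im (W x)) (h ?t x)\<bar> \<le> 6 * \<kappa> * \<delta> + 6 * \<kappa> * e"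
    using order_trans[OF Im_small[OF Z] \<eta>(2)] order_trans[OF Im_small[OF W] \<eta>(2)]
    by (intro forcing_b_lipschitz db lip[OF h_small] small_lip_bound[OF h_small] s)
  have "norm (forcing \<sigma> Z x - forcing \<tau> W x) \<le>
      \<bar>sqrt 2 * (forcing_q (slope Z x) (Im (Z x)) (g ?s x) (h ?s x)
      - forcing_q (slope W x) (Im (W x)) (g ?t x) (h ?t x))\<bar>
      + \<bar>forcing_b (Im (Z x)) (h ?s x) - forcing_b (Im (W x)) (h ?t x)\<bar>"
    using cmod_le[of "forcing \<sigma> Z x - forcing \<tau> W x"] by (simp add: forcing_def right_diff_distrib)
  also have "\<bar>sqrt 2 * (forcing_q (slope Z x) (Im (Z x)) (g ?s x) (h ?s x)
      - forcing_q (slope W x) (Im (W x)) (g ?t x) (h ?t x))\<bar> \<le> 2 * (5 * \<eta> * \<delta> + 9 * \<kappa> * \<delta> + 6 * \<kappa> * e)"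
    by (intro abs_mult_le N1) (simp add: real_le_lsqrt)
  also note N2
  also have "2 * (5 * \<eta> * \<delta> + 9 * \<kappa> * \<delta> + 6 * \<kappa> * e) + (6 * \<kappa> * \<delta> + 6 * \<kappa> * e)
      = 10 * \<eta> * \<delta> + (24 + 36 * pi) * (\<kappa> * \<delta>) + 18 * \<kappa> * \<bar>\<sigma> - \<tau>\<bar>"
    unfolding e_def by (simp add: algebra_simps)
  \<comment> \<open>The constant \<open>150\<close> absorbs the loss \<open>2 * pi\<close> in passing from \<open>q\<close> to its primitive \<open>s\<close>.\<close>
  also have "(24 + 36 * pi) * (\<kappa> * \<delta>) \<le> 150 * (\<kappa> * \<delta>)"
    using pi_less_4 pi_approx \<kappa>_nonneg \<delta>0 by (intro mult_right_mono) auto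
  finally show ?thesis by (simp add: algebra_simps)
qed

lemma contraction_factor: "oscillation_norm * (10 * \<eta> + 150 * \<kappa>) \<le> 1 / 2"
  using \<eta>(3) \<kappa>(1) by (simp add: distrib_left)

text \<open>The factor \<open>18 * oscillation_norm * \<kappa>\<close> in front of the difference of the parameters is also
  at most \<open>1 / 2\<close>.\<close>

lemma oscillation_step:
  assumes Z: "admissible \<eta> Z" and W: "admissible \<eta> W"
    and \<delta>: "\<And>x. norm (Z x - W x) \<le> \<delta>"
    and \<sigma>: "\<sigma> \<le> s0 - 2 * pi * \<eta>" and \<tau>: "\<tau> \<le> s0 - 2 * pi * \<eta>"
  shows "norm (periodic_oscillation (forcing \<sigma> Z) x - periodic_oscillation (forcing \<tau> W) x)
     \<le> \<delta> / 2 + \<bar>\<sigma> - \<tau>\<bar> / 2"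
proof -
  have \<delta>0: "0 \<le> \<delta>" using \<delta>[of x] norm_ge_zero order_trans by blast
  have "norm (periodic_oscillation (forcing \<sigma> Z) x - periodic_oscillation (forcing \<tau> W) x)
     \<le> oscillation_norm * ((10 * \<eta> + 150 * \<kappa>) * \<delta> + 18 * \<kappa> * \<bar>\<sigma> - \<tau>\<bar>)"
    unfolding oscillation_norm_def
    by (intro periodic_oscillation_diff_le forcing_continuous forcing_lipschitz assms)
  also have "\<dots> = oscillation_norm * (10 * \<eta> + 150 * \<kappa>) * \<delta> + oscillation_norm * (18 * \<kappa>) * \<bar>\<sigma> - \<tau>\<bar>"
    by (simp add: algebra_simps)
  also have "\<dots> \<le> 1 / 2 * \<delta> + 1 / 2 * \<bar>\<sigma> - \<tau>\<bar>"
  proof (intro add_mono mult_right_mono contraction_factor)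
    have "oscillation_norm * (18 * \<kappa>) \<le> oscillation_norm * (150 * \<kappa>)"
      using oscillation_norm_pos \<kappa>_nonneg by (intro mult_left_mono) auto
    then show "oscillation_norm * (18 * \<kappa>) \<le> 1 / 2" using \<kappa>(1) by linarith
  qed (use \<delta>0 in auto)
  finally show ?thesis by simp
qed

lemma admissible_zero: "admissible \<eta> (\<lambda>_. 0)"
  using \<eta> by (simp add: admissible_def)

lemma oscillation_zero:
  assumes \<sigma>: "\<sigma> \<le> s0 - 2 * pi * \<eta>"
  shows "norm (periodic_oscillation (forcing \<sigma> (\<lambda>_. 0)) x) \<le> \<eta> / 2"
proof -
  have "norm (forcing \<sigma> (\<lambda>_. 0) x) \<le> 4 * \<kappa>" for x
  proof -
    let ?s = "log_radius \<sigma> (\<lambda>_. 0) x"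
    have s: "?s \<le> s0" using log_radius_le[OF admissible_zero \<sigma>] .
    have "\<bar>sqrt 2 * g ?s x\<bar> \<le> 2 * \<kappa>"
      using small_lip_bound[OF g_small s] by (intro abs_mult_le) (auto simp: real_le_lsqrt)
    moreover have "\<bar>h ?s x\<bar> \<le> \<kappa>" using small_lip_bound[OF h_small s] .
    ultimately show ?thesis
      using cmod_le[of "forcing \<sigma> (\<lambda>_. 0) x"]
      by (simp add: forcing_def forcing_q_def forcing_b_def slope_def)
  qed
  then have "norm (periodic_oscillation (forcing \<sigma> (\<lambda>_. 0)) x - periodic_oscillation (\<lambda>_. 0) x)
      \<le> oscillation_norm * (4 * \<kappa>)"
    unfolding oscillation_norm_def
    by (intro periodic_oscillation_diff_le forcing_continuous admissible_zero \<sigma> continuous_on_const) auto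
  then show ?thesis using \<kappa>(2) by simp
qed

lemma admissible_oscillation:
  assumes Z: "admissible \<eta> Z" and \<sigma>: "\<sigma> \<le> s0 - 2 * pi * \<eta>"
  shows "admissible \<eta> (periodic_oscillation (forcing \<sigma> Z))"
  unfolding admissible_def
proof (intro conjI allI)
  note c = forcing_continuous[OF Z \<sigma>] and p = forcing_periodic[OF Z, of \<sigma>]
  show "continuous_on UNIV (periodic_oscillation (forcing \<sigma> Z))"
    using periodic_oscillation_has_derivative[OF c p]
    by (intro continuous_at_imp_continuous_on) (auto intro: has_vector_derivative_continuous)
  fix x
  show "periodic_oscillation (forcing \<sigma> Z) (x + 2 * pi) = periodic_oscillation (forcing \<sigma> Z) x"
    by (rule periodic_oscillation_periodic) (rule p)
  show "periodic_oscillation (forcing \<sigma> Z) (- x) = - cnj (periodic_oscillation (forcing \<sigma> Z) x)"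
    by (rule periodic_oscillation_reflect[OF c p forcing_reflect[OF Z]])
  have "norm (periodic_oscillation (forcing \<sigma> Z) x - periodic_oscillation (forcing \<sigma> (\<lambda>_. 0)) x) \<le> \<eta> / 2"
    using oscillation_step[OF Z admissible_zero _ \<sigma> \<sigma>, of \<eta> x] admissibleD(4)[OF Z] by simp
  then show "norm (periodic_oscillation (forcing \<sigma> Z) x) \<le> \<eta>"
    using oscillation_zero[OF \<sigma>, of x] norm_triangle_sub[of "periodic_oscillation (forcing \<sigma> Z) x"
        "periodic_oscillation (forcing \<sigma> (\<lambda>_. 0)) x"] by linarith
qed

text \<open>The Banach fixed point theorem in the space of bounded continuous functions. The conditions
  in \<open>admissible\<close> are closed under uniform limits.\<close>

lemma admissible_fixed_point:
  assumes \<sigma>: "\<sigma> \<le> s0 - 2 * pi * \<eta>"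
  shows "\<exists>Z. admissible \<eta> Z \<and> periodic_oscillation (forcing \<sigma> Z) = Z"
proof -
  define S where "S = {Z :: real \<Rightarrow>\<^sub>C complex. admissible \<eta> Z}"
  define T where "T Z = Bcontfun (periodic_oscillation (forcing \<sigma> (apply_bcontfun Z)))" for Z
  have bc: "f \<in> bcontfun" if "admissible \<eta> f" for f
    using that unfolding admissible_def bcontfun_def by (auto intro!: boundedI)
  have T: "apply_bcontfun (T Z) = periodic_oscillation (forcing \<sigma> (apply_bcontfun Z))" if "Z \<in> S" for Z
    unfolding T_def using that S_def by (intro Bcontfun_inverse bc admissible_oscillation \<sigma>) auto
  have ev: "continuous_on UNIV (\<lambda>Z :: real \<Rightarrow>\<^sub>C complex. apply_bcontfun Z x)" for x
    unfolding continuous_on_iff by (meson dist_bounded le_less_trans)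
  have "S = {Z. \<forall>x. apply_bcontfun Z (x + 2 * pi) = apply_bcontfun Z x}
     \<inter> {Z. \<forall>x. apply_bcontfun Z (- x) = - cnj (apply_bcontfun Z x)}
     \<inter> {Z. \<forall>x. norm (apply_bcontfun Z x) \<le> \<eta>}"
    unfolding S_def admissible_def by auto
  then have "closed S"
    by (auto intro!: closed_Int closed_Collect_all closed_Collect_eq closed_Collect_le continuous_intros ev)
  then have "complete S" by (simp add: complete_eq_closed)
  moreover have "S \<noteq> {}"
    using admissible_zero Bcontfun_inverse[OF bc[OF admissible_zero]] unfolding S_def by (metis empty_iff mem_Collect_eq)
  moreover have "T ` S \<subseteq> S"
    using T admissible_oscillation[OF _ \<sigma>] unfolding S_def by auto
  moreover have "dist (T Z) (T W) \<le> 1 / 2 * dist Z W" if ZW: "Z \<in> S" "W \<in> S" for Z W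
  proof (rule dist_bound)
    fix x
    have "norm (apply_bcontfun Z x - apply_bcontfun W x) \<le> dist Z W" for x
      using dist_bounded[of Z x W] by (simp add: dist_norm)
    then show "dist (apply_bcontfun (T Z) x) (apply_bcontfun (T W) x) \<le> 1 / 2 * dist Z W"
      using oscillation_step[of "apply_bcontfun Z" "apply_bcontfun W" "dist Z W" \<sigma> \<sigma> x] ZW \<sigma>
      by (simp add: T[OF ZW(1)] T[OF ZW(2)] dist_norm[of "periodic_oscillation _ _"] S_def)
  qed
  ultimately have "\<exists>!Z. Z \<in> S \<and> T Z = Z"
    by (intro Banach_fix[of S "1/2"]) auto
  then obtain Z where "Z \<in> S" "T Z = Z" by blast
  then show ?thesis using T[of Z] unfolding S_def by (intro exI[of _ "apply_bcontfun Z"]) auto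
qed

definition solution :: "real \<Rightarrow> real \<Rightarrow> complex" where
  "solution \<sigma> = (SOME Z. admissible \<eta> Z \<and> periodic_oscillation (forcing \<sigma> Z) = Z)"

lemma solution:
  assumes "\<sigma> \<le> s0 - 2 * pi * \<eta>"
  shows "admissible \<eta> (solution \<sigma>)" "periodic_oscillation (forcing \<sigma> (solution \<sigma>)) = solution \<sigma>"
  using someI_ex[OF admissible_fixed_point[OF assms]] by (auto simp: solution_def)

text \<open>If two solutions differ by at most \<open>d\<close> in the supremum norm, one application of the map
  improves this to \<open>d / 2 + \<bar>\<sigma> - \<tau>\<bar> / 2\<close>. Applied to the supremum \<open>d\<close> itself this bounds \<open>d\<close>.\<close>

lemma solution_lipschitz:
  assumes \<sigma>: "\<sigma> \<le> s0 - 2 * pi * \<eta>" and \<tau>: "\<tau> \<le> s0 - 2 * pi * \<eta>"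
  shows "norm (solution \<sigma> x - solution \<tau> x) \<le> \<bar>\<sigma> - \<tau>\<bar>"
proof -
  define d where "d = (SUP x. norm (solution \<sigma> x - solution \<tau> x))"
  have "norm (solution \<sigma> x - solution \<tau> x) \<le> \<eta> + \<eta>" for x
    using norm_triangle_ineq4[of "solution \<sigma> x" "solution \<tau> x"]
      admissibleD(4)[OF solution(1)[OF \<sigma>], of x] admissibleD(4)[OF solution(1)[OF \<tau>], of x] by linarith
  then have bdd: "bdd_above (range (\<lambda>x. norm (solution \<sigma> x - solution \<tau> x)))"
    by (intro bdd_aboveI[of _ "\<eta> + \<eta>"]) auto
  have d: "norm (solution \<sigma> x - solution \<tau> x) \<le> d" for x
    unfolding d_def by (rule cSUP_upper[OF _ bdd]) simp
  have "norm (solution \<sigma> x - solution \<tau> x) \<le> d / 2 + \<bar>\<sigma> - \<tau>\<bar> / 2" for x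
    using oscillation_step[OF solution(1)[OF \<sigma>] solution(1)[OF \<tau>] d \<sigma> \<tau>, of x]
    by (simp add: solution \<sigma> \<tau>)
  then have "d \<le> d / 2 + \<bar>\<sigma> - \<tau>\<bar> / 2"
    unfolding d_def by (intro cSUP_least) auto
  then have "d \<le> \<bar>\<sigma> - \<tau>\<bar>" by argo
  with d[of x] show ?thesis by linarith
qed

definition family_s :: "real \<Rightarrow> real \<Rightarrow> real" where "family_s \<sigma> = log_radius \<sigma> (solution \<sigma>)"
definition family_q :: "real \<Rightarrow> real \<Rightarrow> real" where "family_q \<sigma> = slope (solution \<sigma>)"
definition family_b :: "real \<Rightarrow> real \<Rightarrow> real" where "family_b \<sigma> = (\<lambda>x. Im (solution \<sigma> x))"

text \<open>The real and imaginary parts of \<open>Z' = \<i> * sqrt 2 * Z + M\<close>, rewritten in the original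
  variables.\<close>

theorem family_solves_equations:
  assumes \<sigma>: "\<sigma> \<le> s0 - 2 * pi * \<eta>"
  shows "(family_s \<sigma> has_real_derivative family_q \<sigma> x) (at x)"
    and "(family_q \<sigma> has_real_derivative 1 + (family_q \<sigma> x)\<^sup>2 - exp (family_b \<sigma> x) *
        (1 + g (family_s \<sigma> x) x - family_q \<sigma> x * h (family_s \<sigma> x) x)) (at x)"
    and "(family_b \<sigma> has_real_derivative
        2 * family_q \<sigma> x + 2 * exp (family_b \<sigma> x) * h (family_s \<sigma> x) x) (at x)"
    and "family_s \<sigma> (x + 2 * pi) = family_s \<sigma> x" and "family_b \<sigma> (x + 2 * pi) = family_b \<sigma> x"
    and "family_s \<sigma> (- x) = family_s \<sigma> x"
    and "\<bar>family_s \<sigma> x - \<sigma>\<bar> \<le> 2 * pi * \<eta>" and "\<bar>family_b \<sigma> x\<bar> \<le> \<eta>"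
  unfolding family_s_def family_q_def family_b_def
proof -
  note Z = solution(1)[OF \<sigma>]
  show "(log_radius \<sigma> (solution \<sigma>) has_real_derivative slope (solution \<sigma>) x) (at x)"
    by (rule log_radius_has_derivative[OF Z])
  have "(solution \<sigma> has_vector_derivative \<i> * sqrt 2 * solution \<sigma> x + forcing \<sigma> (solution \<sigma>) x) (at x)"
    using periodic_oscillation_has_derivative[OF forcing_continuous[OF Z \<sigma>] forcing_periodic[OF Z], of x]
    unfolding solution(2)[OF \<sigma>] .
  note dZ = this
  have R: "((\<lambda>x. Re (solution \<sigma> x)) has_real_derivative Re (\<i> * sqrt 2 * solution \<sigma> x + forcing \<sigma> (solution \<sigma>) x)) (at x)"
    and I: "((\<lambda>x. Im (solution \<sigma> x)) has_real_derivative Im (\<i> * sqrt 2 * solution \<sigma> x + forcing \<sigma> (solution \<sigma>) x)) (at x)"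
    unfolding has_real_derivative_iff_has_vector_derivative
    by (rule bounded_linear.has_vector_derivative[OF bounded_linear_Re dZ])
      (rule bounded_linear.has_vector_derivative[OF bounded_linear_Im dZ])
  show "(slope (solution \<sigma>) has_real_derivative 1 + (slope (solution \<sigma>) x)\<^sup>2
      - exp (Im (solution \<sigma> x)) * (1 + g (log_radius \<sigma> (solution \<sigma>) x) x
        - slope (solution \<sigma>) x * h (log_radius \<sigma> (solution \<sigma>) x) x)) (at x)"
  proof -
    have "(slope (solution \<sigma>) has_real_derivative Re (\<i> * sqrt 2 * solution \<sigma> x + forcing \<sigma> (solution \<sigma>) x) / sqrt 2) (at x)"
      unfolding slope_def[abs_def] by (intro DERIV_cdivide R)
    also have "Re (\<i> * sqrt 2 * solution \<sigma> x + forcing \<sigma> (solution \<sigma>) x) / sqrt 2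
        = forcing_q (slope (solution \<sigma>) x) (Im (solution \<sigma> x)) (g (log_radius \<sigma> (solution \<sigma>) x) x)
            (h (log_radius \<sigma> (solution \<sigma>) x) x) - Im (solution \<sigma> x)"
      by (simp add: forcing_def diff_divide_distrib)
    finally show ?thesis by (simp add: forcing_q_def algebra_simps)
  qed
  show "((\<lambda>x. Im (solution \<sigma> x)) has_real_derivative 2 * slope (solution \<sigma>) x
      + 2 * exp (Im (solution \<sigma> x)) * h (log_radius \<sigma> (solution \<sigma>) x) x) (at x)"
  proof -
    have "sqrt 2 * Re (solution \<sigma> x) = 2 * slope (solution \<sigma>) x"
      by (simp add: slope_def field_simps)
    then show ?thesis using I by (simp add: forcing_def forcing_b_def)
  qed
  show "log_radius \<sigma> (solution \<sigma>) (x + 2 * pi) = log_radius \<sigma> (solution \<sigma>) x"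
    by (rule log_radius_periodic[OF Z])
  show "Im (solution \<sigma> (x + 2 * pi)) = Im (solution \<sigma> x)"
    by (simp add: admissibleD(2)[OF Z])
  show "log_radius \<sigma> (solution \<sigma>) (- x) = log_radius \<sigma> (solution \<sigma>) x"
    by (rule log_radius_even[OF Z])
  show "\<bar>log_radius \<sigma> (solution \<sigma>) x - \<sigma>\<bar> \<le> 2 * pi * \<eta>"
    by (rule log_radius_near[OF Z])
  show "\<bar>Im (solution \<sigma> x)\<bar> \<le> \<eta>"
    by (rule Im_small[OF Z])
qed

lemma family_lipschitz:
  assumes \<sigma>: "\<sigma> \<le> s0 - 2 * pi * \<eta>" and \<tau>: "\<tau> \<le> s0 - 2 * pi * \<eta>"
  shows "\<bar>family_s \<sigma> x - family_s \<tau> x\<bar> \<le> (1 + 2 * pi) * \<bar>\<sigma> - \<tau>\<bar>"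
    and "\<bar>family_b \<sigma> x - family_b \<tau> x\<bar> \<le> \<bar>\<sigma> - \<tau>\<bar>"
  unfolding family_s_def family_q_def family_b_def
proof -
  note Z = solution(1)[OF \<sigma>]
  show "\<bar>log_radius \<sigma> (solution \<sigma>) x - log_radius \<tau> (solution \<tau>) x\<bar> \<le> (1 + 2 * pi) * \<bar>\<sigma> - \<tau>\<bar>"
    using log_radius_diff[OF Z solution(1)[OF \<tau>] solution_lipschitz[OF \<sigma> \<tau>], of \<sigma> x \<tau>]
    by (simp add: algebra_simps)
  show "\<bar>Im (solution \<sigma> x) - Im (solution \<tau> x)\<bar> \<le> \<bar>\<sigma> - \<tau>\<bar>"
    using abs_Im_le_cmod[of "solution \<sigma> x - solution \<tau> x"] solution_lipschitz[OF \<sigma> \<tau>, of x] by simp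
qed

end

section \<open>Closed polar graphs\<close>

definition polar_graph :: "(real \<Rightarrow> real) \<Rightarrow> real \<Rightarrow> real \<times> real" where
  "polar_graph R x = (1 + R x * cos x, R x * sin x)"

lemma polar_coords_unique:
  fixes a b x y :: real
  assumes "a > 0" "b > 0" "a * cos x = b * cos y" "a * sin x = b * sin y"
  shows "a = b" "\<exists>n::int. x = y + 2 * pi * n"
proof -
  have "a\<^sup>2 = (a * cos x)\<^sup>2 + (a * sin x)\<^sup>2" "b\<^sup>2 = (b * cos y)\<^sup>2 + (b * sin y)\<^sup>2"
    by (simp_all only: sum_squares_polar)
  then have "a\<^sup>2 = b\<^sup>2" using assms by simp
  then show ab: "a = b" using assms by (simp add: power2_eq_iff_nonneg)
  then have "cos x = cos y" "sin x = sin y" using assms by auto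
  then show "\<exists>n::int. x = y + 2 * pi * n"
    using sin_cos_eq_iff by (metis mult.commute mult.left_commute)
qed

context
  fixes R :: "real \<Rightarrow> real"
  assumes cont: "continuous_on UNIV R" and pos: "\<And>x. R x > 0"
    and per: "\<And>x. R (x + 2 * pi) = R x"
begin

lemma polar_graph_shift: "polar_graph R (x + 2 * pi * of_int n) = polar_graph R x"
proof -
  interpret periodic_fun_simple R "2 * pi" by standard (rule per)
  have "R (x + 2 * pi * of_int n) = R x" using plus_of_int[of x n] by (simp add: mult.commute)
  moreover have "cos (x + 2 * pi * of_int n) = cos x" "sin (x + 2 * pi * of_int n) = sin x"
    by (simp_all add: sin_add cos_add)
  ultimately show ?thesis by (simp add: polar_graph_def)
qed

lemma angle_mod:
  obtains y and n :: int where "x = y + 2 * pi * n" "0 \<le> y" "y < 2 * pi"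
proof
  let ?n = "\<lfloor>x / (2 * pi)\<rfloor>"
  show "x = (x - 2 * pi * ?n) + 2 * pi * ?n" by simp
  show "0 \<le> x - 2 * pi * ?n" "x - 2 * pi * ?n < 2 * pi"
    using floor_divide_lower[of "2 * pi" x] floor_divide_upper[of "2 * pi" x]
    by (simp_all add: algebra_simps)
qed

lemma polar_graph_image: "polar_graph R ` {0..2 * pi} = range (polar_graph R)"
proof -
  have "polar_graph R x \<in> polar_graph R ` {0..2 * pi}" for x
    using angle_mod[of x] polar_graph_shift by (metis atLeastAtMost_iff image_eqI less_imp_le)
  then show ?thesis by auto
qed

lemma continuous_polar_graph: "continuous_on S (polar_graph R)"
  unfolding polar_graph_def[abs_def]
  by (intro continuous_intros continuous_on_subset[OF cont]) auto

lemma polar_graph_inj: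
  assumes "polar_graph R x = polar_graph R y"
  shows "\<exists>n::int. x = y + 2 * pi * n"
  using polar_coords_unique(2)[OF pos[of x] pos[of y]] assms by (auto simp: polar_graph_def)

lemma polar_graph_closed_curve:
  "\<exists>g. simple_path g \<and> pathfinish g = pathstart g \<and> path_image g = range (polar_graph R)"
proof (intro exI conjI)
  let ?g = "\<lambda>u. polar_graph R (2 * pi * u)"
  show "pathfinish ?g = pathstart ?g"
    using polar_graph_shift[of 0 1] by (simp add: pathfinish_def pathstart_def)
  have "(\<lambda>u. 2 * pi * u) ` {0..1} = {0..2 * pi}"
    by (simp add: image_mult_atLeastAtMost)
  then show "path_image ?g = range (polar_graph R)"
    unfolding path_image_def polar_graph_image[symmetric] by (metis image_image)
  show "simple_path ?g"
    unfolding simple_path_def loop_free_def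
  proof (intro conjI ballI impI)
    show "path ?g"
      unfolding path_def by (rule continuous_on_compose2[OF continuous_polar_graph[of UNIV]])
        (auto intro!: continuous_intros)
    fix u v :: real assume uv: "u \<in> {0..1}" "v \<in> {0..1}" and "?g u = ?g v"
    from polar_graph_inj[OF this(3)] obtain n :: int where "2 * pi * u = 2 * pi * v + 2 * pi * n"
      by auto
    then have "2 * pi * u = 2 * pi * (v + n)" by (simp add: distrib_left)
    then have "u = v + n" by simp
    moreover from this have "-1 \<le> n" "n \<le> 1" using uv by auto
    then have "n = -1 \<or> n = 0 \<or> n = 1" by linarith
    ultimately show "u = v \<or> u = 0 \<and> v = 1 \<or> u = 1 \<and> v = 0" using uv by auto
  qed
qed

text \<open>The points on or inside the graph and those on or outside it form two closed sets that
  cover the plane and meet only on the graph. A component of the complement of the graph cannot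
  meet both, so the one of the pole stays inside and is bounded.\<close>

lemma polar_graph_encloses: "(1, 0) \<in> inside (range (polar_graph R))"
proof -
  define P where "P t x = (1 + t * R x * cos x, t * R x * sin x)" for t x
  \<comment> \<open>Closures of the two sides of the curve: the inner one is an image of a compact set, the
    outer one a projection along a compact factor.\<close>
  define I' where "I' = (\<lambda>(x, t). P t x) ` ({0..2 * pi} \<times> {0..1})"
  define E' where "E' = {p. \<exists>x. x \<in> {0..2 * pi} \<and> (x, p) \<in>
      {(x, p). snd p * cos x = (fst p - 1) * sin x \<and> R x \<le> (fst p - 1) * cos x + snd p * sin x}}"
  have "compact I'" unfolding I'_def P_def split_beta
    by (intro compact_continuous_image compact_Times continuous_intros
        continuous_on_compose2[OF cont]) auto
  then have I': "closed I'" "bounded I'" by (auto intro: compact_imp_closed compact_imp_bounded)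
  have E'cl: "closed E'" unfolding E'_def split_beta
    by (intro closed_compact_projection closed_Collect_conj closed_Collect_eq closed_Collect_le
        continuous_intros continuous_on_compose2[OF cont]) auto
  have E'I: "p \<in> E' \<longleftrightarrow> (\<exists>x\<in>{0..2 * pi}. \<exists>t\<ge>1. p = P t x)" for p
  proof
    assume "p \<in> E'"
    then obtain x where x: "x \<in> {0..2 * pi}" "snd p * cos x = (fst p - 1) * sin x"
      "R x \<le> (fst p - 1) * cos x + snd p * sin x" by (auto simp: E'_def)
    define m where "m = (fst p - 1) * cos x + snd p * sin x"
    have "m * cos x = (fst p - 1) * ((cos x)\<^sup>2 + (sin x)\<^sup>2)" "m * sin x = snd p * ((cos x)\<^sup>2 + (sin x)\<^sup>2)"
      using x(2) unfolding m_def by algebra+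
    then have "fst p = 1 + m * cos x" "snd p = m * sin x" by simp_all
    then have "p = P (m / R x) x" using pos[of x] by (simp add: P_def prod_eq_iff)
    moreover have "1 \<le> m / R x" using x(3) pos[of x] by (simp add: m_def)
    ultimately show "\<exists>x\<in>{0..2 * pi}. \<exists>t\<ge>1. p = P t x" using x(1) by blast
  next
    assume "\<exists>x\<in>{0..2 * pi}. \<exists>t\<ge>1. p = P t x"
    then obtain x t where x: "x \<in> {0..2 * pi}" "t \<ge> 1" "p = P t x" by blast
    have "(fst p - 1) * cos x + snd p * sin x = t * R x * ((cos x)\<^sup>2 + (sin x)\<^sup>2)"
      unfolding x P_def fst_conv snd_conv by algebra
    also have "\<dots> \<ge> R x" using x(2) pos[of x] by simp
    finally show "p \<in> E'" using x by (auto simp: E'_def P_def)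
  qed
  have unique: "t = u \<and> P 1 x = P 1 y" if "P t x = P u y" "t > 0" "u > 0" for t u x y
  proof -
    have eq: "(t * R x) * cos x = (u * R y) * cos y" "(t * R x) * sin x = (u * R y) * sin y"
      using that(1) by (auto simp: P_def)
    have tu: "t * R x > 0" "u * R y > 0" using that pos by auto
    obtain n :: int where n: "x = y + 2 * pi * n" using polar_coords_unique(2)[OF tu eq] by blast
    then have g: "polar_graph R x = polar_graph R y" using polar_graph_shift by simp
    have "R x = R y"
      using polar_coords_unique(1)[OF pos[of x] pos[of y]] g by (auto simp: polar_graph_def)
    then have "t = u" using polar_coords_unique(1)[OF tu eq] pos[of y] by simp
    then show ?thesis using g by (simp add: P_def polar_graph_def)
  qed
  let ?\<Gamma> = "range (polar_graph R)"
  have \<Gamma>: "P 1 x = polar_graph R x" for x by (simp add: P_def polar_graph_def)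
  have on: "polar_graph R x \<in> I' \<inter> E'" for x
  proof -
    obtain y where y: "y \<in> {0..2 * pi}" "polar_graph R x = P 1 y"
      using polar_graph_image \<Gamma> by (metis imageE rangeI)
    then show ?thesis unfolding Int_iff E'I I'_def by (auto intro!: image_eqI[of _ _ "(y, 1)"])
  qed
  have cover: "p \<in> I' \<union> E'" for p
  proof -
    obtain m x where mx: "m \<ge> 0" "fst p - 1 = m * cos x" "snd p = m * sin x"
    proof -
      obtain m x where mx: "fst p - 1 = m * cos x" "snd p = m * sin x"
        using polar_Ex[of "fst p - 1" "snd p"] by blast
      show ?thesis
      proof (cases "m \<ge> 0")
        case True
        then show ?thesis using mx that by blast
      next
        case False
        then show ?thesis using mx that[of "- m" "x + pi"] by simp
      qed
    qed
    obtain y and n :: int where y: "x = y + 2 * pi * n" "0 \<le> y" "y < 2 * pi" by (rule angle_mod)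
    have "p = P (m / R y) y"
    proof -
      have "cos x = cos y" "sin x = sin y" by (simp_all add: y(1) sin_add cos_add)
      then show ?thesis using mx pos[of y] by (simp add: P_def prod_eq_iff)
    qed
    moreover have "y \<in> {0..2 * pi}" "0 \<le> m / R y" using y mx(1) pos[of y] by auto
    ultimately show ?thesis
    proof (cases "m / R y \<le> 1")
      case True
      with \<open>p = P (m / R y) y\<close> \<open>y \<in> {0..2 * pi}\<close> \<open>0 \<le> m / R y\<close> have "p \<in> I'"
        unfolding I'_def by (auto intro!: image_eqI[of _ _ "(y, m / R y)"])
      then show ?thesis by blast
    next
      case False
      then have "1 \<le> m / R y" by linarith
      with \<open>p = P (m / R y) y\<close> \<open>y \<in> {0..2 * pi}\<close> have "p \<in> E'" unfolding E'I by blast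
      then show ?thesis by blast
    qed
  qed
  have meet: "I' \<inter> E' \<subseteq> ?\<Gamma>"
  proof
    fix p assume "p \<in> I' \<inter> E'"
    then have "p \<in> I'" "p \<in> E'" by auto
    obtain x t where 1: "p = P t x" "0 \<le> t" "t \<le> 1"
      using \<open>p \<in> I'\<close> unfolding I'_def by auto
    obtain y u where 2: "p = P u y" "u \<ge> 1"
      using \<open>p \<in> E'\<close> unfolding E'I by blast
    note * = 1 2
    have "t > 0"
    proof (rule ccontr)
      assume "\<not> t > 0"
      then have "(u * R y) * cos y = 0" "(u * R y) * sin y = 0" using * by (auto simp: P_def)
      moreover have "u * R y > 0" using *(5) pos[of y] by simp
      ultimately have "cos y = 0" "sin y = 0" by auto
      then show False using sin_cos_squared_add[of y] by simp
    qed
    then have "t = 1" using unique[of t x u y] * by auto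
    then show "p \<in> ?\<Gamma>" using * \<Gamma> by auto
  qed
  have centre: "(1, 0) \<notin> E'"
  proof
    assume "(1, 0) \<in> E'"
    then obtain x t where x: "t \<ge> 1" "(1, 0) = P t x" unfolding E'I by auto
    then have "cos x = 0" "sin x = 0" using pos[of x] by (auto simp: P_def)
    then show False using sin_cos_squared_add[of x] by simp
  qed
  have centre': "(1, 0) \<in> I'" using centre cover by blast
  let ?C = "connected_component_set (- ?\<Gamma>) (1, 0)"
  have notin: "(1, 0) \<in> - ?\<Gamma>" using on centre by (metis ComplI IntD2 rangeE)
  have "?C \<subseteq> I'"
  proof (rule ccontr)
    assume "\<not> ?C \<subseteq> I'"
    then obtain p where p: "p \<in> ?C" "p \<in> E'" using cover by blast
    have "connected ?C" by (rule connected_connected_component)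
    moreover have "?C \<subseteq> I' \<union> E'" using cover by blast
    moreover have "I' \<inter> E' \<inter> ?C = {}"
      using meet connected_component_subset[of "- ?\<Gamma>" "(1, 0)"] by blast
    moreover have "I' \<inter> ?C \<noteq> {}"
      using centre' notin by (auto intro: connected_component_refl)
    moreover have "E' \<inter> ?C \<noteq> {}" using p by blast
    ultimately show False using I'(1) E'cl unfolding connected_closed by blast
  qed
  then have "bounded ?C" using I'(2) bounded_subset by blast
  then show ?thesis using notin by (simp add: inside_def)
qed

lemma polar_graph_symmetric:
  assumes "\<And>x. R (- x) = R x"
  shows "(\<lambda>(r, z). (r, - z)) ` range (polar_graph R) = range (polar_graph R)"
proof -
  have "(\<lambda>(r, z). (r, - z)) (polar_graph R x) = polar_graph R (- x)" for x
    by (simp add: polar_graph_def assms)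
  then have "(\<lambda>(r, z). (r, - z)) ` range (polar_graph R) = range (\<lambda>x. polar_graph R (- x))"
    by (simp add: image_image)
  also have "\<dots> = range (polar_graph R)"
    by (auto simp: image_iff) (metis minus_minus)
  finally show ?thesis .
qed

end

section \<open>From the polar equations to an orbit\<close>

text \<open>The lower bound on the derivative makes \<open>F\<close> onto. It is applied to the time as a function of
  the polar angle.\<close>

lemma real_inverse_function:
  fixes F :: "real \<Rightarrow> real"
  assumes F: "\<And>x. (F has_real_derivative f x) (at x)" and p: "p > 0" "\<And>x. f x \<ge> p"
  obtains G where "\<And>t. F (G t) = t" "\<And>x. G (F x) = x"
    "\<And>t. (G has_real_derivative 1 / f (G t)) (at t)"
proof -
  have pos: "f x > 0" for x using p(2)[of x] p(1) by linarith
  have mono: "F x < F y" if "x < y" for x y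
    using that by (rule DERIV_pos_imp_increasing) (use F pos in blast)
  then have inj: "inj F" by (auto intro!: linorder_injI less_imp_neq)
  have cont: "continuous_on S F" for S
    using F by (meson DERIV_isCont continuous_at_imp_continuous_on)
  have lin: "F x - p * x \<le> F y - p * y" if "x \<le> y" for x y
    using that
  proof (rule DERIV_nonneg_imp_nondecreasing)
    show "\<exists>d. ((\<lambda>x. F x - p * x) has_real_derivative d) (at z) \<and> 0 \<le> d" for z
      using p(2)[of z] by (intro exI[of _ "f z - p"]) (auto intro!: derivative_eq_intros F)
  qed
  have "\<exists>x. F x = t" for t
  proof -
    define c where "c = \<bar>t - F 0\<bar> / p"
    have c: "c \<ge> 0" "p * c = \<bar>t - F 0\<bar>" using p by (auto simp: c_def)
    have "F (- c) \<le> t" "t \<le> F c"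
      using lin[of "- c" 0] lin[of 0 c] c by auto
    then show ?thesis using IVT'[of F "- c" t c] cont c by auto
  qed
  then have surj: "surj F" by (metis surj_def)
  show ?thesis
  proof (rule that[of "inv F"])
    show FG: "F (inv F t) = t" for t by (rule surj_f_inv_f[OF surj])
    show GF: "inv F (F x) = x" for x by (rule inv_f_f[OF inj])
    show "(inv F has_real_derivative 1 / f (inv F t)) (at t)" for t
    proof -
      have "(inv F has_derivative (\<lambda>h. 1 / f (inv F t) * h)) (at t)"
      proof (rule has_derivative_inverse_strong_x[where S = UNIV and f = F])
        show "(F has_derivative (*) (f (inv F t))) (at (inv F t))"
          using F[of "inv F t"] by (simp add: has_field_derivative_def)
      qed (use pos[of "inv F t"] in \<open>auto simp: GF FG cont\<close>)
      then show ?thesis unfolding has_field_derivative_def .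
    qed
  qed
qed

lemma vector_3_has_vector_derivative:
  fixes a b c :: "real \<Rightarrow> real"
  assumes "(a has_real_derivative a') (at t)" "(b has_real_derivative b') (at t)" "(c has_real_derivative c') (at t)"
  shows "((\<lambda>t. vector [a t, b t, c t] :: real^3) has_vector_derivative vector [a', b', c']) (at t)"
proof -
  have dec: "vector [x, y, z] = x *\<^sub>R axis 1 1 + y *\<^sub>R axis 2 1 + z *\<^sub>R (axis 3 1 :: real^3)" for x y z :: real
    by (simp add: vec_eq_iff forall_3 axis_def)
  show ?thesis
    unfolding dec
    by (rule has_vector_derivative_eq_rhs)
      (rule has_vector_derivative_add has_vector_derivative_scaleR has_vector_derivative_const assms | simp)+
qed

text \<open>A vertical plane has a horizontal normal vector. It is orthogonal to position and velocity,
  so their horizontal parts are parallel and the angular momentum vanishes.\<close>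

lemma not_in_vertical_plane:
  fixes q :: "real \<Rightarrow> real^3"
  assumes q: "(q has_vector_derivative v) (at t)" and L: "q t $ 1 * v $ 2 - q t $ 2 * v $ 1 \<noteq> 0"
  shows "\<not> (\<exists>P. vertical_plane P \<and> range q \<subseteq> P)"
proof
  assume "\<exists>P. vertical_plane P \<and> range q \<subseteq> P"
  then obtain P where P: "affine P" "aff_dim P = 2" "{p. p$1 = 0 \<and> p$2 = 0} \<subseteq> P" "range q \<subseteq> P"
    by (auto simp: vertical_plane_def)
  obtain n c where n: "n \<noteq> 0" "P \<subseteq> {x. n \<bullet> x = c}"
    using aff_lowdim_subset_hyperplane[of P] P(2) by auto
  have "0 \<in> P" "axis 3 1 \<in> P" using P(3) by (auto simp: axis_def)
  then have "n \<bullet> 0 = c" "n \<bullet> axis 3 1 = c" using n(2) by blast+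
  then have c: "c = 0" "n $ 3 = 0" by (auto simp: inner_axis)
  have "n \<bullet> q s = 0" for s using n(2) P(4) c by blast
  then have "((\<lambda>s. 0) has_vector_derivative n \<bullet> v) (at t)"
    using bounded_linear.has_vector_derivative[OF bounded_linear_inner_right q, of n] by simp
  then have "n \<bullet> v = 0" using has_vector_derivative_const vector_derivative_unique_at by blast
  with \<open>n \<bullet> q t = 0\<close> c have e: "n $ 1 * q t $ 1 + n $ 2 * q t $ 2 = 0" "n $ 1 * v $ 1 + n $ 2 * v $ 2 = 0"
    by (simp_all add: inner_vec_def sum_3)
  have "n $ 1 * (q t $ 1 * v $ 2 - q t $ 2 * v $ 1) = 0" "n $ 2 * (q t $ 1 * v $ 2 - q t $ 2 * v $ 1) = 0"
    using e by algebra+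
  then have "n = 0" using L c by (simp add: vec_eq_iff forall_3)
  with n show False by simp
qed

lemma radial_identity:
  fixes v q e g h c s :: real
  shows "- v * (q + e * h) * (q * c - s) + v * ((1 + q\<^sup>2 - e * (1 + g - q * h)) * c - q * s - c)
     = - (v * e) * ((1 + g) * c - h * s)"
  by (simp add: power2_eq_square algebra_simps)

lemma vertical_identity:
  fixes v q e g h c s :: real
  shows "- v * (q + e * h) * (q * s + c) + v * ((1 + q\<^sup>2 - e * (1 + g - q * h)) * s + q * c - s)
     = - (v * e) * ((1 + g) * s + h * c)"
  by (simp add: power2_eq_square algebra_simps)

lemma rotation_identity:
  fixes u c s W V :: real
  assumes "c * c + s * s = 1"
  shows "(1 + (u * (c * W + s * V) - 1)) * c - u * (c * V - s * W) * s = u * W"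
    "(1 + (u * (c * W + s * V) - 1)) * s + u * (c * V - s * W) * c = u * V"
proof -
  have "(1 + (u * (c * W + s * V) - 1)) * c - u * (c * V - s * W) * s = u * W * (c * c + s * s)"
    "(1 + (u * (c * W + s * V) - 1)) * s + u * (c * V - s * W) * c = u * V * (c * c + s * s)"
    by (simp_all add: algebra_simps)
  then show "(1 + (u * (c * W + s * V) - 1)) * c - u * (c * V - s * W) * s = u * W"
    "(1 + (u * (c * W + s * V) - 1)) * s + u * (c * V - s * W) * c = u * V"
    using assms by simp_all
qed

text \<open>A solution of the polar equations for the true defects, close enough to the pole. The lower
  bounds on \<open>S\<close> and \<open>B\<close> keep the time per unit of angle away from \<open>0\<close>.\<close>

locale polar_solution =
  fixes lam K low \<epsilon> :: real and S Q B :: "real \<Rightarrow> real"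
  assumes lam: "lam > 0" and K: "K \<noteq> 0"
    and dS: "(S has_real_derivative Q x) (at x)"
    and dQ: "(Q has_real_derivative 1 + (Q x)\<^sup>2 - exp (B x) *
        (1 + radial_defect (K\<^sup>2 / lam) (S x) x - Q x * torque_defect (K\<^sup>2 / lam) (S x) x)) (at x)"
    and dB: "(B has_real_derivative 2 * Q x + 2 * exp (B x) * torque_defect (K\<^sup>2 / lam) (S x) x) (at x)"
    and S_periodic: "S (x + 2 * pi) = S x" and B_periodic: "B (x + 2 * pi) = B x"
    and S_even: "S (- x) = S x"
    and S_bounds: "low \<le> S x" "exp (S x) \<le> 1 / 2" "exp (S x) \<le> \<epsilon>" and B_bound: "-1 \<le> B x"
begin

text \<open>Cylindrical coordinates and their time derivatives as functions of the polar angle. The time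
  per unit of angle is \<open>clock\<close>, that is, \<open>exp (2 s) / L\<close> with \<open>L\<close> expressed through \<open>b\<close>; accordingly every
  derivative below is \<open>clock\<close> times a time derivative.\<close>

definition rad :: "real \<Rightarrow> real" where "rad x = 1 + exp (S x) * cos x"
definition hgt :: "real \<Rightarrow> real" where "hgt x = exp (S x) * sin x"
definition speed :: "real \<Rightarrow> real" where "speed x = sqrt (2 * lam) * exp (- B x / 2)"
definition rad_vel :: "real \<Rightarrow> real" where "rad_vel x = speed x * (Q x * cos x - sin x)"
definition hgt_vel :: "real \<Rightarrow> real" where "hgt_vel x = speed x * (Q x * sin x + cos x)"
definition clock :: "real \<Rightarrow> real" where "clock x = exp (S x + B x / 2) / sqrt (2 * lam)"

lemma rad_pos: "rad x \<ge> 1 / 2"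
proof -
  have "\<bar>exp (S x) * cos x\<bar> \<le> 1 / 2 * 1"
    using S_bounds(2)[of x] by (intro abs_mult_le) auto
  then show ?thesis unfolding rad_def by linarith
qed

lemma clock_pos: "clock x > 0"
  using lam by (simp add: clock_def)

lemma clock_lower: "clock x \<ge> exp (low - 1 / 2) / sqrt (2 * lam)"
  unfolding clock_def using S_bounds(1)[of x] B_bound[of x] lam
  by (intro divide_right_mono) auto

lemma clock_speed: "clock x * speed x = exp (S x)"
proof -
  have "exp (S x + B x / 2) * exp (- B x / 2) = exp (S x)" by (simp flip: exp_add)
  then show ?thesis using lam by (simp add: clock_def speed_def)
qed

lemma continuous_SB: "continuous_on UNIV S" "continuous_on UNIV B"
  using DERIV_isCont[OF dS] DERIV_isCont[OF dB] by (auto intro: continuous_at_imp_continuous_on)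

lemma continuous_clock: "continuous_on UNIV clock"
  unfolding clock_def[abs_def] using lam by (intro continuous_intros continuous_SB) auto

lemma continuous_rad: "continuous_on UNIV rad"
  unfolding rad_def[abs_def] by (intro continuous_intros continuous_SB)

lemma rad_has_derivative: "(rad has_real_derivative clock x * rad_vel x) (at x)"
proof -
  have "clock x * rad_vel x = exp (S x) * (Q x * cos x - sin x)"
    unfolding rad_vel_def mult.assoc[symmetric] clock_speed ..
  then show ?thesis unfolding rad_def[abs_def]
    by (auto intro!: derivative_eq_intros dS simp: algebra_simps)
qed

lemma hgt_has_derivative: "(hgt has_real_derivative clock x * hgt_vel x) (at x)"
proof -
  have "clock x * hgt_vel x = exp (S x) * (Q x * sin x + cos x)"
    unfolding hgt_vel_def mult.assoc[symmetric] clock_speed ..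
  then show ?thesis unfolding hgt_def[abs_def]
    by (auto intro!: derivative_eq_intros dS simp: algebra_simps)
qed

lemma speed_has_derivative:
  "(speed has_real_derivative - speed x * (Q x + exp (B x) * torque_defect (K\<^sup>2 / lam) (S x) x)) (at x)"
  unfolding speed_def[abs_def]
  by (auto intro!: derivative_eq_intros dB simp: algebra_simps)

lemma clock_lam: "clock x * lam = speed x * exp (B x) * (exp (S x) / 2)"
proof -
  define w where "w = sqrt (2 * lam)"
  have w: "w > 0" "lam = w * w / 2" using lam by (auto simp: w_def)
  have "exp (- B x / 2) * exp (B x) * exp (S x) = exp (S x + B x / 2)"
    by (simp add: mult_exp_exp)
  then have "w * exp (- B x / 2) * exp (B x) * (exp (S x) / 2) = w / 2 * exp (S x + B x / 2)"
    by (metis (no_types, opaque_lifting) mult.assoc times_divide_eq_left times_divide_eq_right)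
  moreover have "exp (S x + B x / 2) / w * (w * w / 2) = w / 2 * exp (S x + B x / 2)"
    using w(1) by simp
  ultimately show ?thesis
    unfolding clock_def speed_def w_def[symmetric] by (simp only: w(2)[symmetric])
qed

text \<open>The equations for \<open>q\<close> and \<open>b\<close> are designed so that everything but the force cancels here. The
  defects are the polar components of the force, so rotating them back by the angle \<open>x\<close> returns
  the Cartesian components.\<close>

lemma rad_vel_has_derivative:
  "(rad_vel has_real_derivative clock x * (K\<^sup>2 / rad x ^ 3 - lam * ring_force_r (rad x) (hgt x))) (at x)"
proof -
  let ?G = "radial_defect (K\<^sup>2 / lam) (S x) x" and ?H = "torque_defect (K\<^sup>2 / lam) (S x) x"
  let ?W = "ring_force_r (rad x) (hgt x) - (K\<^sup>2 / lam) / rad x ^ 3"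
  have "(rad_vel has_real_derivative - speed x * (Q x + exp (B x) * ?H) * (Q x * cos x - sin x)
     + speed x * ((1 + (Q x)\<^sup>2 - exp (B x) * (1 + ?G - Q x * ?H)) * cos x - Q x * sin x - cos x)) (at x)"
    unfolding rad_vel_def[abs_def]
    by (auto intro!: derivative_eq_intros speed_has_derivative dQ simp: algebra_simps)
  also have "- speed x * (Q x + exp (B x) * ?H) * (Q x * cos x - sin x)
     + speed x * ((1 + (Q x)\<^sup>2 - exp (B x) * (1 + ?G - Q x * ?H)) * cos x - Q x * sin x - cos x)
     = - (speed x * exp (B x)) * ((1 + ?G) * cos x - ?H * sin x)"
    by (rule radial_identity)
  also have "(1 + ?G) * cos x - ?H * sin x = exp (S x) / 2 * ?W"
    unfolding radial_defect_def torque_defect_def Let_def rad_def[symmetric] hgt_def[symmetric]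
    by (rule rotation_identity) simp
  also have "- (speed x * exp (B x)) * (exp (S x) / 2 * ?W) = - (clock x * lam) * ?W"
    unfolding clock_lam by simp
  also have "\<dots> = clock x * (K\<^sup>2 / rad x ^ 3 - lam * ring_force_r (rad x) (hgt x))"
    using lam by (simp add: algebra_simps)
  finally show ?thesis .
qed

lemma hgt_vel_has_derivative:
  "(hgt_vel has_real_derivative clock x * (- lam * ring_force_z (rad x) (hgt x))) (at x)"
proof -
  let ?G = "radial_defect (K\<^sup>2 / lam) (S x) x" and ?H = "torque_defect (K\<^sup>2 / lam) (S x) x"
  let ?V = "ring_force_z (rad x) (hgt x)"
  have "(hgt_vel has_real_derivative - speed x * (Q x + exp (B x) * ?H) * (Q x * sin x + cos x)
     + speed x * ((1 + (Q x)\<^sup>2 - exp (B x) * (1 + ?G - Q x * ?H)) * sin x + Q x * cos x - sin x)) (at x)"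
    unfolding hgt_vel_def[abs_def]
    by (auto intro!: derivative_eq_intros speed_has_derivative dQ simp: algebra_simps)
  also have "- speed x * (Q x + exp (B x) * ?H) * (Q x * sin x + cos x)
     + speed x * ((1 + (Q x)\<^sup>2 - exp (B x) * (1 + ?G - Q x * ?H)) * sin x + Q x * cos x - sin x)
     = - (speed x * exp (B x)) * ((1 + ?G) * sin x + ?H * cos x)"
    by (rule vertical_identity)
  also have "(1 + ?G) * sin x + ?H * cos x = exp (S x) / 2 * ?V"
    unfolding radial_defect_def torque_defect_def Let_def rad_def[symmetric] hgt_def[symmetric]
    by (rule rotation_identity) simp
  also have "- (speed x * exp (B x)) * (exp (S x) / 2 * ?V) = - (clock x * lam) * ?V"
    unfolding clock_lam by simp
  also have "\<dots> = clock x * (- lam * ring_force_z (rad x) (hgt x))" by simp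
  finally show ?thesis .
qed

lemma off_circle: "(rad x, hgt x) \<noteq> (1, 0)"
proof
  assume "(rad x, hgt x) = (1, 0)"
  then have "cos x = 0" "sin x = 0" by (auto simp: rad_def hgt_def)
  then show False using sin_cos_squared_add[of x] by simp
qed

lemma projection_graph: "(rad x, hgt x) = polar_graph (\<lambda>x. exp (S x)) x"
  by (simp add: rad_def hgt_def polar_graph_def)

text \<open>The rotation condition makes the azimuth increase by \<open>2 * pi\<close>, up to sign, during \<open>n\<close> turns around
  the pole. In space, the azimuthal acceleration vanishes because the angular velocity is
  \<open>K / r\<^sup>2\<close>, and the centripetal term cancels the centrifugal force in the reduced equations.\<close>

theorem spiral_periodic_orbit_exists:
  assumes n: "n > 0"
    and rot: "\<bar>K\<bar> * integral {0..2 * pi} (\<lambda>x. clock x / (rad x)\<^sup>2) = 2 * pi / real n"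
  shows "\<exists>q. spiral_periodic_orbit lam q
    \<and> (\<forall>t. angular_momentum q t = K)
    \<and> (\<forall>t. infdist (q t) unit_circle \<le> \<epsilon>)
    \<and> simple_closed_curve (range (canonical_projection q))
    \<and> (\<lambda>(r, z). (r, - z)) ` range (canonical_projection q) = range (canonical_projection q)
    \<and> (1, 0) \<in> inside (range (canonical_projection q))"
proof -
  have rne: "rad x \<noteq> 0" for x using rad_pos[of x] by linarith
  obtain \<tau> where \<tau>: "\<And>x. (\<tau> has_vector_derivative clock x) (at x)"
    using antiderivative_on_line[OF continuous_clock] by blast
  have ck: "continuous_on UNIV (\<lambda>x. K * (clock x / (rad x)\<^sup>2))"
    by (intro continuous_intros continuous_clock continuous_rad) (use rne in auto)
  obtain \<phi> where \<phi>: "\<And>x. (\<phi> has_vector_derivative K * (clock x / (rad x)\<^sup>2)) (at x)"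
    using antiderivative_on_line[OF ck] by blast
  have \<tau>': "(\<tau> has_real_derivative clock x) (at x)" for x
    using \<tau> by (simp add: has_real_derivative_iff_has_vector_derivative)
  have \<phi>': "(\<phi> has_real_derivative clock x * (K / (rad x)\<^sup>2)) (at x)" for x
    using \<phi>[of x] by (simp add: has_real_derivative_iff_has_vector_derivative mult_ac)
  obtain \<theta> where \<theta>: "\<And>t. \<tau> (\<theta> t) = t" "\<And>x. \<theta> (\<tau> x) = x"
    and d\<theta>: "\<And>t. (\<theta> has_real_derivative 1 / clock (\<theta> t)) (at t)"
    using real_inverse_function[OF \<tau>' _ clock_lower] lam by auto
  \<comment> \<open>Passing from the polar angle to time removes the factor \<open>clock\<close>.\<close>
  have chain: "((\<lambda>t. f (\<theta> t)) has_real_derivative y (\<theta> t)) (at t)"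
    if "\<And>x. (f has_real_derivative clock x * y x) (at x)" for f y t
    using DERIV_chain2[OF that d\<theta>[of t]] clock_pos[of "\<theta> t"] by simp
  define pos where "pos x = (vector [rad x * cos (\<phi> x), rad x * sin (\<phi> x), hgt x] :: real^3)" for x
  define vel where "vel x = (vector [rad_vel x * cos (\<phi> x) - K / rad x * sin (\<phi> x),
      rad_vel x * sin (\<phi> x) + K / rad x * cos (\<phi> x), hgt_vel x] :: real^3)" for x
  define acc where "acc x = (vector [- (lam * ring_force_r (rad x) (hgt x) * cos (\<phi> x)),
      - (lam * ring_force_r (rad x) (hgt x) * sin (\<phi> x)), - lam * ring_force_z (rad x) (hgt x)] :: real^3)" for x
  define q where "q t = pos (\<theta> t)" for t
  have q': "(q has_vector_derivative vel (\<theta> t)) (at t)" for t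
    unfolding q_def[abs_def] pos_def vel_def
  proof (intro vector_3_has_vector_derivative chain)
    fix x
    show "((\<lambda>x. rad x * cos (\<phi> x)) has_real_derivative clock x * (rad_vel x * cos (\<phi> x) - K / rad x * sin (\<phi> x))) (at x)"
      "((\<lambda>x. rad x * sin (\<phi> x)) has_real_derivative clock x * (rad_vel x * sin (\<phi> x) + K / rad x * cos (\<phi> x))) (at x)"
      using rne[of x] by (auto intro!: derivative_eq_intros rad_has_derivative \<phi>' simp: field_simps power2_eq_square)
    show "(hgt has_real_derivative clock x * hgt_vel x) (at x)"
      by (rule hgt_has_derivative)
  qed
  have v': "((\<lambda>t. vel (\<theta> t)) has_vector_derivative acc (\<theta> t)) (at t)" for t
    unfolding vel_def acc_def
  proof (intro vector_3_has_vector_derivative chain)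
    fix x
    show "((\<lambda>x. rad_vel x * cos (\<phi> x) - K / rad x * sin (\<phi> x)) has_real_derivative
        clock x * - (lam * ring_force_r (rad x) (hgt x) * cos (\<phi> x))) (at x)"
      "((\<lambda>x. rad_vel x * sin (\<phi> x) + K / rad x * cos (\<phi> x)) has_real_derivative
        clock x * - (lam * ring_force_r (rad x) (hgt x) * sin (\<phi> x))) (at x)"
      using rne[of x] by (auto intro!: derivative_eq_intros rad_has_derivative rad_vel_has_derivative \<phi>'
          simp: field_simps power2_eq_square power3_eq_cube)
    show "(hgt_vel has_real_derivative clock x * (- lam * ring_force_z (rad x) (hgt x))) (at x)"
      by (rule hgt_vel_has_derivative)
  qed
  have orbit: "orbit lam q"
    unfolding orbit_def
  proof (intro exI allI conjI)
    fix t
    show "(q has_vector_derivative vel (\<theta> t)) (at t)" by (rule q')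
    show "((\<lambda>t. vel (\<theta> t)) has_vector_derivative acc (\<theta> t)) (at t)" by (rule v')
    show "q t \<notin> unit_circle"
    proof
      assume "q t \<in> unit_circle"
      then have "(rad (\<theta> t))\<^sup>2 = 1" "hgt (\<theta> t) = 0"
        by (auto simp: unit_circle_def q_def pos_def sum_squares_polar)
      then show False using off_circle[of "\<theta> t"] rad_pos[of "\<theta> t"] by (auto simp: power2_eq_1_iff)
    qed
    show "GDERIV (potential lam) (q t) :> - acc (\<theta> t)"
      unfolding q_def pos_def
      by (rule GDERIV_subst[OF potential_gradient_cylindrical])
        (use rad_pos[of "\<theta> t"] off_circle[of "\<theta> t"] in \<open>auto simp: acc_def vec_eq_iff forall_3\<close>)
  qed
  have L: "q t $ 1 * vel (\<theta> t) $ 2 - q t $ 2 * vel (\<theta> t) $ 1 = K" for t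
  proof -
    have moment: "r * c * (a * s + K / r * c) - r * s * (a * c - K / r * s) = K * (c * c + s * s)"
      if "r \<noteq> 0" for r c a s :: real
      using that by (simp add: field_simps)
    show ?thesis
      unfolding q_def pos_def vel_def using moment[OF rne[of "\<theta> t"]] by simp
  qed
  have am: "angular_momentum q t = K" for t
    using L[of t] by (simp add: angular_momentum_def vector_derivative_at[OF q'])
  have proj: "canonical_projection q t = polar_graph (\<lambda>x. exp (S x)) (\<theta> t)" for t
    using rad_pos[of "\<theta> t"]
    by (simp add: canonical_projection_def q_def pos_def sum_squares_polar flip: projection_graph)
  have "range \<theta> = UNIV" using \<theta>(2) by (metis surj_def)
  then have range: "range (canonical_projection q) = range (polar_graph (\<lambda>x. exp (S x)))"
    unfolding proj[abs_def] by (metis image_image)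
  have clock_per: "clock (x + 2 * pi) = clock x" and rad_per: "rad (x + 2 * pi) = rad x"
    and hgt_per: "hgt (x + 2 * pi) = hgt x" for x
    by (simp_all add: clock_def rad_def hgt_def S_periodic B_periodic)
  define T where "T = \<tau> (2 * pi) - \<tau> 0"
  \<comment> \<open>One turn takes the time \<open>T\<close> and rotates the meridian plane by \<open>\<Delta>\<close>.\<close>
  define \<Delta> where "\<Delta> = \<phi> (2 * pi) - \<phi> 0"
  have \<tau>_shift: "\<tau> (x + 2 * pi) = \<tau> x + T" for x
    using increment_over_period_constant[of \<tau> clock "2 * pi" x, OF \<tau> clock_per] by (simp add: T_def)
  have \<phi>_shift: "\<phi> (x + 2 * pi) = \<phi> x + \<Delta>" for x
    using increment_over_period_constant[of \<phi> "\<lambda>x. K * (clock x / (rad x)\<^sup>2)" "2 * pi" x, OF \<phi>]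
    by (simp add: \<Delta>_def clock_per rad_per)
  have "T > 0"
    unfolding T_def using DERIV_pos_imp_increasing[of 0 "2 * pi" \<tau>] \<tau>' clock_pos by fastforce
  have \<theta>_shift: "\<theta> (t + T) = \<theta> t + 2 * pi" for t
    using \<tau>_shift[of "\<theta> t"] \<theta> by metis
  have \<theta>_shifts: "\<theta> (t + real m * T) = \<theta> t + real m * (2 * pi)" for t m
  proof (induction m)
    case (Suc m)
    have "\<theta> (t + real (Suc m) * T) = \<theta> ((t + real m * T) + T)" by (simp add: algebra_simps)
    then show ?case unfolding \<theta>_shift Suc by (simp add: algebra_simps)
  qed simp
  have shifts: "\<phi> (x + real m * (2 * pi)) = \<phi> x + real m * \<Delta> \<and> rad (x + real m * (2 * pi)) = rad x
     \<and> hgt (x + real m * (2 * pi)) = hgt x" for x m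
  proof (induction m)
    case (Suc m)
    have e: "x + real (Suc m) * (2 * pi) = (x + real m * (2 * pi)) + 2 * pi" by (simp add: algebra_simps)
    show ?case unfolding e \<phi>_shift rad_per hgt_per using Suc by (simp add: algebra_simps)
  qed simp
  have "\<Delta> = K * integral {0..2 * pi} (\<lambda>x. clock x / (rad x)\<^sup>2)"
    using integral_eq_increment[OF \<phi>, of 0 "2 * pi"] unfolding integral_mult_right \<Delta>_def by simp
  then have "\<bar>real n * \<Delta>\<bar> = real n * \<bar>\<bar>K\<bar> * integral {0..2 * pi} (\<lambda>x. clock x / (rad x)\<^sup>2)\<bar>"
    by (simp add: abs_mult)
  also have "\<dots> = 2 * pi" unfolding rot using n by simp
  finally have "real n * \<Delta> = 2 * pi \<or> real n * \<Delta> = - (2 * pi)" by linarith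
  then have turn: "cos (y + real n * \<Delta>) = cos y" "sin (y + real n * \<Delta>) = sin y" for y
    using cos_periodic[of "y - 2 * pi"] sin_periodic[of "y - 2 * pi"] by auto
  have q_per: "q (t + real n * T) = q t" for t
    unfolding q_def pos_def \<theta>_shifts using shifts[of "\<theta> t" n] by (simp add: turn)
  have "periodic q"
    unfolding periodic_def using n \<open>T > 0\<close> q_per
    by (intro exI[of _ "real n * T"] conjI) (auto simp: periodic_fun_simple_def)
  moreover have "periodic (canonical_projection q)"
    unfolding periodic_def
  proof (intro exI[of _ T] conjI \<open>T > 0\<close>)
    show "periodic_fun_simple (canonical_projection q) T"
      by standard (simp add: proj \<theta>_shift polar_graph_def S_periodic)
  qed
  moreover have "\<not> (\<exists>P. vertical_plane P \<and> range q \<subseteq> P)"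
    by (rule not_in_vertical_plane[OF q'[of 0]]) (use L K in auto)
  ultimately have spiral: "spiral_periodic_orbit lam q"
    using orbit by (simp add: spiral_periodic_orbit_def spiral_orbit_def)
  have near: "infdist (q t) unit_circle \<le> \<epsilon>" for t
  proof -
    let ?x = "\<theta> t"
    have "infdist (q t) unit_circle \<le> dist (q t) (circle_param (\<phi> ?x))"
      by (rule infdist_le[OF circle_param_in_unit_circle])
    also have "\<dots> = ring_dist (rad ?x) (hgt ?x) 0"
      unfolding dist_norm q_def pos_def norm_cylindrical_diff_circle by simp
    also have "\<dots> = sqrt ((exp (S ?x))\<^sup>2)"
      unfolding ring_dist_def
    proof (rule arg_cong[of _ _ sqrt])
      have "(rad ?x)\<^sup>2 + 1 - 2 * rad ?x * cos 0 + (hgt ?x)\<^sup>2 = (exp (S ?x) * cos ?x)\<^sup>2 + (exp (S ?x) * sin ?x)\<^sup>2"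
        by (simp add: rad_def hgt_def power2_eq_square algebra_simps)
      then show "(rad ?x)\<^sup>2 + 1 - 2 * rad ?x * cos 0 + (hgt ?x)\<^sup>2 = (exp (S ?x))\<^sup>2"
        unfolding sum_squares_polar .
    qed
    also have "\<dots> \<le> \<epsilon>" using S_bounds(3)[of ?x] by simp
    finally show ?thesis .
  qed
  have R: "continuous_on UNIV (\<lambda>x. exp (S x))" "\<And>x. exp (S x) > 0" "\<And>x. exp (S (x + 2 * pi)) = exp (S x)"
    by (auto intro!: continuous_intros continuous_SB simp: S_periodic)
  show ?thesis
  proof (intro exI[of _ q] conjI allI spiral am near)
    show "simple_closed_curve (range (canonical_projection q))"
      unfolding range simple_closed_curve_def by (rule polar_graph_closed_curve[OF R])
    show "(\<lambda>(r, z). (r, - z)) ` range (canonical_projection q) = range (canonical_projection q)"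
      unfolding range by (rule polar_graph_symmetric[OF R]) (simp add: S_even)
    show "(1, 0) \<in> inside (range (canonical_projection q))"
      unfolding range by (rule polar_graph_encloses[OF R])
  qed
qed

end

section \<open>Commensurable rotation\<close>

text \<open>A uniform Lipschitz condition in one variable upgrades separate continuity to joint
  continuity.\<close>

lemma continuous_on_lipschitz_family:
  fixes f :: "real \<Rightarrow> real \<Rightarrow> real"
  assumes lip: "\<And>\<sigma> \<tau> x. \<sigma> \<in> A \<Longrightarrow> \<tau> \<in> A \<Longrightarrow> \<bar>f \<sigma> x - f \<tau> x\<bar> \<le> L * \<bar>\<sigma> - \<tau>\<bar>"
    and cont: "\<And>\<sigma>. \<sigma> \<in> A \<Longrightarrow> continuous_on UNIV (f \<sigma>)"
  shows "continuous_on (A \<times> X) (\<lambda>y. f (fst y) (snd y))"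
  unfolding continuous_on_def
proof
  fix y assume "y \<in> A \<times> X"
  then have \<sigma>: "fst y \<in> A" by auto
  let ?F = "at y within A \<times> X"
  have f: "((\<lambda>z. fst z) \<longlongrightarrow> fst y) ?F" "((\<lambda>z. snd z) \<longlongrightarrow> snd y) ?F"
    by (auto intro!: tendsto_intros)
  have "((\<lambda>z. f (fst y) (snd z)) \<longlongrightarrow> f (fst y) (snd y)) ?F"
    using cont[OF \<sigma>] f(2) by (auto simp: continuous_on_eq_continuous_at intro: isCont_tendsto_compose)
  moreover have "((\<lambda>z. f (fst z) (snd z) - f (fst y) (snd z)) \<longlongrightarrow> 0) ?F"
  proof (rule Lim_null_comparison)
    show "\<forall>\<^sub>F z in ?F. norm (f (fst z) (snd z) - f (fst y) (snd z)) \<le> L * \<bar>fst z - fst y\<bar>"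
      unfolding eventually_at_filter using lip \<sigma> by (auto intro!: always_eventually)
    show "((\<lambda>z. L * \<bar>fst z - fst y\<bar>) \<longlongrightarrow> 0) ?F"
      using f(1) by (auto intro!: tendsto_eq_intros)
  qed
  ultimately show "((\<lambda>z. f (fst z) (snd z)) \<longlongrightarrow> f (fst y) (snd y)) ?F"
    using tendsto_add by fastforce
qed

theorem theoremC:
  fixes lam \<epsilon> K :: real
  assumes "lam > 0" and "\<epsilon> > 0" and "K \<noteq> 0"
  shows "\<exists>q. spiral_periodic_orbit lam q
    \<and> (\<forall>t. angular_momentum q t = K)
    \<and> (\<forall>t. infdist (q t) unit_circle \<le> \<epsilon>)
    \<and> simple_closed_curve (range (canonical_projection q))
    \<and> (\<lambda>(r, z). (r, - z)) ` range (canonical_projection q) = range (canonical_projection q)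
    \<and> (1, 0) \<in> inside (range (canonical_projection q))"
proof -
  define k where "k = K\<^sup>2 / lam"
  have k: "k \<ge> 0" using assms by (simp add: k_def)
  note O = oscillation_norm_pos
  \<comment> \<open>The largest constants with which the hypotheses of the fixed point argument hold.\<close>
  define \<eta> where "\<eta> = min 1 (1 / (40 * oscillation_norm))"
  have \<eta>: "0 < \<eta>" "\<eta> \<le> 1" "\<eta> \<le> 1 / (40 * oscillation_norm)" using O by (auto simp: \<eta>_def)
  define \<kappa> where "\<kappa> = min (1 / (600 * oscillation_norm)) (\<eta> / (8 * oscillation_norm))"
  have \<kappa>: "0 < \<kappa>" "\<kappa> \<le> 1 / (600 * oscillation_norm)" "\<kappa> \<le> \<eta> / (8 * oscillation_norm)"
    using O \<eta>(1) by (auto simp: \<kappa>_def)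
  obtain s0 where s0: "exp s0 \<le> 1 / 2" "exp s0 \<le> \<epsilon>"
    and small: "\<And>x. small_lip \<kappa> s0 (\<lambda>s. radial_defect k s x)" "\<And>x. small_lip \<kappa> s0 (\<lambda>s. torque_defect k s x)"
    using defects_small[OF k \<kappa>(1) \<open>\<epsilon> > 0\<close>] by metis
  have lt1: "exp s < 1" if "s \<le> s0" for s
  proof -
    have "exp s \<le> exp s0" using that by simp
    then show ?thesis using s0(1) by linarith
  qed
  interpret near_logarithmic "radial_defect k" "torque_defect k" s0 \<kappa> \<eta>
  proof
    show "continuous_on UNIV (\<lambda>x. radial_defect k (f x) x)" "continuous_on UNIV (\<lambda>x. torque_defect k (f x) x)"
      if "continuous_on UNIV f" "\<And>x. f x \<le> s0" for f
      using that lt1 by (auto intro!: continuous_on_defects continuous_on_id)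
    show "oscillation_norm * (10 * \<eta>) \<le> 1 / 4" "oscillation_norm * (150 * \<kappa>) \<le> 1 / 4"
      "oscillation_norm * (4 * \<kappa>) \<le> \<eta> / 2"
      using \<eta>(3) \<kappa>(2,3) O by (simp_all add: field_simps)
  qed (rule radial_defect_even torque_defect_odd radial_defect_periodic torque_defect_periodic
      small \<eta>(1) \<eta>(2))+
  define \<sigma>0 where "\<sigma>0 = s0 - 2 * pi * \<eta>"
  note family = family_solves_equations[folded \<sigma>0_def]
  note dS = family(1) and dQ = family(2) and dB = family(3) and per = family(4-6) and near = family(7,8)
    and lip = family_lipschitz[folded \<sigma>0_def]
  have Sle: "exp (family_s \<sigma> x) \<le> exp s0" if "\<sigma> \<le> \<sigma>0" for \<sigma> x
    using near(1)[OF that, of x] that by (simp add: \<sigma>0_def)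
  have sol: "polar_solution lam K (\<sigma> - 2 * pi * \<eta>) \<epsilon> (family_s \<sigma>) (family_q \<sigma>) (family_b \<sigma>)" if \<sigma>: "\<sigma> \<le> \<sigma>0" for \<sigma>
  proof
    fix x
    show "\<sigma> - 2 * pi * \<eta> \<le> family_s \<sigma> x" "- 1 \<le> family_b \<sigma> x"
      using near(1)[OF \<sigma>, of x] near(2)[OF \<sigma>, of x] \<eta>(2) by linarith+
    show "exp (family_s \<sigma> x) \<le> 1 / 2" "exp (family_s \<sigma> x) \<le> \<epsilon>" using Sle[OF \<sigma>, of x] s0 by linarith+
  qed (use assms dS[OF \<sigma>] dQ[OF \<sigma>] dB[OF \<sigma>] per[OF \<sigma>] in \<open>simp_all add: k_def\<close>)
  \<comment> \<open>Integrating \<open>rate \<sigma>\<close> over a turn gives the rotation per unit of angular momentum. It is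
    written out so that its joint continuity in \<open>\<sigma>\<close> and \<open>x\<close> can be seen.\<close>
  define rate where "rate \<sigma> x = exp (family_s \<sigma> x + family_b \<sigma> x / 2) / sqrt (2 * lam) / (1 + exp (family_s \<sigma> x) * cos x)\<^sup>2" for \<sigma> x
  have rate: "rate \<sigma> x = polar_solution.clock lam (family_s \<sigma>) (family_b \<sigma>) x / (polar_solution.rad (family_s \<sigma>) x)\<^sup>2" if "\<sigma> \<le> \<sigma>0" for \<sigma> x
    by (simp add: rate_def polar_solution.clock_def[OF sol[OF that]] polar_solution.rad_def[OF sol[OF that]])
  have r: "1 / 2 \<le> 1 + exp (family_s \<sigma> x) * cos x" "1 + exp (family_s \<sigma> x) * cos x \<le> 2" if "\<sigma> \<le> \<sigma>0" for \<sigma> x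
  proof -
    have "\<bar>exp (family_s \<sigma> x) * cos x\<bar> \<le> 1 / 2 * 1"
    proof (rule abs_mult_le)
      show "\<bar>exp (family_s \<sigma> x)\<bar> \<le> 1 / 2" using Sle[OF that, of x] s0(1) unfolding abs_exp_cancel by linarith
    qed simp
    then show "1 / 2 \<le> 1 + exp (family_s \<sigma> x) * cos x" "1 + exp (family_s \<sigma> x) * cos x \<le> 2" by linarith+
  qed
  define D where "D \<sigma> = integral {0..2 * pi} (rate \<sigma>)" for \<sigma>
  have cSB: "continuous_on UNIV (family_s \<sigma>)" "continuous_on UNIV (family_b \<sigma>)" if "\<sigma> \<le> \<sigma>0" for \<sigma>
    using polar_solution.continuous_SB[OF sol[OF that]] .
  have joint: "continuous_on ({..\<sigma>0} \<times> cbox 0 (2 * pi)) (\<lambda>(\<sigma>, x). rate \<sigma> x)"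
  proof -
    have c: "continuous_on ({..\<sigma>0} \<times> cbox 0 (2 * pi)) (\<lambda>y. family_s (fst y) (snd y))"
      "continuous_on ({..\<sigma>0} \<times> cbox 0 (2 * pi)) (\<lambda>y. family_b (fst y) (snd y))"
      by (rule continuous_on_lipschitz_family[where L = "1 + 2 * pi"]; use lip(1) cSB(1) in simp)
        (rule continuous_on_lipschitz_family[where L = 1]; use lip(2) cSB(2) in simp)
    have "1 + exp (family_s (fst y) (snd y)) * cos (snd y) \<noteq> 0" if "y \<in> {..\<sigma>0} \<times> cbox 0 (2 * pi)" for y
      using r(1)[of "fst y" "snd y"] that by auto
    then show ?thesis
      unfolding split_beta rate_def using assms
      by (intro continuous_intros c) auto
  qed
  have contD: "continuous_on {..\<sigma>0} D"
    using integral_continuous_on_param[OF joint] by (simp add: D_def)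
  have int: "rate \<sigma> integrable_on {0..2 * pi}" if "\<sigma> \<le> \<sigma>0" for \<sigma>
  proof (rule integrable_continuous_interval)
    show "continuous_on {0..2 * pi} (rate \<sigma>)"
    proof -
      have "continuous_on {0..2 * pi} (\<lambda>x. (\<sigma>, x))" by (intro continuous_intros)
      moreover have "(\<lambda>x. (\<sigma>, x)) ` {0..2 * pi} \<subseteq> {..\<sigma>0} \<times> cbox 0 (2 * pi)" using that by auto
      ultimately show ?thesis using continuous_on_compose2[OF joint] by fastforce
    qed
  qed
  let ?w = "sqrt (2 * lam)"
  have w: "?w > 0" using assms by simp
  have upper: "rate \<sigma> x \<le> 4 * (exp (\<sigma> + 2 * pi * \<eta> + 1) / ?w)" if \<sigma>: "\<sigma> \<le> \<sigma>0" for \<sigma> x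
  proof -
    have num: "exp (family_s \<sigma> x + family_b \<sigma> x / 2) / ?w \<le> exp (\<sigma> + 2 * pi * \<eta> + 1) / ?w"
      using near(1)[OF \<sigma>, of x] near(2)[OF \<sigma>, of x] \<eta>(2) w by (intro divide_right_mono) auto
    have den: "(1 / 2)\<^sup>2 \<le> (1 + exp (family_s \<sigma> x) * cos x)\<^sup>2"
      using r(1)[OF \<sigma>, of x] by (intro power_mono) auto
    have "rate \<sigma> x \<le> (exp (\<sigma> + 2 * pi * \<eta> + 1) / ?w) / (1 / 2)\<^sup>2"
      unfolding rate_def by (rule frac_le[OF _ num _ den]) (use w in simp_all)
    then show ?thesis by (simp add: power2_eq_square mult.commute)
  qed
  have lower: "exp (\<sigma> - 2 * pi * \<eta> - 1) / ?w / 4 \<le> rate \<sigma> x" if \<sigma>: "\<sigma> \<le> \<sigma>0" for \<sigma> x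
  proof -
    have num: "exp (\<sigma> - 2 * pi * \<eta> - 1) / ?w \<le> exp (family_s \<sigma> x + family_b \<sigma> x / 2) / ?w"
      using near(1)[OF \<sigma>, of x] near(2)[OF \<sigma>, of x] \<eta>(2) w by (intro divide_right_mono) auto
    have den: "(1 + exp (family_s \<sigma> x) * cos x)\<^sup>2 \<le> 2\<^sup>2" "0 < (1 + exp (family_s \<sigma> x) * cos x)\<^sup>2"
      using r[OF \<sigma>, of x] power_mono[of "1 + exp (family_s \<sigma> x) * cos x" 2 2] by auto
    have "exp (\<sigma> - 2 * pi * \<eta> - 1) / ?w / 2\<^sup>2 \<le> rate \<sigma> x"
      unfolding rate_def by (rule frac_le[OF _ num den(2,1)]) (use w in simp)
    then show ?thesis by simp
  qed
  have Dupper: "D \<sigma> \<le> 8 * pi * (exp (\<sigma> + 2 * pi * \<eta> + 1) / ?w)" if "\<sigma> \<le> \<sigma>0" for \<sigma>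
    using integral_le[OF int[OF that] integrable_const_ivl, of "4 * (exp (\<sigma> + 2 * pi * \<eta> + 1) / ?w)"] upper[OF that]
    by (simp add: D_def)
  have Dpos: "D \<sigma>0 > 0"
  proof -
    have "0 < 2 * pi * (exp (\<sigma>0 - 2 * pi * \<eta> - 1) / ?w / 4)" using w by simp
    also have "\<dots> \<le> D \<sigma>0"
      using integral_le[OF integrable_const_ivl int[of \<sigma>0], of "exp (\<sigma>0 - 2 * pi * \<eta> - 1) / ?w / 4"] lower[of \<sigma>0]
      by (simp add: D_def)
    finally show ?thesis .
  qed
  have ratio: "0 < 2 * pi / \<bar>K\<bar> / D \<sigma>0" using Dpos assms(3) by simp
  obtain n :: nat where n2: "2 * pi / \<bar>K\<bar> / D \<sigma>0 < real n"
    using reals_Archimedean2 by blast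
  have n: "n > 0" "2 * pi / \<bar>K\<bar> < real n * D \<sigma>0"
  proof -
    have "0 < real n" using ratio n2 by linarith
    then show "n > 0" by simp
    show "2 * pi / \<bar>K\<bar> < real n * D \<sigma>0" using n2 Dpos by (simp only: pos_divide_less_eq)
  qed
  \<comment> \<open>The number \<open>n\<close> is so large that one \<open>n\<close>-th of a full rotation is at most the rotation for
    \<open>\<sigma>0\<close>; a sufficiently small orbit, with parameter \<open>\<sigma>1\<close>, rotates by no more than that.\<close>
  define goal where "goal = 2 * pi / real n / \<bar>K\<bar>"
  have goal: "goal > 0" "goal \<le> D \<sigma>0"
  proof -
    show "goal > 0" using n(1) assms(3) by (simp add: goal_def)
    have "goal = 2 * pi / \<bar>K\<bar> / real n" by (simp add: goal_def)
    also have "\<dots> \<le> D \<sigma>0" using n by (simp only: pos_divide_le_eq of_nat_0_less_iff) (simp add: mult.commute)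
    finally show "goal \<le> D \<sigma>0" .
  qed
  define \<sigma>1 where "\<sigma>1 = min \<sigma>0 (ln (goal * ?w / (8 * pi)) - 2 * pi * \<eta> - 1)"
  have "D \<sigma>1 \<le> goal"
  proof -
    have pos: "goal * ?w / (8 * pi) > 0" using goal w by simp
    have "\<sigma>1 + 2 * pi * \<eta> + 1 \<le> ln (goal * ?w / (8 * pi))" by (simp add: \<sigma>1_def)
    then have "exp (\<sigma>1 + 2 * pi * \<eta> + 1) \<le> goal * ?w / (8 * pi)"
      using pos by (metis exp_le_cancel_iff exp_ln)
    then have "8 * pi * (exp (\<sigma>1 + 2 * pi * \<eta> + 1) / ?w) \<le> goal"
      using w by (simp add: field_simps)
    moreover have "\<sigma>1 \<le> \<sigma>0" by (simp add: \<sigma>1_def)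
    ultimately show ?thesis using Dupper[of \<sigma>1] by linarith
  qed
  then obtain \<sigma> where \<sigma>: "\<sigma> \<le> \<sigma>0" "D \<sigma> = goal"
    using IVT'[of D \<sigma>1 goal \<sigma>0] goal(2) continuous_on_subset[OF contD, of "{\<sigma>1..\<sigma>0}"]
    by (auto simp: \<sigma>1_def)
  have "(\<lambda>x. polar_solution.clock lam (family_s \<sigma>) (family_b \<sigma>) x / (polar_solution.rad (family_s \<sigma>) x)\<^sup>2)
      = rate \<sigma>"
    by (rule ext) (rule rate[OF \<sigma>(1), symmetric])
  moreover have "\<bar>K\<bar> * D \<sigma> = 2 * pi / real n"
    unfolding \<sigma>(2) goal_def using assms(3) by simp
  ultimately have "\<bar>K\<bar> * integral {0..2 * pi} (\<lambda>x. polar_solution.clock lam (family_s \<sigma>) (family_b \<sigma>) x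
      / (polar_solution.rad (family_s \<sigma>) x)\<^sup>2) = 2 * pi / real n"
    unfolding D_def by (simp only:)
  from polar_solution.spiral_periodic_orbit_exists[OF sol[OF \<sigma>(1)] n(1) this] show ?thesis .
qed

end
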